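(* Let $\mathcal{X}=\mathbb{T}^n$, let $R\in\mathrm{P}(\Omega)$ be the reversible Brownian motion on $\mathbb{T}^n$ with diffusion coefficient $a>0$, and let $\pi\in\mathrm{P}(\mathbb{T}^n\times\mathbb{T}^n)$ have both marginals equal to $\mathrm{vol}$. The entropy minimization problem $$H(P|R)\to\min;\qquad P\in\mathrm{P}(\Omega):\ P_t=\mathrm{vol}\ \ \forall\,0\le t\le1,\quad P_{01}=\pi$$ admits a unique solution if and only if $H(\pi|R_{01})<\infty$.
   Context: $\mathbb{T}^n=\mathbb{R}^n/[0,1]^n$ is the flat torus and $\mathrm{vol}$ its normalized volume measure. $\Omega=C([0,1],\mathbb{T}^n)$ with canonical process $X_t(\omega)=\omega_t$. For $Q\in\mathrm{P}(\Omega)$, $Q_t=(X_t)_\#Q$ and $Q_{01}=(X_0,X_1)_\#Q$. $R^x$ is the law of $x+\sqrt a\,B$ with $B$ a standard Brownian motion on $\mathbb{T}^n$ started at $0$, and $R=\int_{\mathbb{T}^n}R^x(\cdot)\,\mathrm{vol}(dx)$. The relative entropy of probability measures is $H(\mathsf q|\mathsf r)=\int\log(d\mathsf q/d\mathsf r)\,d\mathsf q\in[0,\infty]$, equal to $+\infty$ if $\mathsf q\not\ll\mathsf r$. A solution is a measure satisfying the constraints at which the infimum is attained and is finite. *)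

theory Defs
  imports "HOL-Probability.Probability"
begin

section \<open>The flat torus\<close>

definition int_lattice :: "(real ^ 'n) set" where
  "int_lattice = {z. \<forall>i. z $ i \<in> \<int>}"

definition lattice_rel :: "real ^ 'n \<Rightarrow> real ^ 'n \<Rightarrow> bool" where
  "lattice_rel x y \<longleftrightarrow> x - y \<in> int_lattice"

lemma int_lattice_zero [simp]: "0 \<in> int_lattice"
  by (simp add: int_lattice_def)

lemma int_lattice_add: "x \<in> int_lattice \<Longrightarrow> y \<in> int_lattice \<Longrightarrow> x + y \<in> int_lattice"
  by (simp add: int_lattice_def)

lemma int_lattice_diff: "x \<in> int_lattice \<Longrightarrow> y \<in> int_lattice \<Longrightarrow> x - y \<in> int_lattice"
  by (simp add: int_lattice_def)

lemma int_lattice_minus: "x \<in> int_lattice \<Longrightarrow> - x \<in> int_lattice"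
  by (simp add: int_lattice_def)

lemma closed_int_lattice: "closed (int_lattice :: (real ^ 'n) set)"
proof -
  have eq: "(int_lattice :: (real ^ 'n) set) = (\<Inter>i. (\<lambda>z. z $ i) -` \<int>)"
    by (auto simp: int_lattice_def)
  show ?thesis
    unfolding eq by (intro closed_INT ballI continuous_closed_vimage closed_Ints continuous_intros)
qed

lemma int_lattice_nonempty: "int_lattice \<noteq> {}"
  using int_lattice_zero by blast

quotient_type 'n torus = "real ^ 'n" / lattice_rel
  morphisms rep_torus torus_proj
proof (rule equivpI)
  show "reflp lattice_rel" by (auto simp: reflp_def lattice_rel_def)
  show "symp lattice_rel"
    unfolding symp_def lattice_rel_def by (metis int_lattice_minus minus_diff_eq)
  show "transp lattice_rel"
    unfolding transp_def lattice_rel_def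
    by (metis int_lattice_add diff_add_cancel add_diff_eq)
qed

lemma torus_proj_eq_iff: "torus_proj x = torus_proj y \<longleftrightarrow> x - y \<in> int_lattice"
  by (simp add: torus.abs_eq_iff lattice_rel_def)

lemma torus_proj_cases: obtains x where "X = torus_proj x"
  by (rule that[of "rep_torus X"]) (simp add: Quotient_abs_rep[OF Quotient_torus])

instantiation torus :: (finite) ab_group_add
begin

lift_definition zero_torus :: "'a torus" is 0 .

lift_definition plus_torus :: "'a torus \<Rightarrow> 'a torus \<Rightarrow> 'a torus" is "(+)"
  unfolding lattice_rel_def by (metis int_lattice_add add_diff_add)

lift_definition minus_torus :: "'a torus \<Rightarrow> 'a torus \<Rightarrow> 'a torus" is "(-)"
proof -
  fix x x' y y' :: "real ^ 'a"
  assume "lattice_rel x x'" "lattice_rel y y'"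
  then have "(x - x') - (y - y') \<in> int_lattice"
    unfolding lattice_rel_def by (rule int_lattice_diff)
  then show "lattice_rel (x - y) (x' - y')" by (simp add: lattice_rel_def algebra_simps)
qed

lift_definition uminus_torus :: "'a torus \<Rightarrow> 'a torus" is uminus
  unfolding lattice_rel_def by (metis int_lattice_minus minus_diff_minus)

instance
  by standard (transfer, simp add: lattice_rel_def algebra_simps)+

end

text \<open>The quotient metric: the distance from \<open>x - y\<close> to the lattice. It induces the
  quotient topology, see \<open>open_torus_iff\<close>.\<close>

instantiation torus :: (finite) metric_space
begin

lift_definition dist_torus :: "'a torus \<Rightarrow> 'a torus \<Rightarrow> real" is
  "\<lambda>x y. infdist (x - y) int_lattice"
proof -
  have le: "infdist u int_lattice \<le> infdist v int_lattice"
    if uv: "u - v \<in> int_lattice" for u v :: "real ^ 'a"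
  proof -
    have "infdist u int_lattice \<le> dist v z" if z: "z \<in> int_lattice" for z
    proof (rule infdist_le2)
      show "z + (u - v) \<in> int_lattice" using z uv by (rule int_lattice_add)
      show "dist u (z + (u - v)) \<le> dist v z" by (simp add: dist_norm algebra_simps)
    qed
    then show ?thesis
      unfolding infdist_notempty[OF int_lattice_nonempty, of v]
      by (intro cINF_greatest int_lattice_nonempty)
  qed
  fix x x' y y' :: "real ^ 'a"
  assume a: "lattice_rel x x'" "lattice_rel y y'"
  have "(x - y) - (x' - y') \<in> int_lattice"
    using int_lattice_diff[OF a[unfolded lattice_rel_def]] by (simp add: algebra_simps)
  moreover from int_lattice_minus[OF this] have "(x' - y') - (x - y) \<in> int_lattice" by simp
  ultimately show "infdist (x - y) int_lattice = infdist (x' - y') int_lattice"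
    using le by (intro antisym) auto
qed

definition uniformity_torus :: "('a torus \<times> 'a torus) filter" where
  "uniformity_torus = (INF e\<in>{0<..}. principal {(x, y). dist x y < e})"

definition open_torus :: "'a torus set \<Rightarrow> bool" where
  "open_torus U \<longleftrightarrow> (\<forall>x\<in>U. eventually (\<lambda>(x', y). x' = x \<longrightarrow> y \<in> U) uniformity)"

instance
proof
  fix x y z :: "'a torus"
  show "dist x y = 0 \<longleftrightarrow> x = y"
  proof transfer
    fix x y :: "real ^ 'a"
    show "infdist (x - y) int_lattice = 0 \<longleftrightarrow> lattice_rel x y"
      unfolding lattice_rel_def
      using in_closed_iff_infdist_zero[OF closed_int_lattice int_lattice_nonempty] by blast
  qed
  show "dist x y \<le> dist x z + dist y z"
  proof transfer
    fix x y z :: "real ^ 'a"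
    have *: "infdist (x - y) int_lattice \<le> dist (x - z) u + dist (y - z) v"
      if "u \<in> int_lattice" "v \<in> int_lattice" for u v
    proof (rule infdist_le2)
      show "u - v \<in> int_lattice" using that by (rule int_lattice_diff)
      have "(x - y) - (u - v) = ((x - z) - u) - ((y - z) - v)" by simp
      then show "dist (x - y) (u - v) \<le> dist (x - z) u + dist (y - z) v"
        unfolding dist_norm by (metis norm_triangle_ineq4)
    qed
    have "infdist (x - y) int_lattice - dist (x - z) u \<le> infdist (y - z) int_lattice"
      if "u \<in> int_lattice" for u
      unfolding infdist_notempty[OF int_lattice_nonempty, of "y - z"]
    proof (rule cINF_greatest[OF int_lattice_nonempty])
      fix v :: "real ^ 'a" assume "v \<in> int_lattice"
      from *[OF that this] show "infdist (x - y) int_lattice - dist (x - z) u \<le> dist (y - z) v"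
        by simp
    qed
    then have "infdist (x - y) int_lattice - infdist (y - z) int_lattice \<le> dist (x - z) u"
      if "u \<in> int_lattice" for u using that by (simp add: algebra_simps)
    then have "infdist (x - y) int_lattice - infdist (y - z) int_lattice \<le> infdist (x - z) int_lattice"
      unfolding infdist_notempty[OF int_lattice_nonempty, of "x - z"] by (intro cINF_greatest[OF int_lattice_nonempty])
    then show "infdist (x - y) int_lattice \<le> infdist (x - z) int_lattice + infdist (y - z) int_lattice"
      by simp
  qed
qed (simp_all add: uniformity_torus_def open_torus_def)

end

lemma torus_proj_add: "torus_proj (x + y) = torus_proj x + torus_proj y"
  by (simp add: plus_torus.abs_eq)

lemma dist_torus_proj: "dist (torus_proj x) (torus_proj y) = infdist (x - y) int_lattice"
  by (simp add: dist_torus.abs_eq)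

lemma dist_torus_proj_le: "dist (torus_proj x) (torus_proj y) \<le> dist x y"
  unfolding dist_torus_proj by (rule infdist_le2[of 0]) (auto simp: dist_norm)

lemma dist_torus_proj_lessD:
  assumes "dist (torus_proj x) (torus_proj y) < e"
  obtains y' where "torus_proj y' = torus_proj y" "dist x y' < e"
proof -
  have "\<exists>z\<in>int_lattice. dist (x - y) z < e"
    using assms unfolding dist_torus_proj infdist_notempty[OF int_lattice_nonempty]
    by (subst (asm) cINF_less_iff) (auto intro!: bdd_belowI2[of _ 0] int_lattice_nonempty)
  then obtain z where z: "z \<in> int_lattice" "dist (x - y) z < e" by blast
  show thesis
    by (rule that[of "y + z"]) (use z in \<open>auto simp: torus_proj_eq_iff dist_norm algebra_simps\<close>)
qed

lemma open_torus_iff: "open U \<longleftrightarrow> open (torus_proj -` U)"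
proof
  assume U: "open U"
  show "open (torus_proj -` U)"
    unfolding open_dist
  proof (intro ballI)
    fix x assume "x \<in> torus_proj -` U"
    then obtain e where "e > 0" "\<And>y. dist y (torus_proj x) < e \<Longrightarrow> y \<in> U"
      using U unfolding open_dist by auto
    then show "\<exists>e>0. \<forall>y. dist y x < e \<longrightarrow> y \<in> torus_proj -` U"
      by (meson dist_torus_proj_le le_less_trans vimageI2)
  qed
next
  assume U: "open (torus_proj -` U)"
  show "open U"
    unfolding open_dist
  proof (intro ballI)
    fix X assume X: "X \<in> U"
    obtain x where x: "X = torus_proj x" by (rule torus_proj_cases)
    then obtain e where e: "e > 0" "\<And>y. dist y x < e \<Longrightarrow> torus_proj y \<in> U"
      using U X unfolding open_dist by auto
    have "Y \<in> U" if "dist Y X < e" for Y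
    proof -
      obtain y where y: "Y = torus_proj y" by (rule torus_proj_cases)
      have "dist (torus_proj x) (torus_proj y) < e" using that x y by (simp add: dist_commute)
      then obtain y' where "torus_proj y' = torus_proj y" "dist x y' < e"
        by (rule dist_torus_proj_lessD)
      then show ?thesis using e(2)[of y'] y by (simp add: dist_commute)
    qed
    then show "\<exists>e>0. \<forall>y. dist y X < e \<longrightarrow> y \<in> U" using e(1) by blast
  qed
qed

lemma continuous_on_torus_proj [continuous_intros]:
  "continuous_on S f \<Longrightarrow> continuous_on S (\<lambda>x. torus_proj (f x))"
proof -
  have "continuous_on UNIV (torus_proj :: real ^ 'n \<Rightarrow> 'n torus)"
    by (auto simp: continuous_on_open_vimage open_torus_iff[symmetric])
  then show "continuous_on S f \<Longrightarrow> continuous_on S (\<lambda>x. torus_proj (f x))"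
    using continuous_on_compose2 by blast
qed

lemma continuous_on_torus_add [continuous_intros]:
  fixes f g :: "'b::topological_space \<Rightarrow> 'n::finite torus"
  assumes "continuous_on S f" "continuous_on S g"
  shows "continuous_on S (\<lambda>x. f x + g x)"
proof -
  have dist_add: "dist (a + b) (c + d) \<le> dist a c + dist b d" for a b c d :: "'n torus"
  proof -
    have translate: "dist (p + r) (q + r) = dist p q" for p q r :: "'n torus"
      by transfer simp
    have "dist (a + b) (c + d) \<le> dist (a + b) (c + b) + dist (c + b) (c + d)"
      by (rule dist_triangle)
    then show ?thesis using translate[of a b c] translate[of b c d] by (simp add: add.commute)
  qed
  show ?thesis
    unfolding continuous_on_def tendsto_iff
  proof (intro ballI allI impI)
    fix x and e :: real assume x: "x \<in> S" and e: "0 < e"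
    have "\<forall>\<^sub>F y in at x within S. dist (f y) (f x) < e / 2"
      and "\<forall>\<^sub>F y in at x within S. dist (g y) (g x) < e / 2"
      using assms x e unfolding continuous_on_def tendsto_iff by (meson half_gt_zero)+
    then show "\<forall>\<^sub>F y in at x within S. dist (f y + g y) (f x + g x) < e"
    proof eventually_elim
      case (elim y)
      then show ?case using dist_add[of "f y" "g y" "f x" "g x"] by linarith
    qed
  qed
qed

instance torus :: (finite) second_countable_topology
proof
  obtain B :: "(real ^ 'a) set set" where B: "countable B" "topological_basis B"
    using ex_countable_basis by blast
  have op: "open (torus_proj ` V)" if V: "open V" for V :: "(real ^ 'a) set"
  proof -
    have "torus_proj -` torus_proj ` V = (\<Union>z\<in>int_lattice. (+) z ` V)"
    proof (intro equalityI subsetI)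
      fix x assume "x \<in> torus_proj -` torus_proj ` V"
      then obtain v where "v \<in> V" "x - v \<in> int_lattice" by (auto simp: torus_proj_eq_iff)
      then show "x \<in> (\<Union>z\<in>int_lattice. (+) z ` V)"
        by (intro UN_I[of "x - v"]) (auto intro: image_eqI[of _ _ v])
    next
      fix x assume "x \<in> (\<Union>z\<in>int_lattice. (+) z ` V)"
      then obtain z v where zv: "z \<in> int_lattice" "v \<in> V" "x = z + v" by auto
      then have "torus_proj x = torus_proj v" by (simp add: torus_proj_eq_iff)
      then show "x \<in> torus_proj -` torus_proj ` V" using zv(2) by auto
    qed
    moreover have "open (\<Union>z\<in>int_lattice. (+) z ` V)"
      using V by (intro open_UN ballI open_translation)
    ultimately show ?thesis by (simp add: open_torus_iff)
  qed
  have "topological_basis ((`) torus_proj ` B)"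
  proof (rule topological_basisI)
    fix U assume "U \<in> (`) torus_proj ` B"
    then obtain V where "V \<in> B" "U = torus_proj ` V" by blast
    then show "open U" using op[OF topological_basis_open[OF B(2)]] by simp
  next
    fix U :: "'a torus set" and X assume U: "open U" "X \<in> U"
    obtain x where x: "X = torus_proj x" by (rule torus_proj_cases)
    have "open (torus_proj -` U)" using U(1) by (simp add: open_torus_iff)
    then obtain V where "V \<in> B" "x \<in> V" "V \<subseteq> torus_proj -` U"
      using B(2) U(2) x by (metis topological_basisE vimageI2)
    then show "\<exists>B'\<in>(`) torus_proj ` B. X \<in> B' \<and> B' \<subseteq> U"
      by (intro bexI[of _ "torus_proj ` V"]) (simp_all add: x image_subset_iff_subset_vimage)
  qed
  then show "\<exists>B :: 'a torus set set. countable B \<and> open = generate_topology B"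
    using B(1) topological_basis_imp_subbasis by (meson countable_image)
qed

definition torus_vol :: "'n::finite torus measure" where
  "torus_vol = distr (uniform_measure lborel (cbox 0 1)) borel torus_proj"

section \<open>Path space and Brownian motion\<close>

text \<open>\<open>C([0,1], T\<^sup>n)\<close>, with paths represented as functions that are \<open>undefined\<close> outside
  \<open>[0,1]\<close>. The sigma-algebra is the one generated by the canonical process, which is also the
  Borel sigma-algebra of uniform convergence.\<close>

definition path_set :: "(real \<Rightarrow> 'n::finite torus) set" where
  "path_set = {\<omega> \<in> extensional {0..1}. continuous_on {0..1} \<omega>}"

definition path_space :: "(real \<Rightarrow> 'n::finite torus) measure" where
  "path_space = restrict_space (\<Pi>\<^sub>M t\<in>{0..1}. borel) path_set"

definition std_brownian_motion :: "'m measure \<Rightarrow> (real \<Rightarrow> 'm \<Rightarrow> real ^ 'n::finite) \<Rightarrow> bool" where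
  "std_brownian_motion M B \<longleftrightarrow>
     prob_space M \<and>
     (\<forall>t\<in>{0..1}. B t \<in> borel_measurable M) \<and>
     (\<forall>w\<in>space M. B 0 w = 0 \<and> continuous_on {0..1} (\<lambda>t. B t w)) \<and>
     (\<forall>s t. 0 \<le> s \<and> s < t \<and> t \<le> 1 \<longrightarrow>
        distributed M lborel (\<lambda>w. B t w - B s w)
          (\<lambda>x. ennreal (\<Prod>i\<in>UNIV. normal_density 0 (sqrt (t - s)) (x $ i)))) \<and>
     (\<forall>(k::nat) \<tau>. (\<forall>i<k. \<tau> i < \<tau> (Suc i)) \<and> 0 \<le> \<tau> 0 \<and> \<tau> k \<le> 1 \<longrightarrow>
        prob_space.indep_vars M (\<lambda>_. borel) (\<lambda>i w. B (\<tau> (Suc i)) w - B (\<tau> i) w) {..<k})"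

text \<open>The path \<open>x + \<surd>a B\<close> on the torus: \<open>B\<close> is the lift to \<open>\<real>\<^sup>n\<close> of the Brownian motion on
  the torus, so it is scaled before it is projected.\<close>

definition torus_path ::
    "real \<Rightarrow> (real \<Rightarrow> 'm \<Rightarrow> real ^ 'n::finite) \<Rightarrow> 'n torus \<Rightarrow> 'm \<Rightarrow> real \<Rightarrow> 'n torus" where
  "torus_path a B x w = (\<lambda>t\<in>{0..1}. x + torus_proj (sqrt a *\<^sub>R B t w))"

definition brownian_law ::
    "real \<Rightarrow> 'm measure \<Rightarrow> (real \<Rightarrow> 'm \<Rightarrow> real ^ 'n::finite) \<Rightarrow> 'n torus
      \<Rightarrow> (real \<Rightarrow> 'n torus) measure" where
  "brownian_law a M B x = distr M path_space (torus_path a B x)"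

definition reversible_brownian_law ::
    "real \<Rightarrow> 'm measure \<Rightarrow> (real \<Rightarrow> 'm \<Rightarrow> real ^ 'n::finite) \<Rightarrow> (real \<Rightarrow> 'n torus) measure" where
  "reversible_brownian_law a M B = torus_vol \<bind> brownian_law a M B"

definition marginal :: "(real \<Rightarrow> 'n::finite torus) measure \<Rightarrow> real \<Rightarrow> 'n torus measure" where
  "marginal Q t = distr Q borel (\<lambda>\<omega>. \<omega> t)"

definition endpoint_law :: "(real \<Rightarrow> 'n::finite torus) measure \<Rightarrow> ('n torus \<times> 'n torus) measure" where
  "endpoint_law Q = distr Q (borel \<Otimes>\<^sub>M borel) (\<lambda>\<omega>. (\<omega> 0, \<omega> 1))"

section \<open>The entropy minimization problem\<close>

text \<open>\<open>rel_entropy q r\<close> is \<open>H(q|r)\<close>; note that \<open>KL_divergence\<close> takes the reference measure first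
  and that its Bochner integral is \<open>0\<close> when the integrand is not integrable. For probability
  measures the negative part of \<open>log (dq/dr)\<close> is always \<open>q\<close>-integrable (as \<open>s log s \<ge> -1/e\<close>),
  so non-integrability means that the integral is \<open>+\<infinity>\<close>.\<close>

definition rel_entropy :: "'a measure \<Rightarrow> 'a measure \<Rightarrow> ereal" where
  "rel_entropy q r =
     (if absolutely_continuous r q \<and> integrable q (entropy_density (exp 1) r q)
      then ereal (KL_divergence (exp 1) r q) else \<infinity>)"

definition admissible ::
    "('n::finite torus \<times> 'n torus) measure \<Rightarrow> (real \<Rightarrow> 'n torus) measure set" where
  "admissible \<pi> = {P. prob_space P \<and> sets P = sets path_space \<and>
     (\<forall>t\<in>{0..1}. marginal P t = torus_vol) \<and> endpoint_law P = \<pi>}"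

definition is_solution ::
    "(real \<Rightarrow> 'n::finite torus) measure \<Rightarrow> ('n torus \<times> 'n torus) measure
      \<Rightarrow> (real \<Rightarrow> 'n torus) measure \<Rightarrow> bool" where
  "is_solution R \<pi> P \<longleftrightarrow> P \<in> admissible \<pi> \<and>
     rel_entropy P R = (INF Q\<in>admissible \<pi>. rel_entropy Q R) \<and> rel_entropy P R < \<infinity>"

end

theory Submission
  imports Defs "HOL-Real_Asymp.Real_Asymp"
begin

text \<open>
  Necessity is the data processing inequality for the endpoint map.

  For sufficiency, an admissible \<open>P\<close> of finite entropy is obtained by reweighting \<open>R\<close> at the
  times \<open>0\<close>, \<open>1/2\<close>, \<open>1\<close> only: its density is \<open>f(X\<^sub>0, X\<^sub>1) k\<^sub>1(X\<^sub>1\<^sub>/\<^sub>2 - X\<^sub>0) k\<^sub>2(X\<^sub>1 - X\<^sub>1\<^sub>/\<^sub>2)\<close>, where \<open>f\<close> is the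
  density of \<open>\<pi>\<close> with respect to \<open>vol \<otimes> vol\<close> and \<open>k\<^sub>1\<close>, \<open>k\<^sub>2\<close> are the reciprocals of the densities of the
  two increments. Under \<open>P\<close> the triple \<open>(X\<^sub>0, X\<^sub>1\<^sub>/\<^sub>2, X\<^sub>1)\<close> has law \<open>\<pi> \<otimes> vol\<close> up to the order of the
  coordinates. For \<open>t \<le> 1/2\<close> the displacement \<open>X\<^sub>t - X\<^sub>0\<close> is independent of \<open>(X\<^sub>0, X\<^sub>1)\<close>, for \<open>t \<ge> 1/2\<close> so is
  \<open>X\<^sub>1 - X\<^sub>t\<close>; as \<open>vol\<close> is translation invariant, all one-dimensional marginals are \<open>vol\<close>. The functions
  \<open>k\<^sub>1\<close>, \<open>k\<^sub>2\<close> and the density of \<open>R\<^sub>0\<^sub>1\<close> are bounded, hence the entropy is finite.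

  The constraints fix the probabilities of certain events, so a minimizing sequence can be treated
  as for Csiszar's I-projection: the convexity gap of the entropy controls the \<open>L\<^sup>1\<close> distance of the
  densities, the sequence is Cauchy in \<open>L\<^sup>1\<close>, and Fatou's lemma gives lower semicontinuity. The same
  gap gives uniqueness. No topology on the path space is used.
\<close>

section \<open>Relative entropy of densities\<close>

text \<open>The summand \<open>1 - s\<close> integrates to \<open>0\<close> against probability densities and makes \<open>ent\<close>
  nonnegative, so that Fatou's lemma applies. Note \<open>0 * ln 0 = 0\<close>.\<close>

definition ent :: "real \<Rightarrow> real" where
  "ent s = s * ln s - s + 1"

section \<open>Pointwise inequalities for the entropy integrand\<close>

lemma ent_0 [simp]: "ent 0 = 1"
  by (simp add: ent_def)

lemma measurable_ent [measurable]: "ent \<in> borel_measurable borel"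
  unfolding ent_def by measurable

text \<open>Fenchel-Young: \<open>exp t - 1\<close> is the convex conjugate of \<open>ent\<close>.
  The bound is \<open>1 + u \<le> exp u\<close> at \<open>u = t - ln s\<close>, multiplied by
  \<open>s\<close>; at \<open>s = 0\<close> only \<open>0 \<le> exp t\<close> is left.\<close>

lemma ent_young:
  assumes "0 \<le> s"
  shows "s * t \<le> ent s + exp t - 1"
proof (cases "s = 0")
  case False
  with assms have s: "s > 0" by simp
  have "exp t = s * exp (t - ln s)"
    using s by (simp add: exp_diff)
  moreover have "s * (1 + (t - ln s)) \<le> s * exp (t - ln s)"
    using s by (intro mult_left_mono exp_ge_add_one_self) auto
  ultimately show ?thesis by (simp add: ent_def algebra_simps)
qed simp

lemma ent_nonneg: "0 \<le> s \<Longrightarrow> 0 \<le> ent s"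
  using ent_young[of s 0] by simp

text \<open>Quantitative strict convexity. The passage from squared Hellinger distances to
  \<open>\<bar>a - b\<bar>\<close> is usually Cauchy-Schwarz after integration; the inequality
  \<open>2 * e * (p * q) \<le> p\<^sup>2 + e\<^sup>2 * q\<^sup>2\<close> with a free
  \<open>e\<close> does the same pointwise.\<close>

lemma abs_diff_le_ent_gap:
  fixes a b e :: real
  assumes a: "0 \<le> a" and b: "0 \<le> b" and e: "e > 0"
  defines "m \<equiv> (a + b) / 2"
  shows "\<bar>a - b\<bar> \<le> (ent a + ent b - 2 * ent m) / (2 * e) + 2 * e * (a + b)"
proof (cases "m = 0")
  case True
  then have "a = 0" "b = 0" using a b by (auto simp: m_def)
  then show ?thesis using True by simp
next
  case False
  then have m: "m > 0" using a b by (auto simp: m_def)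
  \<comment> \<open>This is \<open>ln y \<le> y - 1\<close> at \<open>y = sqrt (m / s)\<close>,
    times \<open>2 * s\<close>; the square root is what produces the cross term of a Hellinger
    distance. At \<open>s = 0\<close> both sides vanish.\<close>
  have log_ge: "2 * s - 2 * sqrt s * sqrt m \<le> s * ln s - s * ln m" if "0 \<le> s" for s
  proof (cases "s = 0")
    case False
    then have s: "s > 0" using that by simp
    have "ln (sqrt (m / s)) \<le> sqrt (m / s) - 1"
      using s m by (intro ln_le_minus_one) auto
    moreover have 1: "ln (sqrt (m / s)) = (ln m - ln s) / 2"
      using s m by (simp add: ln_sqrt ln_div)
    moreover have 2: "sqrt (m / s) = sqrt m / sqrt s"
      by (rule real_sqrt_divide)
    ultimately have "(ln m - ln s) / 2 \<le> sqrt m / sqrt s - 1" by (simp only:)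
    then have "2 * s * ((ln m - ln s) / 2) \<le> 2 * s * (sqrt m / sqrt s - 1)"
      by (rule mult_left_mono) (use s in simp)
    moreover have "2 * s * ((ln m - ln s) / 2) = s * ln m - s * ln s"
      by (simp add: right_diff_distrib)
    moreover have "2 * s * (sqrt m / sqrt s - 1) = 2 * (sqrt s * sqrt m) - 2 * s"
      using s by (simp add: field_simps)
    ultimately have "s * ln m - s * ln s \<le> 2 * (sqrt s * sqrt m) - 2 * s" by (simp only:)
    then show ?thesis by simp
  qed simp
  \<comment> \<open>The convexity gap dominates the squared Hellinger distances of \<open>a\<close> and \<open>b\<close> to the midpoint.\<close>
  define D where "D s = (sqrt s - sqrt m)\<^sup>2" for s
  have D: "D s = s + m - 2 * sqrt s * sqrt m" if "0 \<le> s" for s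
    using that m by (simp add: D_def power2_diff)
  have "D a + D b = 2 * a - 2 * sqrt a * sqrt m + (2 * b - 2 * sqrt b * sqrt m)"
    using a b by (simp add: D) (simp add: m_def)
  also have "\<dots> \<le> a * ln a - a * ln m + (b * ln b - b * ln m)"
    by (intro add_mono log_ge a b)
  also have "\<dots> = ent a + ent b - 2 * ent m"
    by (simp add: ent_def m_def field_simps)
  finally have Dent: "D a + D b \<le> ent a + ent b - 2 * ent m" .
  have diff_le: "\<bar>s - m\<bar> \<le> D s / (2 * e) + e * (s + m)" if "0 \<le> s" for s
  proof -
    have "\<bar>s - m\<bar> = \<bar>sqrt s - sqrt m\<bar> * (sqrt s + sqrt m)"
    proof -
      have "s - m = (sqrt s - sqrt m) * (sqrt s + sqrt m)"
        using that m by (simp add: algebra_simps)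
      then show ?thesis using that m by (simp add: abs_mult)
    qed
    also have "\<dots> \<le> D s / (2 * e) + e / 2 * (sqrt s + sqrt m)\<^sup>2"
    proof -
      define p q where "p = \<bar>sqrt s - sqrt m\<bar>" and "q = sqrt s + sqrt m"
      have "0 \<le> (p - e * q)\<^sup>2" by simp
      then have "2 * e * (p * q) \<le> p\<^sup>2 + e\<^sup>2 * q\<^sup>2"
        by (simp add: power2_diff power_mult_distrib algebra_simps)
      then have "p * q \<le> p\<^sup>2 / (2 * e) + e / 2 * q\<^sup>2"
        using e by (simp add: field_simps power2_eq_square)
      then show ?thesis by (simp add: p_def q_def D_def)
    qed
    also have "\<dots> \<le> D s / (2 * e) + e * (s + m)"
    proof -
      have "(sqrt s + sqrt m)\<^sup>2 \<le> 2 * (s + m)"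
        using D[OF that] that m zero_le_power2[of "sqrt s - sqrt m"]
        by (simp add: power2_sum D_def)
      then have "e / 2 * (sqrt s + sqrt m)\<^sup>2 \<le> e / 2 * (2 * (s + m))"
        using e by (intro mult_left_mono) auto
      then show ?thesis by (simp add: algebra_simps)
    qed
    finally show ?thesis .
  qed
  have "\<bar>a - b\<bar> \<le> \<bar>a - m\<bar> + \<bar>b - m\<bar>" by simp
  also have "\<dots> \<le> (D a / (2 * e) + e * (a + m)) + (D b / (2 * e) + e * (b + m))"
    by (intro add_mono diff_le a b)
  also have "\<dots> = (D a + D b) / (2 * e) + 2 * e * (a + b)"
  proof -
    have "e * (a + m) + e * (b + m) = 2 * e * (a + b)"
      by (simp add: m_def algebra_simps)
    then show ?thesis by (simp add: add_divide_distrib)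
  qed
  also have "\<dots> \<le> (ent a + ent b - 2 * ent m) / (2 * e) + 2 * e * (a + b)"
    using Dent e by (intro add_right_mono divide_right_mono) auto
  finally show ?thesis .
qed

text \<open>No derivative is taken: if the gap were \<open>- ?d < 0\<close>, multiplying
  \<open>abs_diff_le_ent_gap\<close> by \<open>2 * e\<close> and letting \<open>e\<close> tend to
  \<open>0\<close> would give \<open>0 \<le> - ?d\<close>.\<close>

lemma ent_midpoint_convex:
  assumes "0 \<le> a" "0 \<le> b"
  shows "2 * ent ((a + b) / 2) \<le> ent a + ent b"
proof (rule ccontr)
  assume "\<not> ?thesis"
  then have d: "2 * ent ((a + b) / 2) - (ent a + ent b) > 0" (is "?d > 0") by simp
  have bd: "0 \<le> - ?d + 4 * e\<^sup>2 * (a + b)" if "e > 0" for e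
  proof -
    have "0 \<le> (- ?d) / (2 * e) + 2 * e * (a + b)"
      using abs_diff_le_ent_gap[OF assms that] by (smt (verit))
    then have "0 \<le> (2 * e) * ((- ?d) / (2 * e) + 2 * e * (a + b))"
      using that by (intro mult_nonneg_nonneg) auto
    also have "\<dots> = - ?d + 4 * e\<^sup>2 * (a + b)"
      using that by (simp add: distrib_left power2_eq_square)
    finally show ?thesis .
  qed
  have "((\<lambda>e::real. - ?d + 4 * e\<^sup>2 * (a + b)) \<longlongrightarrow> - ?d + 4 * 0\<^sup>2 * (a + b)) (at_right 0)"
    by (intro tendsto_intros)
  moreover have "eventually (\<lambda>e::real. 0 \<le> - ?d + 4 * e\<^sup>2 * (a + b)) (at_right 0)"
    unfolding eventually_at_right_field using bd by (intro exI[of _ 1]) auto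
  ultimately have "0 \<le> - ?d + 4 * 0\<^sup>2 * (a + b)"
    by (intro tendsto_lowerbound) auto
  then show False using d by simp
qed

text \<open>The boundary point \<open>0\<close> must be included because limits of densities may
  vanish. There \<open>s * ln s\<close> tends to \<open>0\<close>, in agreement with
  \<open>0 * ln 0 = 0\<close>.\<close>

lemma continuous_on_ent: "continuous_on {0..} ent"
  unfolding continuous_on_def
proof
  fix s :: real assume "s \<in> {0..}"
  show "(ent \<longlongrightarrow> ent s) (at s within {0..})"
  proof (cases "s = 0")
    case True
    have "((\<lambda>s::real. s * ln s - s + 1) \<longlongrightarrow> 1) (at_right 0)"
      by real_asymp
    moreover have "at (0::real) within {0..} = at_right 0"
      by (rule at_within_Ici_at_right)
    ultimately show ?thesis using True by (simp add: ent_def[abs_def])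
  next
    case False
    with \<open>s \<in> {0..}\<close> have "isCont ent s"
      unfolding ent_def[abs_def] by (intro continuous_intros) auto
    then show ?thesis unfolding isCont_def by (rule tendsto_within_subset) simp
  qed
qed

lemma tendsto_ent:
  assumes "f \<longlonglongrightarrow> l" "\<And>n. 0 \<le> f n" "0 \<le> l"
  shows "(\<lambda>n. ent (f n)) \<longlonglongrightarrow> ent l"
  by (rule continuous_on_tendsto_compose[OF continuous_on_ent assms(1)]) (use assms in auto)

section \<open>Relative entropy expressed through densities, and its behaviour under maps\<close>

lemma rel_entropy_density:
  fixes \<rho> :: "'a \<Rightarrow> real"
  assumes "prob_space R" and [measurable]: "\<rho> \<in> borel_measurable R" and nn: "\<And>x. 0 \<le> \<rho> x"
    and P: "prob_space (density R \<rho>)"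
  shows "rel_entropy (density R \<rho>) R =
    (if integrable R (\<lambda>x. ent (\<rho> x)) then ereal (\<integral>x. ent (\<rho> x) \<partial>R) else \<infinity>)"
proof -
  interpret R: prob_space R by fact
  interpret P: prob_space "density R \<rho>" by fact
  have "(\<integral>\<^sup>+x. \<rho> x \<partial>R) = 1"
    using P.emeasure_space_1 by (simp add: emeasure_density cong: nn_integral_cong)
  then have \<rho>: "integrable R \<rho>" "integral\<^sup>L R \<rho> = 1"
    using nn by (auto simp: integrable_iff_bounded integral_eq_nn_integral)
  have "AE x in R. \<rho> x = RN_deriv R (density R \<rho>) x"
    by (intro R.RN_deriv_unique) auto
  then have eq: "AE x in R. \<rho> x * entropy_density (exp 1) R (density R \<rho>) x = \<rho> x * ln (\<rho> x)"
  proof eventually_elim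
    case (elim x)
    show ?case
      using nn[of x] by (simp add: entropy_density_def log_def elim[symmetric])
  qed
  have "integrable (density R \<rho>) (entropy_density (exp 1) R (density R \<rho>)) \<longleftrightarrow>
      integrable R (\<lambda>x. \<rho> x * ln (\<rho> x))"
    using nn by (subst integrable_real_density, simp, simp, simp, intro integrable_cong_AE eq) auto
  \<comment> \<open>\<open>ent (\<rho> x)\<close> and \<open>\<rho> x * ln (\<rho> x)\<close> differ
    by \<open>1 - \<rho> x\<close>, which is integrable with integral \<open>0\<close>; so neither
    integrability nor the value of the integral changes.\<close>
  also have "\<dots> \<longleftrightarrow> integrable R (\<lambda>x. ent (\<rho> x))"
  proof
    assume "integrable R (\<lambda>x. ent (\<rho> x))"
    then have "integrable R (\<lambda>x. ent (\<rho> x) + \<rho> x - 1)" using \<rho> by simp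
    then show "integrable R (\<lambda>x. \<rho> x * ln (\<rho> x))" by (simp add: ent_def)
  qed (use \<rho> in \<open>simp add: ent_def\<close>)
  finally have iff: "integrable (density R \<rho>) (entropy_density (exp 1) R (density R \<rho>)) \<longleftrightarrow>
      integrable R (\<lambda>x. ent (\<rho> x))" (is "?L \<longleftrightarrow> ?R") .
  have "KL_divergence (exp 1) R (density R \<rho>) = (\<integral>x. ent (\<rho> x) \<partial>R)" if ?R
  proof -
    have "integrable R (\<lambda>x. ent (\<rho> x) + \<rho> x - 1)" using \<rho> that by simp
    then have int: "integrable R (\<lambda>x. \<rho> x * ln (\<rho> x))" by (simp add: ent_def)
    have "KL_divergence (exp 1) R (density R \<rho>) = (\<integral>x. \<rho> x * log (exp 1) (\<rho> x) \<partial>R)"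
      using nn by (intro R.KL_density) auto
    also have "\<dots> = (\<integral>x. \<rho> x * ln (\<rho> x) \<partial>R)" by (simp add: log_def)
    also have "\<dots> = (\<integral>x. \<rho> x * ln (\<rho> x) - \<rho> x + 1 \<partial>R)"
      using int \<rho> by (simp add: R.prob_space)
    finally show ?thesis by (simp add: ent_def)
  qed
  then show ?thesis
    using iff by (auto simp: rel_entropy_def absolutely_continuousI_density)
qed

text \<open>The Radon-Nikodym derivative is real only almost everywhere; a version that is real and
  nonnegative everywhere is fixed here once and for all.\<close>

lemma finite_rel_entropyE:
  assumes "prob_space R" "prob_space P" "sets P = sets R" "rel_entropy P R < \<infinity>"
  obtains \<rho> :: "'a \<Rightarrow> real" where "\<rho> \<in> borel_measurable R" "\<And>x. 0 \<le> \<rho> x"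
    "P = density R \<rho>" "integrable R (\<lambda>x. ent (\<rho> x))"
    "rel_entropy P R = ereal (\<integral>x. ent (\<rho> x) \<partial>R)"
proof -
  interpret R: prob_space R by fact
  interpret P: prob_space P by fact
  have ac: "absolutely_continuous R P"
    using assms(4) by (auto simp: rel_entropy_def split: if_splits)
  obtain D where D: "D \<in> borel_measurable R" "AE x in R. RN_deriv R P x = ennreal (D x)"
      "\<And>x. 0 \<le> D x"
    using R.real_RN_deriv[OF P.finite_measure_axioms ac assms(3)] by metis
  have P: "P = density R D"
    using R.density_RN_deriv[OF ac assms(3)] D density_cong[OF _ _ D(2)] by auto
  show thesis
    using rel_entropy_density[OF assms(1) D(1,3)] assms(2,4) that[OF D(1,3) P] P
    by (auto split: if_splits)
qed

text \<open>The finiteness hypothesis is an integral under \<open>density R h\<close> itself, so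
  that it can be transported along the endpoint map. The positive part of the logarithm suffices
  because \<open>ent (h x) \<le> 1 + h x * max 0 (ln (h x))\<close>.\<close>

lemma rel_entropy_density_finiteI:
  fixes h :: "'a \<Rightarrow> real"
  assumes R: "prob_space R" and [measurable]: "h \<in> borel_measurable R" and nn: "\<And>x. 0 \<le> h x"
    and P: "prob_space (density R h)"
    and fin: "(\<integral>\<^sup>+x. ennreal (max 0 (ln (h x))) \<partial>density R h) < \<infinity>"
  shows "rel_entropy (density R h) R < \<infinity>"
proof -
  interpret prob_space R by fact
  have "(\<integral>\<^sup>+x. ennreal (ent (h x)) \<partial>R) \<le> (\<integral>\<^sup>+x. 1 + ennreal (h x) * ennreal (max 0 (ln (h x))) \<partial>R)"
  proof (rule nn_integral_mono)
    fix x
    have "h x * ln (h x) \<le> h x * max 0 (ln (h x))" using nn[of x] by (intro mult_left_mono) auto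
    then have "ent (h x) \<le> 1 + h x * max 0 (ln (h x))" using nn[of x] by (simp add: ent_def)
    then have "ennreal (ent (h x)) \<le> ennreal (1 + h x * max 0 (ln (h x)))" by (rule ennreal_leI)
    also have "\<dots> = 1 + ennreal (h x) * ennreal (max 0 (ln (h x)))"
      using nn[of x] by (simp add: ennreal_mult ennreal_plus)
    finally show "ennreal (ent (h x)) \<le> 1 + ennreal (h x) * ennreal (max 0 (ln (h x)))" .
  qed
  also have "\<dots> = 1 + (\<integral>\<^sup>+x. ennreal (max 0 (ln (h x))) \<partial>density R h)"
    by (simp add: nn_integral_add nn_integral_density emeasure_space_1)
  also have "\<dots> < \<infinity>" using fin by (simp add: less_top)
  finally have "integrable R (\<lambda>x. ent (h x))"
    using nn by (intro integrableI_nonneg) (auto intro!: AE_I2 ent_nonneg)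
  then show ?thesis using rel_entropy_density[OF R _ nn P] by simp
qed

text \<open>The converse passage: where the logarithm is nonnegative, \<open>g x * ln (g x)\<close>
  is at most \<open>ent (g x) + g x\<close>; elsewhere the positive part is
  \<open>0\<close>.\<close>

lemma finite_rel_entropy_ln_density:
  fixes g :: "'a \<Rightarrow> real"
  assumes [measurable]: "g \<in> borel_measurable R" and nn: "\<And>x. 0 \<le> g x"
    and P: "prob_space (density R g)" and fin: "integrable R (\<lambda>x. ent (g x))"
  shows "(\<integral>\<^sup>+x. ennreal (max 0 (ln (g x))) \<partial>density R g) < \<infinity>"
proof -
  interpret P: prob_space "density R g" by fact
  have "(\<integral>\<^sup>+x. ennreal (max 0 (ln (g x))) \<partial>density R g) =
      (\<integral>\<^sup>+x. ennreal (g x) * ennreal (max 0 (ln (g x))) \<partial>R)"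
    by (rule nn_integral_density) measurable
  also have "\<dots> \<le> (\<integral>\<^sup>+x. ennreal (ent (g x)) + ennreal (g x) \<partial>R)"
  proof (rule nn_integral_mono)
    fix x
    have "g x * max 0 (ln (g x)) \<le> ent (g x) + g x"
    proof (cases "0 \<le> ln (g x)")
      case False
      then show ?thesis using nn[of x] ent_nonneg[OF nn[of x]] by (simp add: max_def)
    qed (simp add: ent_def)
    then have "ennreal (g x * max 0 (ln (g x))) \<le> ennreal (ent (g x) + g x)" by (rule ennreal_leI)
    then show "ennreal (g x) * ennreal (max 0 (ln (g x))) \<le> ennreal (ent (g x)) + ennreal (g x)"
      using nn[of x] ent_nonneg[OF nn[of x]] by (simp add: ennreal_mult ennreal_plus)
  qed
  also have "\<dots> = (\<integral>\<^sup>+x. ennreal (ent (g x)) \<partial>R) + emeasure (density R g) (space (density R g))"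
    by (simp add: nn_integral_add emeasure_density cong: nn_integral_cong)
  also have "\<dots> < \<infinity>"
    using fin P.emeasure_space_1 nn
    by (simp add: nn_integral_eq_integral ent_nonneg less_top del: space_density)
  finally show ?thesis .
qed

text \<open>Data processing through the dual description of entropy instead of conditional
  expectations: for bounded \<open>t\<close> on the image space, the integral of \<open>t\<close>
  under the image of \<open>P\<close> minus that of \<open>exp t - 1\<close> under the image of
  \<open>R\<close> is at most the entropy of \<open>P\<close>. Formally, \<open>t = ln g\<close>
  with the image density \<open>g\<close> returns the image entropy.\<close>

lemma rel_entropy_distr_finite:
  assumes R: "prob_space R" and P: "prob_space P" "sets P = sets R"
    and X: "X \<in> measurable R N" and fin: "rel_entropy P R < \<infinity>"
  shows "rel_entropy (distr P N X) (distr R N X) < \<infinity>"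
proof -
  interpret R: prob_space R by fact
  interpret P: prob_space P by fact
  note X[measurable]
  have XP[measurable]: "X \<in> measurable P N" using X P(2) by (simp cong: measurable_cong_sets)
  interpret RX: prob_space "distr R N X" by (rule R.prob_space_distr) fact
  interpret PX: prob_space "distr P N X" by (rule P.prob_space_distr) fact
  obtain \<rho> :: "_ \<Rightarrow> real" where \<rho>[measurable]: "\<rho> \<in> borel_measurable R" and \<rho>': "\<And>x. 0 \<le> \<rho> x"
    "P = density R \<rho>" "integrable R (\<lambda>x. ent (\<rho> x))"
    using finite_rel_entropyE[OF R P fin] by metis
  have "absolutely_continuous R P"
    unfolding \<rho>'(2) by (intro absolutely_continuousI_density) measurable
  then have ac: "absolutely_continuous (distr R N X) (distr P N X)"
    using P(2) sets_eq_imp_space_eq[OF P(2)] measurable_sets[OF X]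
    by (auto simp: absolutely_continuous_def null_sets_def emeasure_distr subset_eq)
  obtain g :: "_ \<Rightarrow> real" where g: "g \<in> borel_measurable (distr R N X)"
      "AE y in distr R N X. RN_deriv (distr R N X) (distr P N X) y = ennreal (g y)" "\<And>y. 0 \<le> g y"
    using RX.real_RN_deriv[OF PX.finite_measure_axioms ac] by auto
  have gN[measurable]: "g \<in> borel_measurable N" using g(1) by simp
  have PX: "distr P N X = density (distr R N X) g"
    using RX.density_RN_deriv[OF ac] g density_cong[OF _ _ g(2)] by auto
  \<comment> \<open>Young's inequality \<open>s t \<le> ent s + exp t - 1\<close> is applied with \<open>t = ln (trunc n)\<close>; the truncation
    keeps \<open>t\<close> bounded, and all terms below remain nonnegative, so Fatou removes it again.\<close>
  define trunc where "trunc n y = min (max (g y) (1 / real (Suc n))) (real (Suc n))" for n y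
  have trunc_m[measurable]: "trunc n \<in> borel_measurable N" for n
    unfolding trunc_def[abs_def] by measurable
  have inv_le: "1 / real (Suc n) \<le> real (Suc n)" for n
  proof -
    have "1 / real (Suc n) \<le> 1" by simp
    also have "\<dots> \<le> real (Suc n)" by simp
    finally show ?thesis .
  qed
  have trunc_pos: "0 < trunc n y" for n y by (simp add: trunc_def less_max_iff_disj)
  have trunc_ln: "\<bar>ln (trunc n y)\<bar> \<le> ln (real (Suc n))" for n y
  proof -
    have "1 / real (Suc n) \<le> trunc n y" "trunc n y \<le> real (Suc n)"
      using inv_le[of n] unfolding trunc_def by linarith+
    then have "ln (1 / real (Suc n)) \<le> ln (trunc n y)" "ln (trunc n y) \<le> ln (real (Suc n))"
      using trunc_pos[of n y] by (simp_all only: ln_le_cancel_iff) simp_all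
    then show ?thesis by (simp add: ln_div abs_le_iff)
  qed
  \<comment> \<open>On the lower range the claim reduces to \<open>ln ?N \<le> ?N - 1\<close>, on
    the middle range the term is \<open>ent (g y)\<close>, and on the upper range it is at least
    \<open>ent ?N\<close>.\<close>
  have trunc_nn: "0 \<le> g y * ln (trunc n y) - trunc n y + 1" for n y
  proof -
    let ?N = "real (Suc n)"
    consider "g y \<le> 1 / ?N" | "1 / ?N \<le> g y" "g y \<le> ?N" | "?N \<le> g y" by linarith
    then show ?thesis
    proof cases
      case 1
      then have t: "trunc n y = 1 / ?N"
        using inv_le[of n] unfolding trunc_def by linarith
      have "g y * ln ?N \<le> 1 / ?N * ln ?N" using 1 by (intro mult_right_mono) auto
      also have "\<dots> \<le> 1 / ?N * (?N - 1)" by (intro mult_left_mono ln_le_minus_one) auto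
      also have "\<dots> = 1 - 1 / ?N" by (simp add: field_simps)
      finally show ?thesis unfolding t by (simp add: ln_div)
    next
      case 2
      then have "trunc n y = g y" by (simp add: trunc_def)
      then show ?thesis using ent_nonneg[OF g(3)[of y]] by (simp add: ent_def)
    next
      case 3
      then have t: "trunc n y = ?N"
        using inv_le[of n] unfolding trunc_def by linarith
      have "?N * ln ?N \<le> g y * ln ?N" using 3 by (intro mult_right_mono) auto
      moreover have "0 \<le> ent ?N" by (rule ent_nonneg) simp
      ultimately show ?thesis by (simp add: t ent_def)
    qed
  qed
  \<comment> \<open>If \<open>g y = 0\<close>, the diverging logarithm is multiplied by
    \<open>0\<close> and only \<open>trunc n y\<close> has to tend to \<open>0\<close>; if
    \<open>g y > 0\<close>, the sequence is eventually constant.\<close>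
  have trunc_lim: "(\<lambda>n. g y * ln (trunc n y) - trunc n y + 1) \<longlonglongrightarrow> ent (g y)" for y
  proof (cases "g y = 0")
    case True
    have "trunc n y = 1 / real (Suc n)" for n
      using True inv_le[of n] zero_le_divide_1_iff[of "real (Suc n)"] unfolding trunc_def by linarith
    moreover have "(\<lambda>n. 1 / real (Suc n)) \<longlonglongrightarrow> 0" by real_asymp
    ultimately have "(\<lambda>n. trunc n y) \<longlonglongrightarrow> 0" by (simp only:)
    then have "(\<lambda>n. 0 - trunc n y + 1) \<longlonglongrightarrow> 0 - 0 + 1" by (intro tendsto_intros)
    then show ?thesis using True by simp
  next
    case False
    with g(3)[of y] have pos: "g y > 0" by (simp add: less_le)
    have "\<forall>\<^sub>F n in sequentially. 1 / real (Suc n) < g y"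
      using pos by real_asymp
    moreover have "\<forall>\<^sub>F n in sequentially. g y < real (Suc n)"
      by real_asymp
    ultimately have "\<forall>\<^sub>F n in sequentially. g y * ln (trunc n y) - trunc n y + 1 = ent (g y)"
    proof eventually_elim
      case (elim n)
      then have "trunc n y = g y" unfolding trunc_def by linarith
      then show ?case by (simp add: ent_def)
    qed
    then show ?thesis by (rule tendsto_eventually)
  qed
  define L where "L = (\<integral>x. ent (\<rho> x) \<partial>R)"
  \<comment> \<open>Both image integrals are pulled back along \<open>X\<close> to \<open>R\<close>,
    where \<open>ent_young\<close> with \<open>s = \<rho> x\<close> applies pointwise.\<close>
  have bound: "(\<integral>\<^sup>+y. ennreal (g y * ln (trunc n y) - trunc n y + 1) \<partial>distr R N X) \<le> ennreal L" for n
  proof -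
    have trunc_int: "integrable (distr R N X) (trunc n)" "integrable (distr R N X) (\<lambda>y. ln (trunc n y))"
      "integrable (distr P N X) (\<lambda>y. ln (trunc n y))"
    proof -
      show "integrable (distr R N X) (trunc n)"
        using trunc_pos[of n]
        by (intro RX.integrable_const_bound[of _ "real (Suc n)"]) (auto simp: trunc_def less_imp_le)
      show "integrable (distr R N X) (\<lambda>y. ln (trunc n y))"
        using trunc_ln by (intro RX.integrable_const_bound[of _ "ln (real (Suc n))"]) auto
      show "integrable (distr P N X) (\<lambda>y. ln (trunc n y))"
        using trunc_ln by (intro PX.integrable_const_bound[of _ "ln (real (Suc n))"]) auto
    qed
    have int_g: "integrable (distr R N X) (\<lambda>y. g y * ln (trunc n y))"
      using trunc_int(3) g unfolding PX by (subst (asm) integrable_real_density) auto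
    have int_\<rho>: "integrable R (\<lambda>x. \<rho> x * ln (trunc n (X x)))"
      using trunc_int(3) \<rho>' P(2) by (subst (asm) integrable_distr_eq)
        (auto simp: integrable_real_density)
    have trunc_R: "integrable R (\<lambda>x. trunc n (X x))"
      using trunc_int(1) by (simp add: integrable_distr_eq)
    have eq: "(\<integral>y. g y * ln (trunc n y) \<partial>distr R N X) = (\<integral>x. \<rho> x * ln (trunc n (X x)) \<partial>R)"
    proof -
      have "(\<integral>y. g y * ln (trunc n y) \<partial>distr R N X) = (\<integral>y. ln (trunc n y) \<partial>distr P N X)"
        unfolding PX using g by (subst integral_real_density) auto
      also have "\<dots> = (\<integral>x. ln (trunc n (X x)) \<partial>P)" by (simp add: integral_distr)
      also have "\<dots> = (\<integral>x. \<rho> x * ln (trunc n (X x)) \<partial>R)"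
        unfolding \<rho>'(2) using \<rho>' by (subst integral_real_density) auto
      finally show ?thesis .
    qed
    have "(\<integral>\<^sup>+y. ennreal (g y * ln (trunc n y) - trunc n y + 1) \<partial>distr R N X) =
        ennreal (\<integral>y. g y * ln (trunc n y) - trunc n y + 1 \<partial>distr R N X)"
      using int_g trunc_int trunc_nn by (intro nn_integral_eq_integral) auto
    also have "(\<integral>y. g y * ln (trunc n y) - trunc n y + 1 \<partial>distr R N X) =
        (\<integral>x. \<rho> x * ln (trunc n (X x)) - trunc n (X x) + 1 \<partial>R)"
      using int_g trunc_int int_\<rho> trunc_R eq RX.prob_space R.prob_space
      by (simp add: integral_distr)
    also have "\<dots> \<le> L"
      unfolding L_def
    proof (intro integral_mono)
      fix x
      show "\<rho> x * ln (trunc n (X x)) - trunc n (X x) + 1 \<le> ent (\<rho> x)"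
        using ent_young[OF \<rho>'(1)[of x], of "ln (trunc n (X x))"] trunc_pos[of n "X x"] by simp
    qed (use int_\<rho> trunc_R \<rho>' in auto)
    finally show ?thesis by (simp add: ennreal_leI)
  qed
  have "(\<integral>\<^sup>+y. ennreal (ent (g y)) \<partial>distr R N X) =
      (\<integral>\<^sup>+y. liminf (\<lambda>n. ennreal (g y * ln (trunc n y) - trunc n y + 1)) \<partial>distr R N X)"
    using trunc_lim by (intro nn_integral_cong lim_imp_Liminf[symmetric] tendsto_ennrealI) auto
  also have "\<dots> \<le> liminf (\<lambda>n. \<integral>\<^sup>+y. ennreal (g y * ln (trunc n y) - trunc n y + 1) \<partial>distr R N X)"
    by (rule nn_integral_liminf) measurable
  also have "\<dots> \<le> ennreal L"
    by (rule Liminf_le) (use bound in auto)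
  finally have "(\<integral>\<^sup>+y. ennreal (ent (g y)) \<partial>distr R N X) < \<infinity>"
    using ennreal_less_top by (simp add: le_less_trans)
  then have "integrable (distr R N X) (\<lambda>y. ent (g y))"
    using g(3) by (intro integrableI_nonneg) (auto intro!: AE_I2 ent_nonneg)
  then show ?thesis
    using rel_entropy_density[OF RX.prob_space_axioms _ g(3)] g(1) PX.prob_space_axioms
    unfolding PX by simp
qed

section \<open>Entropy projection\<close>

text \<open>The integrated form of \<open>abs_diff_le_ent_gap\<close>: both masses are
  \<open>1\<close>, so the last term becomes \<open>2 * e * (1 + 1)\<close>. Convexity dominates the
  midpoint entropy by the two given ones, hence it is integrable.\<close>

lemma L1_le_ent_gap:
  fixes f g :: "'a \<Rightarrow> real"
  assumes f: "integrable R f" "\<And>x. 0 \<le> f x" "integral\<^sup>L R f = 1" "integrable R (\<lambda>x. ent (f x))"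
    and g: "integrable R g" "\<And>x. 0 \<le> g x" "integral\<^sup>L R g = 1" "integrable R (\<lambda>x. ent (g x))"
    and e: "e > 0"
  shows "integrable R (\<lambda>x. ent ((f x + g x) / 2))"
    and "(\<integral>x. \<bar>f x - g x\<bar> \<partial>R) \<le> ((\<integral>x. ent (f x) \<partial>R) + (\<integral>x. ent (g x) \<partial>R)
            - 2 * (\<integral>x. ent ((f x + g x) / 2) \<partial>R)) / (2 * e) + 4 * e"
proof -
  have [measurable]: "f \<in> borel_measurable R" "g \<in> borel_measurable R" using f g by auto
  have "integrable R (\<lambda>x. ent (f x) + ent (g x))" using f g by simp
  then show m: "integrable R (\<lambda>x. ent ((f x + g x) / 2))"
  proof (rule Bochner_Integration.integrable_bound)
    show "AE x in R. norm (ent ((f x + g x) / 2)) \<le> norm (ent (f x) + ent (g x))"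
    proof (intro AE_I2)
      fix x
      have "0 \<le> ent ((f x + g x) / 2)" "0 \<le> ent (f x)" "0 \<le> ent (g x)"
        using f(2)[of x] g(2)[of x] by (auto intro!: ent_nonneg)
      then show "norm (ent ((f x + g x) / 2)) \<le> norm (ent (f x) + ent (g x))"
        using ent_midpoint_convex[OF f(2)[of x] g(2)[of x]] by simp
    qed
  qed measurable
  have "(\<integral>x. \<bar>f x - g x\<bar> \<partial>R) \<le>
      (\<integral>x. (ent (f x) + ent (g x) - 2 * ent ((f x + g x) / 2)) / (2 * e) + 2 * e * (f x + g x) \<partial>R)"
    using f g m by (intro integral_mono abs_diff_le_ent_gap e) auto
  also have "\<dots> = ((\<integral>x. ent (f x) \<partial>R) + (\<integral>x. ent (g x) \<partial>R)
            - 2 * (\<integral>x. ent ((f x + g x) / 2) \<partial>R)) / (2 * e) + 4 * e"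
    using f g m by simp
  finally show "(\<integral>x. \<bar>f x - g x\<bar> \<partial>R) \<le> ((\<integral>x. ent (f x) \<partial>R) + (\<integral>x. ent (g x) \<partial>R)
            - 2 * (\<integral>x. ent ((f x + g x) / 2) \<partial>R)) / (2 * e) + 4 * e" .
qed

text \<open>Riesz-Fischer with a rate. The geometric bound makes the sum of the increments
  integrable, so the whole sequence converges almost everywhere and no subsequence is
  extracted.\<close>

lemma L1_geometric_Cauchy_limit:
  fixes f :: "nat \<Rightarrow> 'a \<Rightarrow> real"
  assumes f: "\<And>n. integrable R (f n)"
    and cauchy: "\<And>n m. n \<le> m \<Longrightarrow> (\<integral>x. \<bar>f n x - f m x\<bar> \<partial>R) \<le> (1 / 2) ^ n"
  obtains g where "g \<in> borel_measurable R" "AE x in R. (\<lambda>n. f n x) \<longlonglongrightarrow> g x"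
    "integrable R g" "(\<lambda>n. \<integral>x. \<bar>f n x - g x\<bar> \<partial>R) \<longlonglongrightarrow> 0"
proof -
  have [measurable]: "f n \<in> borel_measurable R" for n using f by auto
  have nn_le: "(\<integral>\<^sup>+x. ennreal \<bar>f n x - f m x\<bar> \<partial>R) \<le> ennreal ((1 / 2) ^ n)" if "n \<le> m" for n m
    using cauchy[OF that] f by (subst nn_integral_eq_integral) (auto intro!: ennreal_leI)
  have "(\<integral>\<^sup>+x. (\<Sum>n. ennreal \<bar>f n x - f (Suc n) x\<bar>) \<partial>R) =
      (\<Sum>n. \<integral>\<^sup>+x. ennreal \<bar>f n x - f (Suc n) x\<bar> \<partial>R)"
    by (rule nn_integral_suminf) measurable
  also have "\<dots> \<le> (\<Sum>n. ennreal ((1 / 2) ^ n))"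
    by (intro suminf_le nn_le) auto
  also have "\<dots> < \<infinity>"
    by (subst suminf_ennreal_eq[OF _ geometric_sums]) auto
  finally have "AE x in R. (\<Sum>n. ennreal \<bar>f n x - f (Suc n) x\<bar>) \<noteq> \<infinity>"
    by (intro nn_integral_noteq_infinite) (auto simp: less_top)
  then have conv: "AE x in R. convergent (\<lambda>n. f n x)"
  proof eventually_elim
    case (elim x)
    then have "summable (\<lambda>n. \<bar>f n x - f (Suc n) x\<bar>)"
      by (intro summable_suminf_not_top) (auto simp: top_ennreal_def)
    then have "summable (\<lambda>n. f n x - f (Suc n) x)" by (rule summable_rabs_cancel)
    then have "convergent (\<lambda>n. \<Sum>k<n. f k x - f (Suc k) x)"
      by (simp add: summable_iff_convergent)
    then have "convergent (\<lambda>n. f 0 x - f n x)"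
      by (simp add: sum_lessThan_telescope'[of "\<lambda>k. f k x"])
    then have "convergent (\<lambda>n. f 0 x - (f 0 x - f n x))"
      by (rule convergent_diff[OF convergent_const])
    moreover have "(\<lambda>n. f 0 x - (f 0 x - f n x)) = (\<lambda>n. f n x)" by simp
    ultimately show ?case by (simp only:)
  qed
  define g where "g x = lim (\<lambda>n. f n x)" for x
  have [measurable]: "g \<in> borel_measurable R" unfolding g_def[abs_def] by measurable
  have lim: "AE x in R. (\<lambda>n. f n x) \<longlonglongrightarrow> g x"
    using conv by eventually_elim (simp add: g_def convergent_LIMSEQ_iff)
  \<comment> \<open>Fatou in \<open>m\<close> for fixed \<open>n\<close>: the Cauchy estimate passes
    to the limit \<open>g\<close> with the same rate.\<close>
  have bnd: "(\<integral>\<^sup>+x. ennreal \<bar>f n x - g x\<bar> \<partial>R) \<le> ennreal ((1 / 2) ^ n)" for n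
  proof -
    have "(\<integral>\<^sup>+x. ennreal \<bar>f n x - g x\<bar> \<partial>R) = (\<integral>\<^sup>+x. liminf (\<lambda>m. ennreal \<bar>f n x - f m x\<bar>) \<partial>R)"
    proof (rule nn_integral_cong_AE)
      show "AE x in R. ennreal \<bar>f n x - g x\<bar> = liminf (\<lambda>m. ennreal \<bar>f n x - f m x\<bar>)"
        using lim
      proof eventually_elim
        case (elim x)
        have "(\<lambda>m. ennreal \<bar>f n x - f m x\<bar>) \<longlonglongrightarrow> ennreal \<bar>f n x - g x\<bar>"
          using elim by (intro tendsto_ennrealI tendsto_intros)
        then show ?case by (simp only: lim_imp_Liminf[OF sequentially_bot])
      qed
    qed
    also have "\<dots> \<le> liminf (\<lambda>m. \<integral>\<^sup>+x. ennreal \<bar>f n x - f m x\<bar> \<partial>R)"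
      by (rule nn_integral_liminf) measurable
    also have "\<dots> \<le> ennreal ((1 / 2) ^ n)"
    proof (rule Liminf_le)
      show "\<forall>\<^sub>F m in sequentially. (\<integral>\<^sup>+x. ennreal \<bar>f n x - f m x\<bar> \<partial>R) \<le> ennreal ((1 / 2) ^ n)"
        using eventually_ge_at_top[of n] by eventually_elim (rule nn_le)
    qed simp
    finally show ?thesis .
  qed
  have diff: "integrable R (\<lambda>x. f n x - g x)" for n
    using le_less_trans[OF bnd[of n] ennreal_less_top] by (intro integrableI_bounded) auto
  have "integrable R (\<lambda>x. f 0 x - (f 0 x - g x))"
    by (intro Bochner_Integration.integrable_diff f diff)
  then have g: "integrable R g" by simp
  have le: "(\<integral>x. \<bar>f n x - g x\<bar> \<partial>R) \<le> (1 / 2) ^ n" for n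
    using bnd[of n] diff[of n] by (subst (asm) nn_integral_eq_integral) auto
  have "(\<lambda>n. \<integral>x. \<bar>f n x - g x\<bar> \<partial>R) \<longlonglongrightarrow> 0"
  proof (rule tendsto_sandwich[OF _ _ tendsto_const])
    show "(\<lambda>n. (1 / 2 :: real) ^ n) \<longlonglongrightarrow> 0" by (rule LIMSEQ_power_zero) simp
  qed (use le in auto)
  with lim g show thesis by (intro that) auto
qed

text \<open>Existence and uniqueness rest on two properties of constraints of the form
  \<open>measure P A = c\<close>: they are affine in the density, and they are preserved under
  \<open>L\<^sup>1\<close> limits. Hence the abstract family \<open>K\<close>, which may be of any
  cardinality.\<close>

theorem ex1_entropy_projection:
  fixes R :: "'a measure" and K :: "('a set \<times> real) set"
  assumes R: "prob_space R" and K: "\<And>A c. (A, c) \<in> K \<Longrightarrow> A \<in> sets R"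
    and C: "C = {P. prob_space P \<and> sets P = sets R \<and> (\<forall>(A, c)\<in>K. measure P A = c)}"
    and fin: "P0 \<in> C" "rel_entropy P0 R < \<infinity>"
  shows "\<exists>!P. P \<in> C \<and> rel_entropy P R = (INF Q\<in>C. rel_entropy Q R) \<and> rel_entropy P R < \<infinity>"
proof -
  interpret R: prob_space R by fact
  \<comment> \<open>Transfer to densities: \<open>D\<close> collects the densities of those members
    of \<open>C\<close> that have finite entropy, and \<open>J\<close> is this entropy.
    \<open>to_C\<close> and \<open>from_C\<close> are the two directions.\<close>
  define D where "D = {\<rho> :: 'a \<Rightarrow> real. integrable R \<rho> \<and> (\<forall>x. 0 \<le> \<rho> x) \<and> integral\<^sup>L R \<rho> = 1 \<and>
    integrable R (\<lambda>x. ent (\<rho> x)) \<and> (\<forall>(A, c)\<in>K. (\<integral>x. \<rho> x * indicator A x \<partial>R) = c)}"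
  define J where "J \<rho> = (\<integral>x. ent (\<rho> x) \<partial>R)" for \<rho>
  have measure_density: "measure (density R \<rho>) A = (\<integral>x. \<rho> x * indicator A x \<partial>R)"
    if "integrable R \<rho>" "\<And>x. 0 \<le> \<rho> x" "A \<in> sets R" for \<rho> A
  proof -
    have i: "integrable R (\<lambda>x. \<rho> x * indicator A x)"
      using that by (intro integrable_real_mult_indicator) auto
    have "emeasure (density R \<rho>) A = (\<integral>\<^sup>+x. ennreal (\<rho> x * indicator A x) \<partial>R)"
      using that by (subst emeasure_density) (auto intro!: nn_integral_cong split: split_indicator)
    also have "\<dots> = ennreal (\<integral>x. \<rho> x * indicator A x \<partial>R)"
      using i that by (intro nn_integral_eq_integral) auto
    finally show ?thesis using that by (simp add: measure_def)
  qed
  have to_C: "density R \<rho> \<in> C \<and> rel_entropy (density R \<rho>) R = ereal (J \<rho>)" if "\<rho> \<in> D" for \<rho>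
  proof -
    have \<rho>: "integrable R \<rho>" "\<And>x. 0 \<le> \<rho> x" "integral\<^sup>L R \<rho> = 1" "integrable R (\<lambda>x. ent (\<rho> x))"
      "\<And>A c. (A, c) \<in> K \<Longrightarrow> (\<integral>x. \<rho> x * indicator A x \<partial>R) = c"
      using that by (auto simp: D_def)
    have "emeasure (density R \<rho>) (space R) = 1"
      using \<rho> by (subst emeasure_density) (auto simp: nn_integral_eq_integral cong: nn_integral_cong)
    then have P: "prob_space (density R \<rho>)" by (intro prob_spaceI) simp
    have "measure (density R \<rho>) A = c" if "(A, c) \<in> K" for A c
      using measure_density[OF \<rho>(1,2) K[OF that]] \<rho>(5)[OF that] by simp
    then have "density R \<rho> \<in> C"
      using P by (simp add: C case_prod_beta)
    then show ?thesis
      using rel_entropy_density[OF R _ \<rho>(2) P] \<rho> by (simp add: J_def)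
  qed
  have from_C: "\<exists>\<rho>\<in>D. P = density R \<rho> \<and> rel_entropy P R = ereal (J \<rho>)"
    if "P \<in> C" "rel_entropy P R < \<infinity>" for P
  proof -
    have P: "prob_space P" "sets P = sets R" "\<And>A c. (A, c) \<in> K \<Longrightarrow> measure P A = c"
      using that by (auto simp: C)
    from P(1,2) that(2) obtain \<rho> where \<rho>: "\<rho> \<in> borel_measurable R" "\<And>x. 0 \<le> \<rho> x" "P = density R \<rho>"
      "integrable R (\<lambda>x. ent (\<rho> x))" "rel_entropy P R = ereal (\<integral>x. ent (\<rho> x) \<partial>R)"
      by (rule finite_rel_entropyE[OF R]) blast
    have "(\<integral>\<^sup>+x. \<rho> x \<partial>R) = 1"
      using prob_space.emeasure_space_1[OF P(1)] \<rho>(1) unfolding \<rho>(3)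
      by (simp add: emeasure_density cong: nn_integral_cong)
    then have "integrable R \<rho>" "integral\<^sup>L R \<rho> = 1"
      using \<rho> by (auto simp: integrable_iff_bounded integral_eq_nn_integral)
    moreover have "(\<integral>x. \<rho> x * indicator A x \<partial>R) = c" if "(A, c) \<in> K" for A c
      using measure_density[OF \<open>integrable R \<rho>\<close> \<rho>(2) K[OF that]] P(3)[OF that] \<rho>(3) by simp
    ultimately have "\<rho> \<in> D"
      using \<rho>(2,4) unfolding D_def by blast
    then show ?thesis using \<rho> by (auto simp: J_def)
  qed
  have D_K: "(\<integral>x. h x * indicator A x \<partial>R) = c" if "h \<in> D" "(A, c) \<in> K" for h A c
    using that unfolding D_def by fastforce
  \<comment> \<open>Convexity of the constraint set: midpoints keep the affine constraints, and
    their entropy is finite by \<open>L1_le_ent_gap\<close>.\<close>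
  have D_mid: "(\<lambda>x. (f x + g x) / 2) \<in> D" if "f \<in> D" "g \<in> D" for f g
  proof -
    have int: "integrable R (\<lambda>x. h x * indicator A x)" if "h \<in> D" "A \<in> sets R" for h A
      using that unfolding D_def by (intro integrable_real_mult_indicator) auto
    have "(\<integral>x. (f x + g x) / 2 * indicator A x \<partial>R) = c" if "(A, c) \<in> K" for A c
    proof -
      have "(\<integral>x. (f x + g x) / 2 * indicator A x \<partial>R) =
        (\<integral>x. (f x * indicator A x + g x * indicator A x) / 2 \<partial>R)"
        by (intro Bochner_Integration.integral_cong) (auto simp: field_simps)
      also have "\<dots> = c"
        using int[OF \<open>f \<in> D\<close> K[OF that]] int[OF \<open>g \<in> D\<close> K[OF that]]
          D_K[OF \<open>f \<in> D\<close> that] D_K[OF \<open>g \<in> D\<close> that] by simp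
      finally show ?thesis .
    qed
    moreover have "integrable R (\<lambda>x. ent ((f x + g x) / 2))"
      using that by (intro L1_le_ent_gap(1)[where e = 1]) (auto simp: D_def)
    ultimately show ?thesis using that by (auto simp: D_def)
  qed
  obtain \<rho>0 where "\<rho>0 \<in> D" using from_C[OF fin] by blast
  have J_nonneg: "0 \<le> J \<rho>" if "\<rho> \<in> D" for \<rho>
    using that unfolding J_def D_def by (intro integral_nonneg_AE) (auto intro!: AE_I2 ent_nonneg)
  then have bdd: "bdd_below (J ` D)" by (rule bdd_belowI2)
  define i where "i = (INF \<rho>\<in>D. J \<rho>)"
  have i_le: "i \<le> J \<rho>" if "\<rho> \<in> D" for \<rho>
    unfolding i_def using bdd that by (rule cINF_lower)
  \<comment> \<open>The parallelogram argument: the midpoint is a competitor, so its entropy is at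
    least \<open>i\<close> and the convexity gap is at most \<open>2 * e\<^sup>2\<close>. The bound
    then reads \<open>e + 4 * e\<close>.\<close>
  have near: "(\<integral>x. \<bar>f x - g x\<bar> \<partial>R) \<le> 5 * e"
    if "f \<in> D" "g \<in> D" "J f \<le> i + e\<^sup>2" "J g \<le> i + e\<^sup>2" "e > 0" for f g e
  proof -
    have "(\<integral>x. \<bar>f x - g x\<bar> \<partial>R) \<le> (J f + J g - 2 * J (\<lambda>x. (f x + g x) / 2)) / (2 * e) + 4 * e"
      unfolding J_def using that by (intro L1_le_ent_gap(2)) (auto simp: D_def)
    also have "\<dots> \<le> (2 * e\<^sup>2) / (2 * e) + 4 * e"
      using that i_le[OF D_mid[OF that(1,2)]] by (intro add_right_mono divide_right_mono) auto
    also have "\<dots> = 5 * e" using \<open>e > 0\<close> by (simp add: power2_eq_square)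
    finally show ?thesis .
  qed
  \<comment> \<open>The factor \<open>1 / 5\<close> cancels the \<open>5\<close> in
    \<open>near\<close> and leaves exactly the rate that \<open>L1_geometric_Cauchy_limit\<close>
    expects.\<close>
  define e where "e n = (1 / 2) ^ n / (5 :: real)" for n :: nat
  have e: "e n > 0" for n by (simp add: e_def)
  have "\<exists>\<rho>\<in>D. J \<rho> < i + (e n)\<^sup>2" for n
  proof -
    have "i < i + (e n)\<^sup>2" using e[of n] by simp
    then show ?thesis unfolding i_def using bdd \<open>\<rho>0 \<in> D\<close> by (subst (asm) cINF_less_iff) auto
  qed
  then obtain f where f: "\<And>n. f n \<in> D" "\<And>n. J (f n) < i + (e n)\<^sup>2" by metis
  have cauchy: "(\<integral>x. \<bar>f n x - f m x\<bar> \<partial>R) \<le> (1 / 2) ^ n" if "n \<le> m" for n m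
  proof -
    have "e m \<le> e n" using that by (auto simp: e_def power_decreasing)
    then have "(e m)\<^sup>2 \<le> (e n)\<^sup>2" using e[of m] by (intro power_mono) auto
    then have "(\<integral>x. \<bar>f n x - f m x\<bar> \<partial>R) \<le> 5 * e n"
      using f(2)[of n] f(2)[of m] by (intro near f(1) e) auto
    then show ?thesis by (simp add: e_def)
  qed
  have fD: "integrable R (f n)" "0 \<le> f n x" "integral\<^sup>L R (f n) = 1" "integrable R (\<lambda>x. ent (f n x))"
      "(A, c) \<in> K \<Longrightarrow> (\<integral>x. f n x * indicator A x \<partial>R) = c" for n x A c
    using f(1)[of n] by (auto simp: D_def)
  obtain g' where g': "g' \<in> borel_measurable R" "AE x in R. (\<lambda>n. f n x) \<longlonglongrightarrow> g' x"
    "integrable R g'" "(\<lambda>n. \<integral>x. \<bar>f n x - g' x\<bar> \<partial>R) \<longlonglongrightarrow> 0"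
    by (rule L1_geometric_Cauchy_limit[OF fD(1) cauchy])
  note g'(1)[measurable]
  \<comment> \<open>The limit is nonnegative only almost everywhere, whereas members of
    \<open>D\<close> are nonnegative at every point.\<close>
  define g where "g x = max 0 (g' x)" for x
  have [measurable]: "g \<in> borel_measurable R" by (simp add: g_def[abs_def])
  have f_m[measurable]: "f n \<in> borel_measurable R" for n using fD(1) by auto
  have gg': "AE x in R. g x = g' x" using g'(2)
  proof eventually_elim
    case (elim x)
    then have "0 \<le> g' x" using fD(2) by (intro LIMSEQ_le_const[of "\<lambda>n. f n x"]) auto
    then show ?case by (simp add: g_def)
  qed
  have g_nn: "0 \<le> g x" for x by (simp add: g_def)
  have g_int: "integrable R g" using g'(3) by (simp add: g_def[abs_def])
  have g_L1: "(\<lambda>n. \<integral>x. \<bar>f n x - g x\<bar> \<partial>R) \<longlonglongrightarrow> 0"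
  proof -
    have "(\<integral>x. \<bar>f n x - g x\<bar> \<partial>R) = (\<integral>x. \<bar>f n x - g' x\<bar> \<partial>R)" for n
      using gg' by (intro integral_cong_AE) auto
    then show ?thesis using g'(4) by simp
  qed
  \<comment> \<open>The probability of a fixed event is Lipschitz in the \<open>L\<^sup>1\<close>
    distance of densities, so each constraint survives in the limit.\<close>
  have lim_A: "(\<lambda>n. \<integral>x. f n x * indicator A x \<partial>R) \<longlonglongrightarrow> (\<integral>x. g x * indicator A x \<partial>R)"
    if A: "A \<in> sets R" for A
  proof (rule Lim_transform2[OF tendsto_const])
    have int: "integrable R (\<lambda>x. h x * indicator A x)" if "integrable R h" for h :: "'a \<Rightarrow> real"
      using that A by (intro integrable_real_mult_indicator) auto
    have le: "\<bar>(\<integral>x. g x * indicator A x \<partial>R) - (\<integral>x. f n x * indicator A x \<partial>R)\<bar>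
        \<le> (\<integral>x. \<bar>f n x - g x\<bar> \<partial>R)" for n
    proof -
      have "\<bar>(\<integral>x. g x * indicator A x \<partial>R) - (\<integral>x. f n x * indicator A x \<partial>R)\<bar> =
        \<bar>\<integral>x. g x * indicator A x - f n x * indicator A x \<partial>R\<bar>"
        using int[OF g_int] int[OF fD(1)] by simp
      also have "\<dots> \<le> (\<integral>x. \<bar>g x * indicator A x - f n x * indicator A x\<bar> \<partial>R)"
        by (rule integral_abs_bound)
      also have "\<dots> \<le> (\<integral>x. \<bar>f n x - g x\<bar> \<partial>R)"
        using int[OF g_int] int[OF fD(1)] g_int fD(1)
        by (intro integral_mono) (auto split: split_indicator)
      finally show ?thesis .
    qed
    show "(\<lambda>n. (\<integral>x. g x * indicator A x \<partial>R) - (\<integral>x. f n x * indicator A x \<partial>R)) \<longlonglongrightarrow> 0"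
      by (rule tendsto_rabs_zero_cancel, rule tendsto_sandwich[OF _ _ tendsto_const g_L1])
        (use le in auto)
  qed
  have g_K: "(\<integral>x. g x * indicator A x \<partial>R) = c" if "(A, c) \<in> K" for A c
    using lim_A[OF K[OF that]] fD(5)[OF that] by (simp add: LIMSEQ_const_iff)
  \<comment> \<open>No mass escapes: the total mass is the case \<open>A = space R\<close> of the
    same convergence.\<close>
  have g_1: "integral\<^sup>L R g = 1"
  proof -
    have *: "(\<integral>x. h x * indicator (space R) x \<partial>R) = integral\<^sup>L R h" for h :: "'a \<Rightarrow> real"
      by (intro Bochner_Integration.integral_cong) auto
    show ?thesis using lim_A[OF sets.top] fD(3) by (simp add: * LIMSEQ_const_iff)
  qed
  have "(\<integral>\<^sup>+x. ennreal (ent (g x)) \<partial>R) = (\<integral>\<^sup>+x. liminf (\<lambda>n. ennreal (ent (f n x))) \<partial>R)"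
  proof (rule nn_integral_cong_AE)
    show "AE x in R. ennreal (ent (g x)) = liminf (\<lambda>n. ennreal (ent (f n x)))"
      using g'(2) gg'
    proof eventually_elim
      case (elim x)
      then have "(\<lambda>n. ennreal (ent (f n x))) \<longlonglongrightarrow> ennreal (ent (g x))"
        using fD(2) g_nn[of x] by (intro tendsto_ennrealI tendsto_ent) auto
      then show ?case by (simp only: lim_imp_Liminf[OF sequentially_bot])
    qed
  qed
  \<comment> \<open>Lower semicontinuity of the entropy along the minimizing sequence; Fatou applies
    since \<open>ent\<close> is nonnegative on densities.\<close>
  also have "\<dots> \<le> liminf (\<lambda>n. \<integral>\<^sup>+x. ennreal (ent (f n x)) \<partial>R)"
    by (rule nn_integral_liminf) measurable
  also have "\<dots> = liminf (\<lambda>n. ennreal (J (f n)))"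
    unfolding J_def using fD by (subst nn_integral_eq_integral) (auto intro!: AE_I2 ent_nonneg)
  also have "\<dots> \<le> liminf (\<lambda>n. ennreal (i + (e n)\<^sup>2))"
    using f(2) by (intro Liminf_mono always_eventually allI ennreal_leI) (auto intro: less_imp_le)
  also have "\<dots> = ennreal i"
  proof (intro lim_imp_Liminf tendsto_ennrealI)
    have "e \<longlonglongrightarrow> 0 / 5" unfolding e_def by (intro tendsto_divide LIMSEQ_power_zero tendsto_const) auto
    then have "(\<lambda>n. i + (e n)\<^sup>2) \<longlonglongrightarrow> i + 0\<^sup>2" by (intro tendsto_intros) simp
    then show "(\<lambda>n. i + (e n)\<^sup>2) \<longlonglongrightarrow> i" by simp
  qed simp
  finally have g_ent_le: "(\<integral>\<^sup>+x. ennreal (ent (g x)) \<partial>R) \<le> ennreal i" .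
  then have g_ent: "integrable R (\<lambda>x. ent (g x))"
    using le_less_trans[OF g_ent_le ennreal_less_top] g_nn
    by (intro integrableI_nonneg) (auto intro!: AE_I2 ent_nonneg)
  have gD: "g \<in> D" unfolding D_def using g_int g_nn g_1 g_ent g_K by auto
  have i_nn: "0 \<le> i" unfolding i_def using J_nonneg \<open>\<rho>0 \<in> D\<close> by (intro cINF_greatest) auto
  have Jg: "J g = i"
    using g_ent_le g_nn i_le[OF gD] i_nn unfolding J_def
    by (subst (asm) nn_integral_eq_integral[OF g_ent]) (auto intro!: AE_I2 ent_nonneg)
  \<comment> \<open>Members of \<open>C\<close> with infinite entropy do not affect the infimum, so
    it agrees with the infimum of \<open>J\<close> over \<open>D\<close>.\<close>
  have INF: "(INF Q\<in>C. rel_entropy Q R) = ereal i"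
  proof (rule antisym)
    show "(INF Q\<in>C. rel_entropy Q R) \<le> ereal i"
      using to_C[OF gD] Jg by (metis INF_lower)
    show "ereal i \<le> (INF Q\<in>C. rel_entropy Q R)"
    proof (rule INF_greatest)
      fix Q assume "Q \<in> C"
      then show "ereal i \<le> rel_entropy Q R"
        using from_C[of Q] i_le by (cases "rel_entropy Q R < \<infinity>") auto
    qed
  qed
  show ?thesis
  proof (rule ex1I[of _ "density R g"])
    show "density R g \<in> C \<and> rel_entropy (density R g) R = (INF Q\<in>C. rel_entropy Q R) \<and>
      rel_entropy (density R g) R < \<infinity>"
      using to_C[OF gD] Jg INF by simp
  next
    fix P assume P: "P \<in> C \<and> rel_entropy P R = (INF Q\<in>C. rel_entropy Q R) \<and> rel_entropy P R < \<infinity>"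
    then obtain h where h: "h \<in> D" "P = density R h" "J h = i"
      using from_C[of P] INF by auto
    \<comment> \<open>Uniqueness is \<open>near\<close> once more: both entropies equal
      \<open>i\<close>, so every positive tolerance is allowed.\<close>
    have "(\<integral>x. \<bar>h x - g x\<bar> \<partial>R) \<le> 0 + d" if "d > 0" for d
    proof -
      have "(\<integral>x. \<bar>h x - g x\<bar> \<partial>R) \<le> 5 * (d / 5)"
        using that by (intro near h(1) gD) (simp_all add: h(3) Jg)
      then show ?thesis by simp
    qed
    then have "(\<integral>x. \<bar>h x - g x\<bar> \<partial>R) \<le> 0"
      by (rule field_le_epsilon)
    moreover have "integrable R h" using h(1) by (simp add: D_def)
    ultimately have "AE x in R. \<bar>h x - g x\<bar> = 0"
      using g_int by (subst integral_nonneg_eq_0_iff_AE[symmetric])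
        (auto intro!: antisym integral_nonneg_AE)
    then have "AE x in R. ennreal (h x) = ennreal (g x)" by eventually_elim simp
    then show "P = density R g"
      unfolding h(2) using \<open>integrable R h\<close> by (intro density_cong) auto
  qed
qed

section \<open>Densities and image measures\<close>

text \<open>On the set where the derivative exceeds \<open>C\<close>, its excess over
  \<open>C\<close> integrates to \<open>0\<close> by the domination hypothesis. Cutting it off at
  \<open>C\<close> therefore changes it only on a null set and gives a bound valid at every
  point.\<close>

lemma bounded_density:
  assumes N: "finite_measure N" and sets: "sets Q = sets N"
    and le: "\<And>A. A \<in> sets N \<Longrightarrow> emeasure Q A \<le> ennreal C * emeasure N A" and C: "0 \<le> C"
  obtains k :: "'a \<Rightarrow> real" where "k \<in> borel_measurable N" "\<And>x. 0 \<le> k x" "\<And>x. k x \<le> C"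
    "Q = density N k"
proof -
  interpret N: finite_measure N by fact
  have "emeasure Q (space N) \<le> ennreal C * emeasure N (space N)" by (rule le) simp
  also have "\<dots> < \<infinity>"
    by (auto simp: ennreal_mult_eq_top_iff less_top[symmetric])
  finally interpret Q: finite_measure Q
    using sets_eq_imp_space_eq[OF sets] by (intro finite_measureI) auto
  have ac: "absolutely_continuous N Q"
    unfolding absolutely_continuous_def
  proof
    fix A assume A: "A \<in> null_sets N"
    then have "emeasure Q A \<le> ennreal C * 0" using le[of A] by (auto simp: null_sets_def)
    then show "A \<in> null_sets Q" using A sets by (auto simp: null_sets_def)
  qed
  obtain D where D: "D \<in> borel_measurable N" "AE x in N. RN_deriv N Q x = ennreal (D x)"
      "\<And>x. 0 \<le> D x"
    using N.real_RN_deriv[OF Q.finite_measure_axioms ac sets] by metis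
  note D(1)[measurable]
  have Q: "Q = density N D"
    using N.density_RN_deriv[OF ac sets] D density_cong[OF _ _ D(2)] by auto
  define A where "A = {x \<in> space N. C < D x}"
  have A[measurable]: "A \<in> sets N" unfolding A_def by measurable
  have "(\<integral>\<^sup>+x. ennreal (D x - C) * indicator A x \<partial>N) + ennreal C * emeasure N A =
      (\<integral>\<^sup>+x. ennreal (D x - C) * indicator A x + ennreal C * indicator A x \<partial>N)"
    by (subst nn_integral_add) (auto simp: nn_integral_cmult_indicator)
  also have "\<dots> = (\<integral>\<^sup>+x. ennreal (D x) * indicator A x \<partial>N)"
    using C by (intro nn_integral_cong)
      (auto simp: A_def ennreal_plus[symmetric] simp del: ennreal_plus split: split_indicator)
  also have "\<dots> = emeasure Q A" by (simp add: Q emeasure_density)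
  also have "\<dots> \<le> ennreal C * emeasure N A" by (rule le) fact
  finally have "ennreal C * emeasure N A + (\<integral>\<^sup>+x. ennreal (D x - C) * indicator A x \<partial>N) \<le>
      ennreal C * emeasure N A + 0" by (simp add: add.commute)
  moreover have "ennreal C * emeasure N A \<noteq> \<infinity>" by (auto simp: ennreal_mult_eq_top_iff)
  ultimately have "(\<integral>\<^sup>+x. ennreal (D x - C) * indicator A x \<partial>N) = 0"
    unfolding ennreal_add_left_cancel_le by simp
  then have "AE x in N. ennreal (D x - C) * indicator A x = 0"
    by (subst (asm) nn_integral_0_iff_AE) auto
  then have ae: "AE x in N. ennreal (D x) = ennreal (min (D x) C)"
    using AE_space
  proof eventually_elim
    case (elim x)
    then show ?case by (cases "C < D x") (auto simp: A_def ennreal_eq_0_iff)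
  qed
  show thesis
  proof (rule that[of "\<lambda>x. min (D x) C"])
    show "Q = density N (\<lambda>x. min (D x) C)"
      unfolding Q using ae by (intro density_cong) auto
  qed (use C D(3) in auto)
qed

text \<open>Rewrites a constraint on an image law as prescribed probabilities of events, the form
  required by \<open>ex1_entropy_projection\<close>.\<close>

lemma distr_eq_iff_measure:
  assumes "prob_space P" "prob_space Q" "X \<in> P \<rightarrow>\<^sub>M N" "sets Q = sets N"
  shows "distr P N X = Q \<longleftrightarrow> (\<forall>S\<in>sets N. measure P (X -` S \<inter> space P) = measure Q S)"
proof
  assume "distr P N X = Q"
  then show "\<forall>S\<in>sets N. measure P (X -` S \<inter> space P) = measure Q S"
    using assms(3) by (auto simp: measure_distr)
next
  interpret P: prob_space P by fact
  interpret Q: prob_space Q by fact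
  assume "\<forall>S\<in>sets N. measure P (X -` S \<inter> space P) = measure Q S"
  then show "distr P N X = Q"
    using assms(3,4)
    by (intro measure_eqI) (auto simp: emeasure_distr P.emeasure_eq_measure Q.emeasure_eq_measure)
qed

text \<open>Independence enters later only as a product formula for a joint law, ready for Fubini.
  The maps \<open>f\<close> and \<open>g\<close> read the wanted variables off the families supplied
  by \<open>indep_var_restrict\<close>.\<close>

lemma (in prob_space) indep_var_distr_pair:
  assumes ind: "indep_var S X T Y" and f[measurable]: "f \<in> S \<rightarrow>\<^sub>M S'" and g[measurable]: "g \<in> T \<rightarrow>\<^sub>M T'"
  shows "distr M (S' \<Otimes>\<^sub>M T') (\<lambda>w. (f (X w), g (Y w))) =
    distr M S' (\<lambda>w. f (X w)) \<Otimes>\<^sub>M distr M T' (\<lambda>w. g (Y w))"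
proof -
  have X[measurable]: "X \<in> M \<rightarrow>\<^sub>M S" and Y[measurable]: "Y \<in> M \<rightarrow>\<^sub>M T"
    and eq: "distr M S X \<Otimes>\<^sub>M distr M T Y = distr M (S \<Otimes>\<^sub>M T) (\<lambda>w. (X w, Y w))"
    using ind by (auto simp: indep_var_distribution_eq)
  interpret gY: prob_space "distr M T' (\<lambda>w. g (Y w))" by (rule prob_space_distr) measurable
  have "distr M S' (\<lambda>w. f (X w)) \<Otimes>\<^sub>M distr M T' (\<lambda>w. g (Y w)) =
      distr (distr M S X) S' f \<Otimes>\<^sub>M distr (distr M T Y) T' g"
    by (simp add: distr_distr comp_def)
  also have "\<dots> = distr (distr M S X \<Otimes>\<^sub>M distr M T Y) (S' \<Otimes>\<^sub>M T') (\<lambda>(x, y). (f x, g y))"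
    by (rule pair_measure_distr)
      (simp_all add: distr_distr comp_def gY.sigma_finite_measure_axioms)
  also have "\<dots> = distr M (S' \<Otimes>\<^sub>M T') (\<lambda>w. (f (X w), g (Y w)))"
    unfolding eq by (subst distr_distr) (simp_all add: comp_def)
  finally show ?thesis by simp
qed

section \<open>Volume of the torus\<close>

lemma dist_torus_translate: "dist (p + r) (q + r) = dist p (q :: 'n::finite torus)"
  by transfer simp

text \<open>Both continuity conditions come from the translation invariance of the metric. Together
  with second countability the instance makes sums of measurable torus-valued functions
  measurable.\<close>

instance torus :: (finite) topological_group_add
proof
  fix a b :: "'a torus"
  show "LIM x (nhds a \<times>\<^sub>F nhds b). fst x + snd x :> nhds (a + b)"
    unfolding tendsto_iff
  proof (intro allI impI)
    fix e :: real assume "0 < e"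
    then have "\<forall>\<^sub>F x in nhds a. dist x a < e / 2" "\<forall>\<^sub>F y in nhds b. dist y b < e / 2"
      by (auto intro!: eventually_nhds_metric[THEN iffD2] exI[of _ "e / 2"])
    then have "\<forall>\<^sub>F z in nhds a \<times>\<^sub>F nhds b. dist (fst z) a < e / 2 \<and> dist (snd z) b < e / 2"
      by (rule eventually_prodI)
    then show "\<forall>\<^sub>F z in nhds a \<times>\<^sub>F nhds b. dist (fst z + snd z) (a + b) < e"
    proof eventually_elim
      case (elim z)
      have "dist (fst z + snd z) (a + b) \<le> dist (fst z + snd z) (a + snd z) + dist (a + snd z) (a + b)"
        by (rule dist_triangle)
      also have "\<dots> = dist (fst z) a + dist (snd z) b"
        using dist_torus_translate[of "snd z" a b]
        by (simp add: dist_torus_translate add.commute)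
      finally show ?case using elim by simp
    qed
  qed
  show "(uminus \<longlongrightarrow> - a) (nhds a)"
  proof -
    have "dist (- x) (- a) = dist x a" for x
      using dist_torus_translate[of "- x" "x + a" "- a"] by (simp add: dist_commute algebra_simps)
    then show ?thesis
      unfolding tendsto_iff by (auto intro!: eventually_nhds_metric[THEN iffD2])
  qed
qed

lemma measurable_torus_diff [measurable (raw)]:
  fixes f g :: "'a \<Rightarrow> 'n::finite torus"
  assumes "f \<in> borel_measurable M" "g \<in> borel_measurable M"
  shows "(\<lambda>x. f x - g x) \<in> borel_measurable M"
proof -
  have "(uminus :: 'n torus \<Rightarrow> 'n torus) \<in> borel_measurable borel"
    by (intro borel_measurable_continuous_onI continuous_intros)
  from measurable_compose[OF assms(2) this] assms(1)
  have "(\<lambda>x. f x + - g x) \<in> borel_measurable M" by measurable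
  then show ?thesis by simp
qed

lemma measurable_torus_proj [measurable]: "torus_proj \<in> borel_measurable borel"
  by (intro borel_measurable_continuous_onI continuous_intros)

lemma measurable_vec_nth' [measurable]: "(\<lambda>x::real^'n::finite. x $ i) \<in> borel_measurable borel"
  by (intro borel_measurable_continuous_onI continuous_intros)

section \<open>The half-open cube as a fundamental domain, and invariance of the volume\<close>

definition unit_cube :: "(real ^ 'n::finite) set" where
  "unit_cube = {x. \<forall>i. 0 \<le> x $ i \<and> x $ i < 1}"

text \<open>Indexing the lattice by the countable type \<open>int ^ 'n\<close> makes
  \<open>emeasure_partition\<close> applicable to its cells.\<close>

definition int_vec :: "int ^ 'n \<Rightarrow> real ^ 'n" where
  "int_vec k = (\<chi> i. of_int (k $ i))"

lemma int_vec_lattice: "int_vec k \<in> int_lattice"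
  by (simp add: int_vec_def int_lattice_def)

lemma unit_cube_sets [measurable]: "unit_cube \<in> sets (borel :: (real ^ 'n::finite) measure)"
proof -
  have "{x \<in> space borel. \<forall>i\<in>UNIV. 0 \<le> x $ i \<and> x $ i < 1} \<in> sets (borel :: (real ^ 'n) measure)"
    by measurable
  then show ?thesis by (simp add: unit_cube_def)
qed

text \<open>Half-openness gives uniqueness: in each coordinate the floor is the only admissible
  integer.\<close>

lemma unit_cube_minus: "\<exists>!k. x - int_vec k \<in> unit_cube"
proof (rule ex1I[of _ "\<chi> i. \<lfloor>x $ i\<rfloor>"])
  show "x - int_vec (\<chi> i. \<lfloor>x $ i\<rfloor>) \<in> unit_cube"
    by (simp add: unit_cube_def int_vec_def) linarith
  fix k assume "x - int_vec k \<in> unit_cube"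
  then have "\<lfloor>x $ i\<rfloor> = k $ i" for i
    by (simp add: unit_cube_def int_vec_def floor_eq_iff algebra_simps)
  then show "k = (\<chi> i. \<lfloor>x $ i\<rfloor>)" by (simp add: vec_eq_iff)
qed

lemma unit_cube_plus: "\<exists>!k. x + int_vec k \<in> unit_cube"
proof -
  have neg: "int_vec (- k) = - int_vec k" for k by (simp add: int_vec_def vec_eq_iff)
  obtain k where k: "x - int_vec k \<in> unit_cube" "\<And>l. x - int_vec l \<in> unit_cube \<Longrightarrow> l = k"
    using unit_cube_minus[of x] by blast
  show ?thesis
  proof (rule ex1I[of _ "- k"])
    show "x + int_vec (- k) \<in> unit_cube" using k(1) by (simp add: neg)
    fix l assume "x + int_vec l \<in> unit_cube"
    then have "- l = k" by (intro k(2)) (simp add: neg)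
    then show "l = - k" by auto
  qed
qed

text \<open>The half-open cube lies between the open and the closed one, which have the same volume.
  This links the closed cube in the definition of \<open>torus_vol\<close> to a true fundamental
  domain.\<close>

lemma AE_cbox_unit_cube: "AE x in lborel. (x :: real ^ 'n::finite) \<in> cbox 0 1 \<longleftrightarrow> x \<in> unit_cube"
  and emeasure_cbox_0_1: "emeasure lborel (cbox 0 (1 :: real ^ 'n)) = 1"
proof -
  have one: "(1 :: real ^ 'n) \<bullet> b = 1" if "b \<in> Basis" for b
    using that by (auto simp: Basis_vec_def inner_axis)
  have c: "emeasure lborel (cbox 0 (1 :: real ^ 'n)) = 1"
    by (subst emeasure_lborel_cbox) (auto simp: one)
  have b: "emeasure lborel (box 0 (1 :: real ^ 'n)) = 1"
    by (subst emeasure_lborel_box) (auto simp: one)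
  show "emeasure lborel (cbox 0 (1 :: real ^ 'n)) = 1" by (rule c)
  have "emeasure lborel (cbox 0 (1 :: real ^ 'n) - box 0 1) = 0"
    using box_subset_cbox[of 0 "1 :: real ^ 'n"] by (subst emeasure_Diff) (auto simp: b c)
  then have "AE x in lborel. (x :: real ^ 'n) \<notin> cbox 0 1 - box 0 1"
    by (intro AE_not_in) (auto simp: null_sets_def)
  then show "AE x in lborel. (x :: real ^ 'n) \<in> cbox 0 1 \<longleftrightarrow> x \<in> unit_cube"
    by eventually_elim (auto simp: unit_cube_def mem_box_cart less_imp_le)
qed

lemma space_torus_vol [simp]: "space torus_vol = UNIV"
  and sets_torus_vol [simp, measurable_cong]: "sets torus_vol = sets borel"
  by (simp_all add: torus_vol_def)

lemma prob_space_torus_vol: "prob_space (torus_vol :: 'n::finite torus measure)"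
proof -
  interpret prob_space "uniform_measure lborel (cbox 0 (1 :: real ^ 'n))"
    by (intro prob_space_uniform_measure) (simp_all add: emeasure_cbox_0_1)
  show ?thesis
    unfolding torus_vol_def by (rule prob_space_distr) (simp cong: measurable_cong_sets)
qed

interpretation torus_vol: prob_space torus_vol
  by (rule prob_space_torus_vol)

lemma nn_integral_torus_vol:
  fixes f :: "'n::finite torus \<Rightarrow> ennreal"
  assumes [measurable]: "f \<in> borel_measurable borel"
  shows "(\<integral>\<^sup>+X. f X \<partial>torus_vol) = (\<integral>\<^sup>+x. indicator (cbox 0 1) x * f (torus_proj x) \<partial>lborel)"
proof -
  have "(\<integral>\<^sup>+X. f X \<partial>torus_vol) = (\<integral>\<^sup>+x. f (torus_proj x) \<partial>uniform_measure lborel (cbox 0 1))"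
    unfolding torus_vol_def by (subst nn_integral_distr) (simp_all cong: measurable_cong_sets)
  also have "\<dots> = (\<integral>\<^sup>+x. f (torus_proj x) * indicator (cbox 0 1) x \<partial>lborel)"
    by (subst nn_integral_uniform_measure) (simp_all add: emeasure_cbox_0_1 divide_ennreal_def)
  finally show ?thesis by (simp add: mult.commute)
qed

lemma emeasure_torus_vol:
  fixes A :: "'n::finite torus set"
  assumes [measurable]: "A \<in> sets borel"
  shows "emeasure torus_vol A = emeasure lborel {x. torus_proj x \<in> A \<and> x \<in> unit_cube}"
proof -
  have [measurable]: "{x. torus_proj x \<in> A \<and> x \<in> unit_cube} \<in> sets borel"
  proof -
    have "{x \<in> space borel. torus_proj x \<in> A \<and> x \<in> unit_cube} \<in> sets borel" by measurable
    then show ?thesis by simp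
  qed
  have "emeasure torus_vol A = (\<integral>\<^sup>+X. indicator A X \<partial>torus_vol)" by simp
  also have "\<dots> = (\<integral>\<^sup>+x. indicator (cbox 0 1) x * indicator A (torus_proj x) \<partial>lborel)"
    by (rule nn_integral_torus_vol) measurable
  also have "\<dots> = (\<integral>\<^sup>+x. indicator {x. torus_proj x \<in> A \<and> x \<in> unit_cube} x \<partial>lborel)"
    using AE_cbox_unit_cube by (intro nn_integral_cong_AE) (auto split: split_indicator)
  finally show ?thesis by simp
qed

lemma emeasure_lborel_translate:
  fixes y :: "real ^ 'n::finite"
  assumes [measurable]: "S \<in> sets borel"
  shows "emeasure lborel {x. x + y \<in> S} = emeasure lborel S"
proof -
  have "emeasure lborel S = emeasure (distr lborel borel ((+) y)) S"
    by (simp add: lborel_distr_plus)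
  also have "\<dots> = emeasure lborel {x. x + y \<in> S}"
    by (subst emeasure_distr) (auto simp: vimage_def add.commute)
  finally show ?thesis by simp
qed

text \<open>The sum over the pieces is an integral for counting measure, so two decompositions can
  be compared piece by piece with \<open>nn_integral_cong\<close>.\<close>

lemma emeasure_partition:
  fixes F :: "'i::countable \<Rightarrow> 'a set"
  assumes "\<And>i. F i \<in> sets M" and ex1: "\<And>x. x \<in> E \<Longrightarrow> \<exists>!i. x \<in> F i" and "E \<in> sets M"
  shows "emeasure M E = (\<integral>\<^sup>+i. emeasure M (E \<inter> F i) \<partial>count_space UNIV)"
proof -
  have "emeasure M (\<Union>i\<in>UNIV. E \<inter> F i) = (\<integral>\<^sup>+i. emeasure M (E \<inter> F i) \<partial>count_space UNIV)"
    using assms by (intro emeasure_UN_countable) (auto simp: disjoint_family_on_def)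
  moreover have "(\<Union>i\<in>UNIV. E \<inter> F i) = E" using ex1 by blast
  ultimately show ?thesis by simp
qed

text \<open>The translated cube is a fundamental domain too, and a lattice-periodic set has the same
  volume in any two fundamental domains.\<close>

lemma emeasure_torus_vol_translate:
  fixes A :: "'n::finite torus set"
  assumes A[measurable]: "A \<in> sets borel"
  shows "emeasure torus_vol {X. X + Y \<in> A} = emeasure torus_vol A"
proof -
  obtain y where y: "Y = torus_proj y" by (rule torus_proj_cases)
  define T where "T = {x. torus_proj x \<in> A}"
  have T_sets[measurable]: "T \<in> sets borel"
  proof -
    have "{x \<in> space borel. torus_proj x \<in> A} \<in> sets borel" by measurable
    then show ?thesis by (simp add: T_def)
  qed
  have T_per: "x + int_vec k \<in> T \<longleftrightarrow> x \<in> T" for x k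
  proof -
    have "torus_proj (x + int_vec k) = torus_proj x"
      unfolding torus_proj_eq_iff by (simp add: int_vec_lattice)
    then show ?thesis by (simp add: T_def)
  qed
  have [measurable]: "{x. x + c \<in> unit_cube} \<in> sets (borel :: (real ^ 'n) measure)" for c
  proof -
    have "{x \<in> space borel. x + c \<in> unit_cube} \<in> sets (borel :: (real ^ 'n) measure)" by measurable
    then show ?thesis by simp
  qed
  have [measurable]: "{X. X + Y \<in> A} \<in> sets borel"
  proof -
    have "{X \<in> space borel. X + Y \<in> A} \<in> sets borel" by measurable
    then show ?thesis by simp
  qed
  have "emeasure torus_vol {X. X + Y \<in> A} = emeasure lborel {x. x + y \<in> T \<and> x \<in> unit_cube}"
    by (subst emeasure_torus_vol) (simp_all add: T_def y torus_proj_add)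
  also have "\<dots> = emeasure lborel {x. x + y \<in> {x \<in> T. x + - y \<in> unit_cube}}" by simp
  also have "\<dots> = emeasure lborel (T \<inter> {x. x + - y \<in> unit_cube})" (is "_ = emeasure _ ?E")
    by (subst emeasure_lborel_translate) (auto simp: Int_def)
  \<comment> \<open>Cut the translated cube along the lattice cells and move the pieces back to the unit cube.\<close>
  also have "\<dots> = (\<integral>\<^sup>+k. emeasure lborel (?E \<inter> {x. x + int_vec k \<in> unit_cube}) \<partial>count_space UNIV)"
  proof (rule emeasure_partition)
    fix x assume "x \<in> ?E"
    show "\<exists>!k. x \<in> {x. x + int_vec k \<in> unit_cube}" using unit_cube_plus[of x] by simp
  qed measurable
  also have "\<dots> = (\<integral>\<^sup>+k. emeasure lborel ((T \<inter> unit_cube) \<inter> {x. x + (- y - int_vec k) \<in> unit_cube}) \<partial>count_space UNIV)"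
  proof (intro nn_integral_cong)
    fix k
    have "emeasure lborel ((T \<inter> unit_cube) \<inter> {x. x + (- y - int_vec k) \<in> unit_cube}) =
      emeasure lborel {x. x + int_vec k \<in> (T \<inter> unit_cube) \<inter> {x. x + (- y - int_vec k) \<in> unit_cube}}"
      by (rule emeasure_lborel_translate[symmetric]) measurable
    also have "{x. x + int_vec k \<in> (T \<inter> unit_cube) \<inter> {x. x + (- y - int_vec k) \<in> unit_cube}} =
      ?E \<inter> {x. x + int_vec k \<in> unit_cube}"
      by (auto simp: T_per algebra_simps)
    finally show "emeasure lborel (?E \<inter> {x. x + int_vec k \<in> unit_cube}) =
      emeasure lborel ((T \<inter> unit_cube) \<inter> {x. x + (- y - int_vec k) \<in> unit_cube})" by simp
  qed
  also have "\<dots> = emeasure lborel (T \<inter> unit_cube)"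
  proof (rule emeasure_partition[symmetric])
    fix x assume "x \<in> T \<inter> unit_cube"
    show "\<exists>!k. x \<in> {x. x + (- y - int_vec k) \<in> unit_cube}"
      using unit_cube_minus[of "x - y"] by (simp add: algebra_simps)
  qed measurable
  also have "\<dots> = emeasure torus_vol A"
    by (subst emeasure_torus_vol) (auto simp: T_def Int_def)
  finally show ?thesis .
qed

lemma nn_integral_torus_vol_translate:
  fixes f :: "'n::finite torus \<Rightarrow> ennreal"
  assumes [measurable]: "f \<in> borel_measurable borel"
  shows "(\<integral>\<^sup>+X. f (X + Y) \<partial>torus_vol) = (\<integral>\<^sup>+X. f X \<partial>torus_vol)"
    and "(\<integral>\<^sup>+X. f (Y + X) \<partial>torus_vol) = (\<integral>\<^sup>+X. f X \<partial>torus_vol)"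
proof -
  have "distr torus_vol borel (\<lambda>X. X + Y) = torus_vol"
    by (intro measure_eqI) (simp_all add: emeasure_distr vimage_def emeasure_torus_vol_translate)
  then have "(\<integral>\<^sup>+X. f X \<partial>torus_vol) = (\<integral>\<^sup>+X. f X \<partial>distr torus_vol borel (\<lambda>X. X + Y))" by simp
  also have "\<dots> = (\<integral>\<^sup>+X. f (X + Y) \<partial>torus_vol)" by (rule nn_integral_distr) measurable
  finally show "(\<integral>\<^sup>+X. f (X + Y) \<partial>torus_vol) = (\<integral>\<^sup>+X. f X \<partial>torus_vol)" by simp
  then show "(\<integral>\<^sup>+X. f (Y + X) \<partial>torus_vol) = (\<integral>\<^sup>+X. f X \<partial>torus_vol)"
    by (simp add: add.commute)
qed

lemma nn_integral_lborel_scale: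
  fixes f :: "'a::euclidean_space \<Rightarrow> ennreal"
  assumes [measurable]: "f \<in> borel_measurable borel" and "c \<noteq> 0"
  shows "(\<integral>\<^sup>+x. f x \<partial>lborel) = ennreal (\<bar>c\<bar> ^ DIM('a)) * (\<integral>\<^sup>+x. f (c *\<^sub>R x) \<partial>lborel)"
proof -
  have "(\<integral>\<^sup>+x. f x \<partial>lborel) =
      (\<integral>\<^sup>+x. f x \<partial>density (distr lborel borel (\<lambda>x. 0 + c *\<^sub>R x)) (\<lambda>_. \<bar>c\<bar> ^ DIM('a)))"
    using lborel_affine[OF assms(2), of "0 :: 'a"] by metis
  also have "\<dots> = ennreal (\<bar>c\<bar> ^ DIM('a)) * (\<integral>\<^sup>+x. f (c *\<^sub>R x) \<partial>lborel)"
    by (simp add: nn_integral_density nn_integral_distr nn_integral_cmult)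
  finally show ?thesis .
qed

lemma nn_integral_lborel_translate:
  fixes f :: "'a::euclidean_space \<Rightarrow> ennreal"
  assumes [measurable]: "f \<in> borel_measurable borel"
  shows "(\<integral>\<^sup>+x. f (c + x) \<partial>lborel) = (\<integral>\<^sup>+x. f x \<partial>lborel)"
proof -
  have "(\<integral>\<^sup>+x. f x \<partial>lborel) = (\<integral>\<^sup>+x. f x \<partial>distr lborel borel ((+) c))"
    by (simp only: lborel_distr_plus)
  also have "\<dots> = (\<integral>\<^sup>+x. f (c + x) \<partial>lborel)" by (rule nn_integral_distr) measurable
  finally show ?thesis by simp
qed

lemma pair_torus_vol: "sets (torus_vol \<Otimes>\<^sub>M torus_vol) = sets (borel \<Otimes>\<^sub>M (borel :: 'n::finite torus measure))"
  by (intro sets_pair_measure_cong) simp_all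

interpretation torus_vol2: pair_prob_space torus_vol torus_vol ..

section \<open>Gaussian laws on the torus\<close>

text \<open>\<open>\<tau>\<close> is the standard deviation of each coordinate, not the variance; an
  increment over \<open>[s, t]\<close> has \<open>\<tau> = sqrt (t - s)\<close>.\<close>

definition gauss :: "real \<Rightarrow> real ^ 'n::finite \<Rightarrow> real" where
  "gauss \<tau> x = (\<Prod>i\<in>UNIV. normal_density 0 \<tau> (x $ i))"

lemma gauss_nonneg: "0 \<le> gauss \<tau> x"
  by (simp add: gauss_def prod_nonneg)

lemma measurable_gauss [measurable]: "gauss \<tau> \<in> borel_measurable borel"
  unfolding gauss_def by measurable

text \<open>One lattice cell suffices: on the preimage of the unit cube the Gaussian is bounded
  below by a positive constant, and the other cells can only add mass.\<close>

lemma torus_vol_le_gauss: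
  assumes "\<tau> > 0" "s > 0"
  obtains C where "0 \<le> C" "\<And>A :: 'n::finite torus set. A \<in> sets borel \<Longrightarrow> emeasure torus_vol A \<le>
    ennreal C * (\<integral>\<^sup>+x. ennreal (gauss \<tau> x) * indicator A (torus_proj (s *\<^sub>R x)) \<partial>lborel)"
proof
  \<comment> \<open>The least value of the Gaussian on the preimage of the cube, taken where every
    coordinate equals \<open>1 / s\<close>.\<close>
  define m where "m = normal_density 0 \<tau> (1 / s) ^ CARD('n)"
  have m: "m > 0" using assms by (simp add: m_def normal_density_pos)
  have gauss_ge: "m \<le> gauss \<tau> x" if "s *\<^sub>R x \<in> cbox 0 1" for x :: "real ^ 'n"
    unfolding m_def gauss_def prod_constant[symmetric]
  proof (intro prod_mono conjI)
    fix i :: 'n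
    have "0 \<le> s * x $ i" "s * x $ i \<le> 1" using that by (auto simp: mem_box_cart)
    then have "0 \<le> x $ i" "x $ i \<le> 1 / s" using assms by (simp_all add: zero_le_mult_iff field_simps)
    then have "(x $ i)\<^sup>2 \<le> (1 / s)\<^sup>2" by (intro power_mono)
    then show "normal_density 0 \<tau> (1 / s) \<le> normal_density 0 \<tau> (x $ i)"
      using assms unfolding normal_density_def
      by (intro mult_left_mono) (auto intro: divide_right_mono)
  qed simp
  show "0 \<le> s ^ DIM(real ^ 'n) / m" using m assms by simp
  fix A :: "'n torus set" assume [measurable]: "A \<in> sets borel"
  have "emeasure torus_vol A = (\<integral>\<^sup>+x. indicator (cbox 0 1) x * indicator A (torus_proj x) \<partial>lborel)"
    by (subst nn_integral_torus_vol[symmetric]) simp_all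
  also have "\<dots> = ennreal (\<bar>s\<bar> ^ DIM(real ^ 'n)) *
      (\<integral>\<^sup>+x. indicator (cbox 0 1) (s *\<^sub>R x) * indicator A (torus_proj (s *\<^sub>R x)) \<partial>lborel)"
    using assms by (intro nn_integral_lborel_scale) auto
  also have "\<dots> \<le> ennreal (\<bar>s\<bar> ^ DIM(real ^ 'n)) *
      (\<integral>\<^sup>+x. ennreal (1 / m) * (ennreal (gauss \<tau> x) * indicator A (torus_proj (s *\<^sub>R x))) \<partial>lborel)"
  proof (intro mult_left_mono nn_integral_mono)
    fix x :: "real ^ 'n"
    have "indicator (cbox 0 1) (s *\<^sub>R x) \<le> ennreal (1 / m * gauss \<tau> x)"
      using gauss_ge[of x] m gauss_nonneg[of \<tau> x]
      by (auto split: split_indicator simp: ennreal_1[symmetric] field_simps simp del: ennreal_1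
          intro!: ennreal_leI)
    then have "indicator (cbox 0 1) (s *\<^sub>R x) * indicator A (torus_proj (s *\<^sub>R x)) \<le>
      ennreal (1 / m * gauss \<tau> x) * indicator A (torus_proj (s *\<^sub>R x))"
      by (rule mult_right_mono) simp
    also have "\<dots> = ennreal (1 / m) * (ennreal (gauss \<tau> x) * indicator A (torus_proj (s *\<^sub>R x)))"
      using m gauss_nonneg[of \<tau> x] by (simp only: ennreal_mult'' mult.assoc)
    finally show "indicator (cbox 0 1) (s *\<^sub>R x) * indicator A (torus_proj (s *\<^sub>R x)) \<le>
      ennreal (1 / m) * (ennreal (gauss \<tau> x) * indicator A (torus_proj (s *\<^sub>R x)))" .
  qed simp
  also have "\<dots> = ennreal (s ^ DIM(real ^ 'n) / m) *
      (\<integral>\<^sup>+x. ennreal (gauss \<tau> x) * indicator A (torus_proj (s *\<^sub>R x)) \<partial>lborel)"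
    using assms m by (subst nn_integral_cmult) (simp_all add: mult.assoc[symmetric] ennreal_mult'[symmetric])
  finally show "emeasure torus_vol A \<le> ennreal (s ^ DIM(real ^ 'n) / m) *
      (\<integral>\<^sup>+x. ennreal (gauss \<tau> x) * indicator A (torus_proj (s *\<^sub>R x)) \<partial>lborel)" .
qed

text \<open>Averaging the wider Gaussian over translates by \<open>u \<in> [0,1]\<^sup>n\<close> avoids summing over the lattice.\<close>

lemma gauss_le_torus_vol:
  assumes \<tau>: "\<tau> > 0" and s: "s > 0" and one: "(\<integral>\<^sup>+x. gauss \<tau> x \<partial>(lborel :: (real ^ 'n::finite) measure)) = 1"
  obtains C where "0 \<le> C" "\<And>A :: 'n torus set. A \<in> sets borel \<Longrightarrow>
    (\<integral>\<^sup>+x. ennreal (gauss \<tau> x) * indicator A (torus_proj (s *\<^sub>R x)) \<partial>lborel) \<le>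
    ennreal C * emeasure torus_vol A"
proof
  define E where "E = exp ((1 / s)\<^sup>2 / (2 * \<tau>\<^sup>2)) ^ CARD('n)"
  have E: "E > 0" by (simp add: E_def)
  \<comment> \<open>Scaling the argument by \<open>1 / sqrt 2\<close> doubles the variance. Since
    \<open>(x - v)\<^sup>2 / 2 \<le> x\<^sup>2 + v\<^sup>2\<close>, the wider Gaussian dominates
    even with its centre moved by \<open>v\<close>; the factor \<open>E\<close> pays for
    \<open>v\<^sup>2 \<le> (1 / s)\<^sup>2\<close> in each coordinate.\<close>
  define r where "r = 1 / sqrt 2"
  have r: "r > 0" "r\<^sup>2 = 1 / 2" by (simp_all add: r_def power_divide)
  have gauss_le: "gauss \<tau> x \<le> E * gauss \<tau> (r *\<^sub>R (x - (1 / s) *\<^sub>R u))"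
    if "u \<in> cbox 0 1" for x u :: "real ^ 'n"
    unfolding E_def gauss_def prod_constant[symmetric] prod.distrib[symmetric]
  proof (intro prod_mono conjI)
    fix i :: 'n
    define v where "v = 1 / s * u $ i"
    have "0 \<le> u $ i" "u $ i \<le> 1" using that by (auto simp: mem_box_cart)
    then have "0 \<le> v" "v \<le> 1 / s" using s by (simp_all add: v_def field_simps)
    then have "v\<^sup>2 \<le> (1 / s)\<^sup>2" by (intro power_mono)
    moreover have "(r * (x $ i - v))\<^sup>2 \<le> v\<^sup>2 + (x $ i)\<^sup>2"
      using zero_le_power2[of "x $ i + v"]
      by (simp add: power_mult_distrib r(2) power2_diff power2_sum)
    ultimately have "(r * (x $ i - v))\<^sup>2 - (1 / s)\<^sup>2 \<le> (x $ i)\<^sup>2" by linarith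
    then have "((r * (x $ i - v))\<^sup>2 - (1 / s)\<^sup>2) / (2 * \<tau>\<^sup>2) \<le> (x $ i)\<^sup>2 / (2 * \<tau>\<^sup>2)"
      by (rule divide_right_mono) simp
    then have "- (x $ i)\<^sup>2 / (2 * \<tau>\<^sup>2) \<le> (1 / s)\<^sup>2 / (2 * \<tau>\<^sup>2) + - (r * (x $ i - v))\<^sup>2 / (2 * \<tau>\<^sup>2)"
      by (simp add: diff_divide_distrib)
    then have "exp (- (x $ i)\<^sup>2 / (2 * \<tau>\<^sup>2)) \<le> exp ((1 / s)\<^sup>2 / (2 * \<tau>\<^sup>2)) * exp (- (r * (x $ i - v))\<^sup>2 / (2 * \<tau>\<^sup>2))"
      by (simp only: exp_add[symmetric] exp_le_cancel_iff)
    then have "1 / sqrt (2 * pi * \<tau>\<^sup>2) * exp (- (x $ i)\<^sup>2 / (2 * \<tau>\<^sup>2)) \<le>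
       1 / sqrt (2 * pi * \<tau>\<^sup>2) * (exp ((1 / s)\<^sup>2 / (2 * \<tau>\<^sup>2)) * exp (- (r * (x $ i - v))\<^sup>2 / (2 * \<tau>\<^sup>2)))"
      by (rule mult_left_mono) simp
    then show "normal_density 0 \<tau> (x $ i) \<le>
        exp ((1 / s)\<^sup>2 / (2 * \<tau>\<^sup>2)) * normal_density 0 \<tau> ((r *\<^sub>R (x - (1 / s) *\<^sub>R u)) $ i)"
      by (simp add: normal_density_def v_def mult.left_commute)
  qed simp
  let ?D = "ennreal ((1 / r) ^ DIM(real ^ 'n))"
  show "0 \<le> E * (1 / r) ^ DIM(real ^ 'n)" using E r by simp
  fix A :: "'n torus set" assume [measurable]: "A \<in> sets borel"
  have "(\<integral>\<^sup>+x. ennreal (gauss \<tau> x) * indicator A (torus_proj (s *\<^sub>R x)) \<partial>lborel) =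
    (\<integral>\<^sup>+x. (\<integral>\<^sup>+u. indicator (cbox 0 1) u * (ennreal (gauss \<tau> x) * indicator A (torus_proj (s *\<^sub>R x)))
        \<partial>(lborel :: (real ^ 'n) measure)) \<partial>lborel)"
    by (simp add: nn_integral_multc emeasure_cbox_0_1)
  also have "\<dots> \<le> (\<integral>\<^sup>+x. (\<integral>\<^sup>+u. indicator (cbox 0 1) u *
      (ennreal (E * gauss \<tau> (r *\<^sub>R (x - (1 / s) *\<^sub>R u))) * indicator A (torus_proj (s *\<^sub>R x)))
        \<partial>(lborel :: (real ^ 'n) measure)) \<partial>lborel)"
    using gauss_le by (intro nn_integral_mono) (auto split: split_indicator intro!: ennreal_leI)
  also have "\<dots> = (\<integral>\<^sup>+u. (\<integral>\<^sup>+x. indicator (cbox 0 1) u *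
      (ennreal (E * gauss \<tau> (r *\<^sub>R (x - (1 / s) *\<^sub>R u))) * indicator A (torus_proj (s *\<^sub>R x)))
        \<partial>lborel) \<partial>(lborel :: (real ^ 'n) measure))"
    by (rule lborel_pair.Fubini') measurable
  \<comment> \<open>Shifting \<open>x\<close> by \<open>(1 / s) *\<^sub>R u\<close> moves the
    translate from the Gaussian into the torus argument. After exchanging the integrals again, the
    \<open>u\<close>-integral over the cube is one for \<open>torus_vol\<close>, and invariance
    frees it from \<open>x\<close>.\<close>
  also have "\<dots> = (\<integral>\<^sup>+u. (\<integral>\<^sup>+x. indicator (cbox 0 1) u *
      (ennreal (E * gauss \<tau> (r *\<^sub>R x)) * indicator A (torus_proj (u + s *\<^sub>R x)))
        \<partial>lborel) \<partial>(lborel :: (real ^ 'n) measure))"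
  proof (rule nn_integral_cong)
    fix u :: "real ^ 'n"
    show "(\<integral>\<^sup>+x. indicator (cbox 0 1) u *
      (ennreal (E * gauss \<tau> (r *\<^sub>R (x - (1 / s) *\<^sub>R u))) * indicator A (torus_proj (s *\<^sub>R x))) \<partial>lborel) =
      (\<integral>\<^sup>+x. indicator (cbox 0 1) u *
      (ennreal (E * gauss \<tau> (r *\<^sub>R x)) * indicator A (torus_proj (u + s *\<^sub>R x))) \<partial>lborel)"
      using s by (subst nn_integral_lborel_translate[of _ "(1 / s) *\<^sub>R u", symmetric])
        (simp_all add: scaleR_add_right)
  qed
  also have "\<dots> = (\<integral>\<^sup>+x. (\<integral>\<^sup>+u. indicator (cbox 0 1) u *
      (ennreal (E * gauss \<tau> (r *\<^sub>R x)) * indicator A (torus_proj (u + s *\<^sub>R x)))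
        \<partial>lborel) \<partial>(lborel :: (real ^ 'n) measure))"
    by (rule lborel_pair.Fubini') measurable
  also have "\<dots> = (\<integral>\<^sup>+x. ennreal (E * gauss \<tau> (r *\<^sub>R x)) * emeasure torus_vol A \<partial>(lborel :: (real ^ 'n) measure))"
  proof (rule nn_integral_cong)
    fix x :: "real ^ 'n"
    have "(\<integral>\<^sup>+u. indicator (cbox 0 1) u *
      (ennreal (E * gauss \<tau> (r *\<^sub>R x)) * indicator A (torus_proj (u + s *\<^sub>R x))) \<partial>lborel) =
      ennreal (E * gauss \<tau> (r *\<^sub>R x)) *
      (\<integral>\<^sup>+u. indicator (cbox 0 1) u * indicator A (torus_proj u + torus_proj (s *\<^sub>R x)) \<partial>lborel)"
      by (subst nn_integral_cmult[symmetric]) (simp_all add: torus_proj_add mult.left_commute)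
    also have "(\<integral>\<^sup>+u. indicator (cbox 0 1) u * indicator A (torus_proj u + torus_proj (s *\<^sub>R x)) \<partial>lborel) =
      (\<integral>\<^sup>+X. indicator A (X + torus_proj (s *\<^sub>R x)) \<partial>torus_vol)"
      by (rule nn_integral_torus_vol[symmetric]) measurable
    also have "\<dots> = emeasure torus_vol A"
      by (subst nn_integral_torus_vol_translate) simp_all
    finally show "(\<integral>\<^sup>+u. indicator (cbox 0 1) u *
      (ennreal (E * gauss \<tau> (r *\<^sub>R x)) * indicator A (torus_proj (u + s *\<^sub>R x))) \<partial>lborel) =
      ennreal (E * gauss \<tau> (r *\<^sub>R x)) * emeasure torus_vol A" .
  qed
  also have "\<dots> = (\<integral>\<^sup>+x. ennreal (gauss \<tau> (r *\<^sub>R x)) \<partial>(lborel :: (real ^ 'n) measure)) * ennreal E * emeasure torus_vol A"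
    using E by (simp add: nn_integral_multc nn_integral_cmult ennreal_mult' mult.commute)
  also have "(\<integral>\<^sup>+x. ennreal (gauss \<tau> (r *\<^sub>R x)) \<partial>(lborel :: (real ^ 'n) measure)) =
      ?D * (\<integral>\<^sup>+x. ennreal (gauss \<tau> x) \<partial>(lborel :: (real ^ 'n) measure))"
    using r by (subst nn_integral_lborel_scale[of _ "1 / r"]) simp_all
  also have "?D * (\<integral>\<^sup>+x. ennreal (gauss \<tau> x) \<partial>(lborel :: (real ^ 'n) measure)) * ennreal E * emeasure torus_vol A =
      ennreal (E * (1 / r) ^ DIM(real ^ 'n)) * emeasure torus_vol A"
    using E r by (simp add: one ennreal_mult' mult.commute)
  finally show "(\<integral>\<^sup>+x. ennreal (gauss \<tau> x) * indicator A (torus_proj (s *\<^sub>R x)) \<partial>lborel) \<le>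
    ennreal (E * (1 / r) ^ DIM(real ^ 'n)) * emeasure torus_vol A" .
qed

section \<open>Brownian motion on the torus\<close>

lemma measurable_path_coord:
  assumes "t \<in> {0..1}"
  shows "(\<lambda>\<omega>. \<omega> t) \<in> path_space \<rightarrow>\<^sub>M (borel :: 'n::finite torus measure)"
  unfolding path_space_def
  by (intro measurable_restrict_space1 measurable_component_singleton assms)

locale torus_brownian_motion = prob_space M for M :: "'m measure" +
  fixes B :: "real \<Rightarrow> 'm \<Rightarrow> real ^ 'n::finite" and a :: real
  assumes bm: "std_brownian_motion M B" and a: "a > 0"
begin

section \<open>Brownian increments and their laws on the torus\<close>

lemma B_measurable [measurable]: "t \<in> {0..1} \<Longrightarrow> B t \<in> borel_measurable M"
  using bm by (simp add: std_brownian_motion_def)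

lemma B_0: "w \<in> space M \<Longrightarrow> B 0 w = 0"
  using bm by (simp add: std_brownian_motion_def)

lemma B_continuous: "w \<in> space M \<Longrightarrow> continuous_on {0..1} (\<lambda>t. B t w)"
  using bm by (simp add: std_brownian_motion_def)

lemma B_distributed: "0 \<le> s \<Longrightarrow> s < t \<Longrightarrow> t \<le> 1 \<Longrightarrow>
    distributed M lborel (\<lambda>w. B t w - B s w) (\<lambda>x. ennreal (gauss (sqrt (t - s)) x))"
  using bm by (simp add: std_brownian_motion_def gauss_def)

text \<open>The independence clause for the partition \<open>0 < p < q < 1\<close>; with three
  increments only the values of \<open>\<tau>\<close> up to index \<open>3\<close> are read.\<close>

lemma B_indep:
  assumes "0 < p" "p < q" "q < 1"
  defines "\<tau> \<equiv> \<lambda>i::nat. if i = 0 then 0 else if i = 1 then p else if i = 2 then q else 1"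
  shows "indep_vars (\<lambda>_. borel) (\<lambda>i w. B (\<tau> (Suc i)) w - B (\<tau> i) w) {..<3}"
proof -
  have "\<forall>i<3::nat. \<tau> i < \<tau> (Suc i)" "0 \<le> \<tau> 0" "\<tau> 3 \<le> 1"
    using assms by (auto simp: \<tau>_def less_Suc_eq numeral_3_eq_3)
  moreover have "(\<forall>i<3. \<tau> i < \<tau> (Suc i)) \<and> 0 \<le> \<tau> 0 \<and> \<tau> 3 \<le> 1 \<longrightarrow>
      indep_vars (\<lambda>_. borel) (\<lambda>i w. B (\<tau> (Suc i)) w - B (\<tau> i) w) {..<3}"
    using bm unfolding std_brownian_motion_def by blast
  ultimately show ?thesis by blast
qed

text \<open>The displacement on the torus: a path started at \<open>x\<close> is at
  \<open>x + W t w\<close> at time \<open>t\<close>.\<close>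

definition W :: "real \<Rightarrow> 'm \<Rightarrow> 'n torus" where
  "W t w = torus_proj (sqrt a *\<^sub>R B t w)"

lemma W_measurable [measurable]: "t \<in> {0..1} \<Longrightarrow> W t \<in> borel_measurable M"
  unfolding W_def[abs_def] by measurable

lemma W_0: "w \<in> space M \<Longrightarrow> W 0 w = 0"
  by (simp add: W_def B_0 zero_torus.abs_eq)

lemma W_diff: "W t w - W s w = torus_proj (sqrt a *\<^sub>R (B t w - B s w))"
  by (simp add: W_def minus_torus.abs_eq scaleR_diff_right)

text \<open>\<open>B p\<close> and \<open>B q\<close> are functions of the first two increments, and
  the last displacement depends on the third alone. Applied with \<open>q = 1 / 2\<close> and
  \<open>p\<close> the observation time.\<close>

lemma indep_past:
  assumes "0 < p" "p < q" "q < 1"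
  shows "distr M ((borel \<Otimes>\<^sub>M borel) \<Otimes>\<^sub>M borel) (\<lambda>w. ((B p w, B q w), W 1 w - W q w)) =
    distr M (borel \<Otimes>\<^sub>M borel) (\<lambda>w. (B p w, B q w)) \<Otimes>\<^sub>M distr M borel (\<lambda>w. W 1 w - W q w)"
proof -
  define D where "D i w = (let \<tau> = (\<lambda>i::nat. if i = 0 then 0 else if i = 1 then p else if i = 2 then q else 1)
    in B (\<tau> (Suc i)) w - B (\<tau> i) w)" for i w
  have D: "indep_vars (\<lambda>_. borel) D {..<3}"
    using B_indep[OF assms] by (simp add: D_def[abs_def])
  have "distr M ((borel \<Otimes>\<^sub>M borel) \<Otimes>\<^sub>M borel)
        (\<lambda>w. ((D 0 w, D 0 w + D 1 w), torus_proj (sqrt a *\<^sub>R D 2 w))) =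
      distr M (borel \<Otimes>\<^sub>M borel) (\<lambda>w. (D 0 w, D 0 w + D 1 w)) \<Otimes>\<^sub>M
      distr M borel (\<lambda>w. torus_proj (sqrt a *\<^sub>R D 2 w))"
    using indep_var_distr_pair[OF indep_var_restrict[OF D, of "{0, 1}" "{2}"],
        of "\<lambda>f. (f 0, f 0 + f 1)" "borel \<Otimes>\<^sub>M borel" "\<lambda>f. torus_proj (sqrt a *\<^sub>R f 2)" borel]
    by simp
  moreover have "D 0 w = B p w" "D 0 w + D 1 w = B q w" "D 2 w = B 1 w - B q w"
    if "w \<in> space M" for w
    using B_0[OF that] by (simp_all add: D_def)
  ultimately show ?thesis by (simp only: W_diff cong: distr_cong)
qed

text \<open>The time-reversed counterpart: positions are recorded relative to the end point. Applied
  with \<open>p = 1 / 2\<close> and \<open>q\<close> the observation time.\<close>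

lemma indep_future:
  assumes "0 < p" "p < q" "q < 1"
  shows "distr M ((borel \<Otimes>\<^sub>M borel) \<Otimes>\<^sub>M borel) (\<lambda>w. ((B 1 w - B q w, B 1 w - B p w), W p w)) =
    distr M (borel \<Otimes>\<^sub>M borel) (\<lambda>w. (B 1 w - B q w, B 1 w - B p w)) \<Otimes>\<^sub>M distr M borel (W p)"
proof -
  define D where "D i w = (let \<tau> = (\<lambda>i::nat. if i = 0 then 0 else if i = 1 then p else if i = 2 then q else 1)
    in B (\<tau> (Suc i)) w - B (\<tau> i) w)" for i w
  have D: "indep_vars (\<lambda>_. borel) D {..<3}"
    using B_indep[OF assms] by (simp add: D_def[abs_def])
  have "distr M ((borel \<Otimes>\<^sub>M borel) \<Otimes>\<^sub>M borel)
        (\<lambda>w. ((D 2 w, D 2 w + D 1 w), torus_proj (sqrt a *\<^sub>R D 0 w))) =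
      distr M (borel \<Otimes>\<^sub>M borel) (\<lambda>w. (D 2 w, D 2 w + D 1 w)) \<Otimes>\<^sub>M
      distr M borel (\<lambda>w. torus_proj (sqrt a *\<^sub>R D 0 w))"
    using indep_var_distr_pair[OF indep_var_restrict[OF D, of "{1, 2}" "{0}"],
        of "\<lambda>f. (f 2, f 2 + f 1)" "borel \<Otimes>\<^sub>M borel" "\<lambda>f. torus_proj (sqrt a *\<^sub>R f 0)" borel]
    by simp
  moreover have "D 0 w = B p w" "D 2 w + D 1 w = B 1 w - B p w" "D 2 w = B 1 w - B q w"
    if "w \<in> space M" for w
    using B_0[OF that] by (simp_all add: D_def)
  ultimately show ?thesis unfolding W_def[abs_def] by (simp only: cong: distr_cong)
qed

lemma W_diff_law:
  assumes "0 \<le> s" "s < t" "t \<le> 1" and [measurable]: "A \<in> sets borel"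
  shows "emeasure (distr M borel (\<lambda>w. W t w - W s w)) A =
    (\<integral>\<^sup>+x. ennreal (gauss (sqrt (t - s)) x) * indicator A (torus_proj (sqrt a *\<^sub>R x)) \<partial>lborel)"
proof -
  have [measurable]: "W t \<in> borel_measurable M" "W s \<in> borel_measurable M"
    using assms by auto
  have "emeasure (distr M borel (\<lambda>w. W t w - W s w)) A = (\<integral>\<^sup>+y. indicator A y \<partial>distr M borel (\<lambda>w. W t w - W s w))"
    by simp
  also have "\<dots> = (\<integral>\<^sup>+w. indicator A (W t w - W s w) \<partial>M)"
    by (rule nn_integral_distr) measurable
  also have "\<dots> = (\<integral>\<^sup>+w. indicator A (torus_proj (sqrt a *\<^sub>R (B t w - B s w))) \<partial>M)"
    by (simp only: W_diff)
  also have "\<dots> = (\<integral>\<^sup>+x. ennreal (gauss (sqrt (t - s)) x) * indicator A (torus_proj (sqrt a *\<^sub>R x)) \<partial>lborel)"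
    by (rule distributed_nn_integral[OF B_distributed, symmetric]) (use assms in measurable)
  finally show ?thesis .
qed

text \<open>Here the volume has a density with respect to the increment law, not the other way
  round. It is bounded because the Gaussian law dominates a multiple of the volume.\<close>

lemma W_diff_density:
  assumes "0 \<le> s" "s < t" "t \<le> 1"
  obtains C and k :: "'n torus \<Rightarrow> real" where "0 \<le> C" "k \<in> borel_measurable borel" "\<And>x. 0 \<le> k x"
    "\<And>x. k x \<le> C" "density (distr M borel (\<lambda>w. W t w - W s w)) k = torus_vol"
proof -
  have [measurable]: "W t \<in> borel_measurable M" "W s \<in> borel_measurable M"
    using assms by auto
  obtain C where C: "0 \<le> C" "\<And>A :: 'n torus set. A \<in> sets borel \<Longrightarrow> emeasure torus_vol A \<le>
    ennreal C * (\<integral>\<^sup>+x. ennreal (gauss (sqrt (t - s)) x) * indicator A (torus_proj (sqrt a *\<^sub>R x)) \<partial>lborel)"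
    using torus_vol_le_gauss[of "sqrt (t - s)" "sqrt a"] assms a by auto
  interpret N: prob_space "distr M borel (\<lambda>w. W t w - W s w)"
    by (rule prob_space_distr) measurable
  obtain k :: "'n torus \<Rightarrow> real" where "k \<in> borel_measurable (distr M borel (\<lambda>w. W t w - W s w))"
    "\<And>x. 0 \<le> k x" "\<And>x. k x \<le> C" "torus_vol = density (distr M borel (\<lambda>w. W t w - W s w)) k"
    by (rule bounded_density[OF N.finite_measure_axioms, of torus_vol C])
      (use C assms in \<open>auto simp: W_diff_law\<close>)
  then show thesis using that[OF C(1)] by simp
qed

text \<open>The opposite comparison. The Gaussian need not be integrated explicitly: it is the
  density of an increment, so its total mass is that of \<open>M\<close>.\<close>

lemma W_diff_law_le:
  assumes "0 \<le> s" "s < t" "t \<le> 1"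
  obtains C where "0 \<le> C" "\<And>A. A \<in> sets borel \<Longrightarrow>
    emeasure (distr M borel (\<lambda>w. W t w - W s w)) A \<le> ennreal C * emeasure torus_vol A"
proof -
  have "(\<integral>\<^sup>+x. ennreal (gauss (sqrt (t - s)) x) * 1 \<partial>(lborel :: (real ^ 'n) measure)) = (\<integral>\<^sup>+w. 1 \<partial>M)"
    by (rule distributed_nn_integral[OF B_distributed]) (use assms in auto)
  then have "(\<integral>\<^sup>+x. gauss (sqrt (t - s)) x \<partial>(lborel :: (real ^ 'n) measure)) = 1"
    by (simp add: emeasure_space_1)
  from gauss_le_torus_vol[OF _ _ this, of "sqrt a"] assms a
  obtain C where "0 \<le> C" "\<And>A :: 'n torus set. A \<in> sets borel \<Longrightarrow>
    (\<integral>\<^sup>+x. ennreal (gauss (sqrt (t - s)) x) * indicator A (torus_proj (sqrt a *\<^sub>R x)) \<partial>lborel)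
      \<le> ennreal C * emeasure torus_vol A" by auto
  then show thesis using that[of C] assms by (simp add: W_diff_law)
qed

section \<open>The reversible law as a mixture over starting points\<close>

abbreviation R :: "(real \<Rightarrow> 'n torus) measure" where
  "R \<equiv> reversible_brownian_law a M B"

lemma torus_path_apply: "t \<in> {0..1} \<Longrightarrow> torus_path a B x w t = x + W t w"
  by (simp add: torus_path_def W_def)

lemma measurable_torus_path [measurable]:
  "(\<lambda>z. torus_path a B (fst z) (snd z)) \<in> torus_vol \<Otimes>\<^sub>M M \<rightarrow>\<^sub>M path_space"
  unfolding path_space_def
proof (rule measurable_restrict_space2)
  show "(\<lambda>z. torus_path a B (fst z) (snd z)) \<in> space (torus_vol \<Otimes>\<^sub>M M) \<rightarrow> path_set"
  proof
    fix z :: "'n torus \<times> 'm" assume "z \<in> space (torus_vol \<Otimes>\<^sub>M M)"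
    then have "snd z \<in> space M" by (auto simp: space_pair_measure)
    then have "continuous_on {0..1} (\<lambda>t. fst z + torus_proj (sqrt a *\<^sub>R B t (snd z)))"
      by (intro continuous_intros B_continuous)
    then have "continuous_on {0..1} (torus_path a B (fst z) (snd z))"
      by (rule continuous_on_cong[THEN iffD1, rotated 2]) (auto simp: torus_path_def)
    then show "torus_path a B (fst z) (snd z) \<in> path_set"
      by (simp add: path_set_def torus_path_def)
  qed
  show "(\<lambda>z. torus_path a B (fst z) (snd z)) \<in> torus_vol \<Otimes>\<^sub>M M \<rightarrow>\<^sub>M (\<Pi>\<^sub>M t\<in>{0..1}. borel)"
    unfolding torus_path_def W_def[symmetric]
  proof (rule measurable_restrict)
    fix t :: real assume "t \<in> {0..1}"
    then have [measurable]: "W t \<in> borel_measurable M" by simp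
    show "(\<lambda>z. fst z + W t (snd z)) \<in> torus_vol \<Otimes>\<^sub>M M \<rightarrow>\<^sub>M borel" by measurable
  qed
qed

text \<open>The measurability condition under which the integral formula for \<open>bind\<close>
  applies.\<close>

lemma brownian_law_kernel: "brownian_law a M B \<in> torus_vol \<rightarrow>\<^sub>M subprob_algebra path_space"
  unfolding brownian_law_def[abs_def]
proof (rule measurable_distr2)
  show "(\<lambda>(x, w). torus_path a B x w) \<in> torus_vol \<Otimes>\<^sub>M M \<rightarrow>\<^sub>M path_space"
    using measurable_torus_path by (simp add: case_prod_beta')
  show "(\<lambda>x. M) \<in> torus_vol \<rightarrow>\<^sub>M subprob_algebra M"
    by (intro measurable_const) (simp add: space_subprob_algebra subprob_space_axioms)
qed

lemma measurable_torus_path' [measurable]: "torus_path a B x \<in> M \<rightarrow>\<^sub>M path_space"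
proof -
  have "(\<lambda>w. (x, w)) \<in> M \<rightarrow>\<^sub>M torus_vol \<Otimes>\<^sub>M M" by measurable
  from measurable_compose[OF this measurable_torus_path] show ?thesis by simp
qed

lemma sets_R: "sets R = sets path_space"
  unfolding reversible_brownian_law_def by (rule sets_bind) (auto simp: brownian_law_def)

lemma measurable_R [simp]: "borel_measurable R = borel_measurable path_space"
  by (rule measurable_cong_sets[OF sets_R refl])

lemma nn_integral_R:
  assumes [measurable]: "f \<in> borel_measurable path_space"
  shows "(\<integral>\<^sup>+\<omega>. f \<omega> \<partial>R) = (\<integral>\<^sup>+x. \<integral>\<^sup>+w. f (torus_path a B x w) \<partial>M \<partial>torus_vol)"
  unfolding reversible_brownian_law_def
  by (subst nn_integral_bind[OF assms brownian_law_kernel])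
    (simp add: brownian_law_def nn_integral_distr)

lemma prob_space_R: "prob_space R"
proof
  have "emeasure R (space R) = (\<integral>\<^sup>+\<omega>. 1 \<partial>R)" by simp
  also have "\<dots> = 1"
    by (subst nn_integral_R) (simp_all add: emeasure_space_1 torus_vol.emeasure_space_1[simplified])
  finally show "emeasure R (space R) = 1" .
qed

text \<open>The weight \<open>k\<close> makes \<open>V\<close> uniform while keeping it independent
  of \<open>Z\<close>. By translation invariance \<open>x + (u (Z w) + V w)\<close> is then uniform
  for each fixed \<open>x\<close> and \<open>Z w\<close>, so the end point turns into a separate
  variable \<open>y\<close>, integrated independently.\<close>

lemma nn_integral_uniformize:
  fixes V :: "'m \<Rightarrow> 'n torus" and k :: "'n torus \<Rightarrow> real" and G :: "'n torus \<Rightarrow> 'n torus \<Rightarrow> 's \<Rightarrow> ennreal"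
  assumes Z[measurable]: "Z \<in> M \<rightarrow>\<^sub>M S" and V[measurable]: "V \<in> borel_measurable M"
    and u[measurable]: "u \<in> borel_measurable S"
    and ind: "distr M (S \<Otimes>\<^sub>M borel) (\<lambda>w. (Z w, V w)) = distr M S Z \<Otimes>\<^sub>M distr M borel V"
    and k[measurable]: "k \<in> borel_measurable borel" and unif: "density (distr M borel V) k = torus_vol"
    and G[measurable]: "(\<lambda>(x, y, z). G x y z) \<in> borel_measurable (borel \<Otimes>\<^sub>M borel \<Otimes>\<^sub>M S)"
  shows "(\<integral>\<^sup>+x. \<integral>\<^sup>+w. G x (x + (u (Z w) + V w)) (Z w) * ennreal (k (V w)) \<partial>M \<partial>torus_vol) =
    (\<integral>\<^sup>+x. \<integral>\<^sup>+y. \<integral>\<^sup>+w. G x y (Z w) \<partial>M \<partial>torus_vol \<partial>torus_vol)"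
proof (rule nn_integral_cong)
  fix x :: "'n torus"
  interpret Z: prob_space "distr M S Z" by (rule prob_space_distr) measurable
  interpret V: prob_space "distr M borel V" by (rule prob_space_distr) measurable
  interpret P: pair_sigma_finite "distr M S Z" torus_vol ..
  have "(\<integral>\<^sup>+w. G x (x + (u (Z w) + V w)) (Z w) * ennreal (k (V w)) \<partial>M) =
    (\<integral>\<^sup>+w. (\<lambda>(z, v). G x (x + (u z + v)) z * ennreal (k v)) (Z w, V w) \<partial>M)" by simp
  also have "\<dots> = (\<integral>\<^sup>+zv. (\<lambda>(z, v). G x (x + (u z + v)) z * ennreal (k v)) zv
      \<partial>distr M (S \<Otimes>\<^sub>M borel) (\<lambda>w. (Z w, V w)))"
    by (rule nn_integral_distr[symmetric]) measurable
  also have "\<dots> = (\<integral>\<^sup>+z. \<integral>\<^sup>+v. G x (x + (u z + v)) z * ennreal (k v) \<partial>distr M borel V \<partial>distr M S Z)"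
    unfolding ind by (subst V.nn_integral_fst[symmetric]) (auto simp: case_prod_beta')
  also have "\<dots> = (\<integral>\<^sup>+z. \<integral>\<^sup>+y. G x y z \<partial>torus_vol \<partial>distr M S Z)"
  proof (rule nn_integral_cong)
    fix z assume "z \<in> space (distr M S Z)"
    then have [measurable]: "z \<in> space S" by simp
    have Gz[measurable]: "(\<lambda>y. G x y z) \<in> borel_measurable borel"
    proof -
      have "(\<lambda>y. (x, y, z)) \<in> borel \<rightarrow>\<^sub>M borel \<Otimes>\<^sub>M borel \<Otimes>\<^sub>M S" by measurable
      from measurable_compose[OF this G] show ?thesis by simp
    qed
    have "(\<integral>\<^sup>+v. G x (x + (u z + v)) z * ennreal (k v) \<partial>distr M borel V) =
      (\<integral>\<^sup>+v. G x (x + (u z + v)) z \<partial>density (distr M borel V) k)"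
      by (subst nn_integral_density) (auto simp: mult.commute)
    also have "\<dots> = (\<integral>\<^sup>+v. G x ((x + u z) + v) z \<partial>torus_vol)" by (simp add: unif add.assoc)
    also have "\<dots> = (\<integral>\<^sup>+y. G x y z \<partial>torus_vol)"
      by (rule nn_integral_torus_vol_translate(2)) measurable
    finally show "(\<integral>\<^sup>+v. G x (x + (u z + v)) z * ennreal (k v) \<partial>distr M borel V) =
      (\<integral>\<^sup>+y. G x y z \<partial>torus_vol)" .
  qed
  also have "\<dots> = (\<integral>\<^sup>+y. \<integral>\<^sup>+z. G x y z \<partial>distr M S Z \<partial>torus_vol)"
    by (rule P.Fubini'[symmetric]) measurable
  also have "\<dots> = (\<integral>\<^sup>+y. \<integral>\<^sup>+w. G x y (Z w) \<partial>M \<partial>torus_vol)"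
    by (intro nn_integral_cong nn_integral_distr) measurable
  finally show "(\<integral>\<^sup>+w. G x (x + (u (Z w) + V w)) (Z w) * ennreal (k (V w)) \<partial>M) =
    (\<integral>\<^sup>+y. \<integral>\<^sup>+w. G x y (Z w) \<partial>M \<partial>torus_vol)" .
qed

section \<open>The endpoint law and the reweighted path measure\<close>

lemma endpoints_measurable:
  "(\<lambda>\<omega>. \<omega> 0) \<in> path_space \<rightarrow>\<^sub>M (borel :: 'n torus measure)"
  "(\<lambda>\<omega>. \<omega> 1) \<in> path_space \<rightarrow>\<^sub>M (borel :: 'n torus measure)"
  "(\<lambda>\<omega>. \<omega> (1 / 2)) \<in> path_space \<rightarrow>\<^sub>M (borel :: 'n torus measure)"
  by (intro measurable_path_coord; simp)+

text \<open>Given the start \<open>x\<close>, the end point is \<open>x + W 1 w\<close>. The bound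
  on the law of \<open>W 1\<close> is applied on each fibre and then integrated over
  \<open>x\<close>.\<close>

lemma endpoint_law_R_le:
  obtains C where "0 \<le> C" "\<And>A. A \<in> sets (torus_vol \<Otimes>\<^sub>M torus_vol) \<Longrightarrow>
    emeasure (endpoint_law R) A \<le> ennreal C * emeasure (torus_vol \<Otimes>\<^sub>M torus_vol) A"
proof -
  obtain C where C: "0 \<le> C" "\<And>A. A \<in> sets borel \<Longrightarrow>
    emeasure (distr M borel (\<lambda>w. W 1 w - W 0 w)) A \<le> ennreal C * emeasure torus_vol A"
    using W_diff_law_le[of 0 1] by auto
  have W1[measurable]: "W 1 \<in> borel_measurable M" by simp
  have WW: "distr M borel (\<lambda>w. W 1 w - W 0 w) = distr M borel (W 1)"
    by (intro distr_cong) (auto simp: W_0)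
  show thesis
  proof (rule that[OF C(1)])
    fix A :: "('n torus \<times> 'n torus) set" assume "A \<in> sets (torus_vol \<Otimes>\<^sub>M torus_vol)"
    then have A[measurable]: "A \<in> sets (borel \<Otimes>\<^sub>M borel)" by (simp add: pair_torus_vol)
    have sl[measurable]: "{v. (x, x + v) \<in> A} \<in> sets borel" for x
    proof -
      have "{v \<in> space borel. (x, x + v) \<in> A} \<in> sets borel" by measurable
      then show ?thesis by simp
    qed
    have ends: "(\<lambda>\<omega>. (\<omega> 0, \<omega> 1)) \<in> path_space \<rightarrow>\<^sub>M borel \<Otimes>\<^sub>M (borel :: 'n torus measure)"
      by (intro measurable_Pair endpoints_measurable)
    have ends_R: "(\<lambda>\<omega>. (\<omega> 0, \<omega> 1)) \<in> R \<rightarrow>\<^sub>M borel \<Otimes>\<^sub>M borel"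
      using ends unfolding measurable_cong_sets[OF sets_R refl] .
    have "emeasure (endpoint_law R) A = (\<integral>\<^sup>+z. indicator A z \<partial>endpoint_law R)"
      by (simp add: endpoint_law_def)
    also have "\<dots> = (\<integral>\<^sup>+\<omega>. indicator A (\<omega> 0, \<omega> 1) \<partial>R)"
      unfolding endpoint_law_def by (rule nn_integral_distr[OF ends_R]) measurable
    also have "\<dots> = (\<integral>\<^sup>+x. \<integral>\<^sup>+w. indicator A (torus_path a B x w 0, torus_path a B x w 1) \<partial>M \<partial>torus_vol)"
      by (rule nn_integral_R[OF measurable_compose[OF ends borel_measurable_indicator[OF A]]])
    also have "\<dots> = (\<integral>\<^sup>+x. \<integral>\<^sup>+w. indicator {v. (x, x + v) \<in> A} (W 1 w) \<partial>M \<partial>torus_vol)"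
      by (intro nn_integral_cong) (simp add: torus_path_apply W_0 indicator_def)
    also have "\<dots> = (\<integral>\<^sup>+x. emeasure (distr M borel (W 1)) {v. (x, x + v) \<in> A} \<partial>torus_vol)"
    proof (rule nn_integral_cong)
      fix x
      have "(\<integral>\<^sup>+w. indicator {v. (x, x + v) \<in> A} (W 1 w) \<partial>M) =
        (\<integral>\<^sup>+v. indicator {v. (x, x + v) \<in> A} v \<partial>distr M borel (W 1))"
        by (rule nn_integral_distr[symmetric]) measurable
      then show "(\<integral>\<^sup>+w. indicator {v. (x, x + v) \<in> A} (W 1 w) \<partial>M) =
        emeasure (distr M borel (W 1)) {v. (x, x + v) \<in> A}" by simp
    qed
    also have "\<dots> \<le> (\<integral>\<^sup>+x. ennreal C * emeasure torus_vol {v. (x, x + v) \<in> A} \<partial>torus_vol)"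
      using C(2) unfolding WW by (intro nn_integral_mono) auto
    also have "\<dots> = (\<integral>\<^sup>+x. ennreal C * (\<integral>\<^sup>+y. indicator A (x, y) \<partial>torus_vol) \<partial>torus_vol)"
    proof (intro nn_integral_cong arg_cong[where f = "(*) (ennreal C)"])
      fix x
      have "emeasure torus_vol {v. (x, x + v) \<in> A} = (\<integral>\<^sup>+v. indicator {v. (x, x + v) \<in> A} v \<partial>torus_vol)"
        by simp
      also have "\<dots> = (\<integral>\<^sup>+v. indicator A (x, x + v) \<partial>torus_vol)"
        by (intro nn_integral_cong) (simp add: indicator_def)
      also have "\<dots> = (\<integral>\<^sup>+y. indicator A (x, y) \<partial>torus_vol)"
        by (rule nn_integral_torus_vol_translate(2)) measurable
      finally show "emeasure torus_vol {v. (x, x + v) \<in> A} = (\<integral>\<^sup>+y. indicator A (x, y) \<partial>torus_vol)" .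
    qed
    also have "\<dots> = ennreal C * emeasure (torus_vol \<Otimes>\<^sub>M torus_vol) A"
      by (subst torus_vol.emeasure_pair_measure, simp add: pair_torus_vol, subst nn_integral_cmult)
        simp_all
    finally show "emeasure (endpoint_law R) A \<le> ennreal C * emeasure (torus_vol \<Otimes>\<^sub>M torus_vol) A" .
  qed
qed

text \<open>One computation for both halves of the time interval, with their roles exchanged. The
  factor \<open>k\<close> is spent on making the end point uniform, \<open>f\<close> then gives the
  endpoint pair its prescribed law, and \<open>\<kappa>\<close> stays with \<open>Z\<close>: after
  reweighting, \<open>Z\<close> and the endpoints are independent.\<close>

lemma nn_integral_reweighted:
  fixes V :: "'m \<Rightarrow> 'n torus" and k \<kappa> :: "'n torus \<Rightarrow> real" and f :: "'n torus \<times> 'n torus \<Rightarrow> real"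
    and \<Psi> :: "'n torus \<Rightarrow> 'n torus \<Rightarrow> 's \<Rightarrow> ennreal"
  assumes Z[measurable]: "Z \<in> M \<rightarrow>\<^sub>M S" and V[measurable]: "V \<in> borel_measurable M"
    and u[measurable]: "u \<in> borel_measurable S"
    and ind: "distr M (S \<Otimes>\<^sub>M borel) (\<lambda>w. (Z w, V w)) = distr M S Z \<Otimes>\<^sub>M distr M borel V"
    and k[measurable]: "k \<in> borel_measurable borel" and unif: "density (distr M borel V) k = torus_vol"
    and \<kappa>[measurable]: "\<kappa> \<in> borel_measurable borel"
    and f[measurable]: "f \<in> borel_measurable (borel \<Otimes>\<^sub>M borel)"
    and nn: "\<And>x. 0 \<le> k x" "\<And>x. 0 \<le> \<kappa> x" "\<And>z. 0 \<le> f z"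
    and \<Psi>[measurable]: "(\<lambda>(x, y, z). \<Psi> x y z) \<in> borel_measurable (borel \<Otimes>\<^sub>M borel \<Otimes>\<^sub>M S)"
    and h[measurable]: "h \<in> borel_measurable path_space"
    and h_path: "\<And>x w. w \<in> space M \<Longrightarrow> h (torus_path a B x w) =
      f (x, x + (u (Z w) + V w)) * \<kappa> (u (Z w)) * k (V w)"
    and \<Phi>[measurable]: "\<Phi> \<in> borel_measurable path_space"
    and \<Phi>_path: "\<And>x w. w \<in> space M \<Longrightarrow> \<Phi> (torus_path a B x w) = \<Psi> x (x + (u (Z w) + V w)) (Z w)"
  shows "(\<integral>\<^sup>+\<omega>. \<Phi> \<omega> \<partial>density R h) =
    (\<integral>\<^sup>+w. ennreal (\<kappa> (u (Z w))) *
      (\<integral>\<^sup>+z. \<Psi> (fst z) (snd z) (Z w) \<partial>density (torus_vol \<Otimes>\<^sub>M torus_vol) f) \<partial>M)"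
proof -
  interpret pair_sigma_finite "torus_vol \<Otimes>\<^sub>M torus_vol" M ..
  have f'[measurable]: "f \<in> borel_measurable (torus_vol \<Otimes>\<^sub>M torus_vol)"
    using f unfolding measurable_cong_sets[OF pair_torus_vol refl] .
  have \<Psi>Z[measurable]: "(\<lambda>(z, w). \<Psi> (fst z) (snd z) (Z w)) \<in>
      borel_measurable ((torus_vol \<Otimes>\<^sub>M torus_vol) \<Otimes>\<^sub>M M)"
  proof -
    have "(\<lambda>(z, w). (fst z, snd z, Z w)) \<in> (torus_vol \<Otimes>\<^sub>M torus_vol) \<Otimes>\<^sub>M M \<rightarrow>\<^sub>M borel \<Otimes>\<^sub>M borel \<Otimes>\<^sub>M S"
      by measurable
    from measurable_compose[OF this \<Psi>] show ?thesis by (simp add: case_prod_beta')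
  qed
  have "(\<integral>\<^sup>+\<omega>. \<Phi> \<omega> \<partial>density R h) = (\<integral>\<^sup>+\<omega>. ennreal (h \<omega>) * \<Phi> \<omega> \<partial>R)"
    by (rule nn_integral_density) simp_all
  also have "\<dots> = (\<integral>\<^sup>+x. \<integral>\<^sup>+w. ennreal (h (torus_path a B x w)) * \<Phi> (torus_path a B x w) \<partial>M \<partial>torus_vol)"
    by (rule nn_integral_R) measurable
  \<comment> \<open>All factors except \<open>k (V w)\<close> depend only on the endpoints and on
    \<open>Z w\<close>, which is the shape needed for \<open>nn_integral_uniformize\<close>.\<close>
  also have "\<dots> = (\<integral>\<^sup>+x. \<integral>\<^sup>+w. (\<lambda>x y z. ennreal (f (x, y)) * ennreal (\<kappa> (u z)) * \<Psi> x y z)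
      x (x + (u (Z w) + V w)) (Z w) * ennreal (k (V w)) \<partial>M \<partial>torus_vol)"
    using nn by (intro nn_integral_cong) (simp add: h_path \<Phi>_path ennreal_mult mult_ac)
  also have "\<dots> = (\<integral>\<^sup>+x. \<integral>\<^sup>+y. \<integral>\<^sup>+w. ennreal (f (x, y)) * ennreal (\<kappa> (u (Z w))) * \<Psi> x y (Z w)
      \<partial>M \<partial>torus_vol \<partial>torus_vol)"
  proof (rule nn_integral_uniformize[OF Z V u ind k unif])
    note \<Psi>[unfolded case_prod_beta', measurable]
    show "(\<lambda>(x, y, z). ennreal (f (x, y)) * ennreal (\<kappa> (u z)) * \<Psi> x y z)
        \<in> borel_measurable (borel \<Otimes>\<^sub>M borel \<Otimes>\<^sub>M S)"
      unfolding case_prod_beta' by measurable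
  qed
  also have "\<dots> = (\<integral>\<^sup>+z. \<integral>\<^sup>+w. ennreal (f z) * ennreal (\<kappa> (u (Z w))) * \<Psi> (fst z) (snd z) (Z w)
      \<partial>M \<partial>(torus_vol \<Otimes>\<^sub>M torus_vol))"
    by (subst torus_vol.nn_integral_fst[symmetric]) simp_all
  also have "\<dots> = (\<integral>\<^sup>+w. \<integral>\<^sup>+z. ennreal (f z) * ennreal (\<kappa> (u (Z w))) * \<Psi> (fst z) (snd z) (Z w)
      \<partial>(torus_vol \<Otimes>\<^sub>M torus_vol) \<partial>M)"
    by (rule Fubini'[symmetric]) measurable
  also have "\<dots> = (\<integral>\<^sup>+w. ennreal (\<kappa> (u (Z w))) *
      (\<integral>\<^sup>+z. \<Psi> (fst z) (snd z) (Z w) \<partial>density (torus_vol \<Otimes>\<^sub>M torus_vol) f) \<partial>M)"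
  proof (rule nn_integral_cong)
    fix w assume w: "w \<in> space M"
    have \<Psi>w[measurable]: "(\<lambda>z. \<Psi> (fst z) (snd z) (Z w)) \<in> borel_measurable (torus_vol \<Otimes>\<^sub>M torus_vol)"
      using measurable_compose[OF measurable_Pair2'[OF w] \<Psi>Z] by simp
    show "(\<integral>\<^sup>+z. ennreal (f z) * ennreal (\<kappa> (u (Z w))) * \<Psi> (fst z) (snd z) (Z w)
        \<partial>(torus_vol \<Otimes>\<^sub>M torus_vol)) = ennreal (\<kappa> (u (Z w))) *
      (\<integral>\<^sup>+z. \<Psi> (fst z) (snd z) (Z w) \<partial>density (torus_vol \<Otimes>\<^sub>M torus_vol) f)"
      by (subst nn_integral_density, measurable, subst nn_integral_cmult[symmetric], measurable)
        (simp add: mult_ac)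
  qed
  finally show ?thesis .
qed

text \<open>For the entropy estimate, the bound of \<open>h\<close> by a multiple of
  \<open>f\<close> at the endpoints is enough; it reduces the entropy on path space to that of the
  endpoint law.\<close>

lemma ex_admissible_density:
  fixes f :: "'n torus \<times> 'n torus \<Rightarrow> real"
  assumes f[measurable]: "f \<in> borel_measurable (borel \<Otimes>\<^sub>M borel)" and f_nn: "\<And>z. 0 \<le> f z"
    and \<pi>: "\<pi> = density (torus_vol \<Otimes>\<^sub>M torus_vol) f" "prob_space \<pi>"
    and fst: "distr \<pi> borel fst = torus_vol" and snd: "distr \<pi> borel snd = torus_vol"
  obtains h C where "h \<in> borel_measurable path_space" "\<And>\<omega>. 0 \<le> h \<omega>" "0 \<le> C"
    "\<And>\<omega>. h \<omega> \<le> C * f (\<omega> 0, \<omega> 1)" "density R h \<in> admissible \<pi>"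
proof -
  interpret \<pi>: prob_space \<pi> by fact
  have sets_\<pi>: "sets \<pi> = sets (borel \<Otimes>\<^sub>M borel)" by (simp add: \<pi>(1) pair_torus_vol)
  have fst_m[measurable]: "fst \<in> \<pi> \<rightarrow>\<^sub>M borel" and snd_m[measurable]: "snd \<in> \<pi> \<rightarrow>\<^sub>M borel"
    unfolding measurable_cong_sets[OF sets_\<pi> refl] by measurable
  have W_half[measurable]: "W (1 / 2) \<in> borel_measurable M" and W_one[measurable]: "W 1 \<in> borel_measurable M"
    by simp_all
  let ?V = "\<lambda>w. W 1 w - W (1 / 2) w"
  obtain C1 k1 where k1: "0 \<le> C1" "k1 \<in> borel_measurable borel" "\<And>x. 0 \<le> k1 x" "\<And>x. k1 x \<le> C1"
    "density (distr M borel (\<lambda>w. W (1 / 2) w - W 0 w)) (\<lambda>x. ennreal (k1 x)) = torus_vol"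
    by (rule W_diff_density[of 0 "1 / 2"]) auto
  have "distr M borel (\<lambda>w. W (1 / 2) w - W 0 w) = distr M borel (W (1 / 2))"
    by (intro distr_cong) (auto simp: W_0)
  with k1(5) have k1': "density (distr M borel (W (1 / 2))) (\<lambda>x. ennreal (k1 x)) = torus_vol" by simp
  obtain C2 k2 where k2: "0 \<le> C2" "k2 \<in> borel_measurable borel" "\<And>x. 0 \<le> k2 x" "\<And>x. k2 x \<le> C2"
    "density (distr M borel ?V) (\<lambda>x. ennreal (k2 x)) = torus_vol"
    by (rule W_diff_density[of "1 / 2" 1]) auto
  note k1(2)[measurable] k2(2)[measurable]
  define h where "h \<omega> = f (\<omega> 0, \<omega> 1) * k1 (\<omega> (1 / 2) - \<omega> 0) * k2 (\<omega> 1 - \<omega> (1 / 2))"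
    for \<omega> :: "real \<Rightarrow> 'n torus"
  have h: "h \<in> borel_measurable path_space"
  proof -
    note endpoints_measurable[measurable]
    show ?thesis unfolding h_def[abs_def] by measurable
  qed
  have h_nn: "0 \<le> h \<omega>" for \<omega> using f_nn k1(3) k2(3) by (simp add: h_def)
  have h_path: "h (torus_path a B x w) = f (x, x + W 1 w) * k1 (W (1 / 2) w) * k2 (?V w)"
    if "w \<in> space M" for x w
    using W_0[OF that] by (simp add: h_def torus_path_apply)
  have mass1: "(\<integral>\<^sup>+w. ennreal (k1 (W (1 / 2) w)) \<partial>M) = 1"
  proof -
    have "(\<integral>\<^sup>+w. ennreal (k1 (W (1 / 2) w)) \<partial>M) = (\<integral>\<^sup>+x. ennreal (k1 x) \<partial>distr M borel (W (1 / 2)))"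
      by (rule nn_integral_distr[symmetric]) measurable
    also have "\<dots> = emeasure (density (distr M borel (W (1 / 2))) k1) UNIV"
      by (subst emeasure_density) simp_all
    finally show ?thesis using torus_vol.emeasure_space_1 by (simp add: k1')
  qed
  have mass2: "(\<integral>\<^sup>+w. ennreal (k2 (?V w)) \<partial>M) = 1"
  proof -
    have "(\<integral>\<^sup>+w. ennreal (k2 (?V w)) \<partial>M) = (\<integral>\<^sup>+x. ennreal (k2 x) \<partial>distr M borel ?V)"
      by (rule nn_integral_distr[symmetric]) measurable
    also have "\<dots> = emeasure (density (distr M borel ?V) k2) UNIV"
      by (subst emeasure_density) simp_all
    finally show ?thesis using torus_vol.emeasure_space_1 by (simp add: k2(5))
  qed
  let ?u = "\<lambda>z :: (real ^ 'n) \<times> (real ^ 'n). torus_proj (sqrt a *\<^sub>R snd z)"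
  have u_m: "?u \<in> borel_measurable (borel \<Otimes>\<^sub>M borel)" by measurable
  \<comment> \<open>The increment over \<open>[1/2, 1]\<close> is made uniform by \<open>k2\<close>,
    so observables of the first half are independent of the endpoints and carry the weight
    \<open>k1\<close>.\<close>
  have past: "(\<integral>\<^sup>+\<omega>. \<Phi> \<omega> \<partial>density R h) = (\<integral>\<^sup>+w. ennreal (k1 (W (1 / 2) w)) *
      (\<integral>\<^sup>+z. \<Psi> (fst z) (snd z) (B p w, B (1 / 2) w) \<partial>\<pi>) \<partial>M)"
    if p: "0 < p" "p < 1 / 2" and \<Psi>: "(\<lambda>(x, y, z). \<Psi> x y z) \<in> borel_measurable (borel \<Otimes>\<^sub>M borel \<Otimes>\<^sub>M borel \<Otimes>\<^sub>M borel)"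
      and \<Phi>: "\<Phi> \<in> borel_measurable path_space"
      and \<Phi>_path: "\<And>x w. w \<in> space M \<Longrightarrow> \<Phi> (torus_path a B x w) = \<Psi> x (x + W 1 w) (B p w, B (1 / 2) w)"
    for p \<Phi> \<Psi>
  proof -
    have [measurable]: "B p \<in> borel_measurable M" "B (1 / 2) \<in> borel_measurable M"
      using p by simp_all
    have u: "?u (B p w, B (1 / 2) w) = W (1 / 2) w" for w by (simp add: W_def)
    have "(\<integral>\<^sup>+\<omega>. \<Phi> \<omega> \<partial>density R h) = (\<integral>\<^sup>+w. ennreal (k1 (?u (B p w, B (1 / 2) w))) *
      (\<integral>\<^sup>+z. \<Psi> (fst z) (snd z) (B p w, B (1 / 2) w) \<partial>density (torus_vol \<Otimes>\<^sub>M torus_vol) f) \<partial>M)"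
    proof (rule nn_integral_reweighted[OF _ _ u_m _ k2(2,5) k1(2) f k2(3) k1(3) f_nn \<Psi> h _ \<Phi>])
      show "distr M ((borel \<Otimes>\<^sub>M borel) \<Otimes>\<^sub>M borel) (\<lambda>w. ((B p w, B (1 / 2) w), ?V w)) =
          distr M (borel \<Otimes>\<^sub>M borel) (\<lambda>w. (B p w, B (1 / 2) w)) \<Otimes>\<^sub>M distr M borel ?V"
        using p by (intro indep_past) auto
      have sum: "W (1 / 2) w + ?V w = W 1 w" for w by simp
      show "h (torus_path a B x w) = f (x, x + (?u (B p w, B (1 / 2) w) + ?V w)) *
          k1 (?u (B p w, B (1 / 2) w)) * k2 (?V w)" if "w \<in> space M" for x w
        unfolding u sum by (rule h_path[OF that])
      show "\<Phi> (torus_path a B x w) = \<Psi> x (x + (?u (B p w, B (1 / 2) w) + ?V w)) (B p w, B (1 / 2) w)"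
        if "w \<in> space M" for x w
        unfolding u sum by (rule \<Phi>_path[OF that])
    qed measurable
    then show ?thesis by (simp only: u \<pi>(1))
  qed
  \<comment> \<open>Roles exchanged: \<open>W (1 / 2)\<close> is made uniform by \<open>k1\<close>,
    and the second half, seen from the end point, carries the weight \<open>k2\<close>.\<close>
  have future: "(\<integral>\<^sup>+\<omega>. \<Phi> \<omega> \<partial>density R h) = (\<integral>\<^sup>+w. ennreal (k2 (?V w)) *
      (\<integral>\<^sup>+z. \<Psi> (fst z) (snd z) (B 1 w - B q w, B 1 w - B (1 / 2) w) \<partial>\<pi>) \<partial>M)"
    if q: "1 / 2 < q" "q < 1" and \<Psi>: "(\<lambda>(x, y, z). \<Psi> x y z) \<in> borel_measurable (borel \<Otimes>\<^sub>M borel \<Otimes>\<^sub>M borel \<Otimes>\<^sub>M borel)"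
      and \<Phi>: "\<Phi> \<in> borel_measurable path_space"
      and \<Phi>_path: "\<And>x w. w \<in> space M \<Longrightarrow> \<Phi> (torus_path a B x w) =
        \<Psi> x (x + W 1 w) (B 1 w - B q w, B 1 w - B (1 / 2) w)"
    for q \<Phi> \<Psi>
  proof -
    have [measurable]: "B q \<in> borel_measurable M" "B (1 / 2) \<in> borel_measurable M" "B 1 \<in> borel_measurable M"
      using q by simp_all
    have u: "?u (B 1 w - B q w, B 1 w - B (1 / 2) w) = ?V w" for w by (simp add: W_diff)
    have "(\<integral>\<^sup>+\<omega>. \<Phi> \<omega> \<partial>density R h) = (\<integral>\<^sup>+w. ennreal (k2 (?u (B 1 w - B q w, B 1 w - B (1 / 2) w))) *
      (\<integral>\<^sup>+z. \<Psi> (fst z) (snd z) (B 1 w - B q w, B 1 w - B (1 / 2) w)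
        \<partial>density (torus_vol \<Otimes>\<^sub>M torus_vol) f) \<partial>M)"
    proof (rule nn_integral_reweighted[OF _ W_half u_m _ k1(2) k1' k2(2) f k1(3) k2(3) f_nn \<Psi> h _ \<Phi>])
      show "distr M ((borel \<Otimes>\<^sub>M borel) \<Otimes>\<^sub>M borel)
            (\<lambda>w. ((B 1 w - B q w, B 1 w - B (1 / 2) w), W (1 / 2) w)) =
          distr M (borel \<Otimes>\<^sub>M borel) (\<lambda>w. (B 1 w - B q w, B 1 w - B (1 / 2) w)) \<Otimes>\<^sub>M
          distr M borel (W (1 / 2))"
        using q by (intro indep_future) auto
      have sum: "?V w + W (1 / 2) w = W 1 w" for w by simp
      show "h (torus_path a B x w) =
          f (x, x + (?u (B 1 w - B q w, B 1 w - B (1 / 2) w) + W (1 / 2) w)) *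
          k2 (?u (B 1 w - B q w, B 1 w - B (1 / 2) w)) * k1 (W (1 / 2) w)" if "w \<in> space M" for x w
        unfolding u sum h_path[OF that] by simp
      show "\<Phi> (torus_path a B x w) =
          \<Psi> x (x + (?u (B 1 w - B q w, B 1 w - B (1 / 2) w) + W (1 / 2) w))
            (B 1 w - B q w, B 1 w - B (1 / 2) w)" if "w \<in> space M" for x w
        unfolding u sum by (rule \<Phi>_path[OF that])
    qed measurable
    then show ?thesis by (simp only: u \<pi>(1))
  qed
  let ?P = "density R h"
  \<comment> \<open>The time \<open>1 / 4\<close> is arbitrary, as the observable ignores its third
    argument; what remains of the weight has mass \<open>1\<close> by \<open>mass1\<close>.\<close>
  have endpoint: "(\<integral>\<^sup>+\<omega>. \<Psi> (\<omega> 0) (\<omega> 1) \<partial>?P) = (\<integral>\<^sup>+z. \<Psi> (fst z) (snd z) \<partial>\<pi>)"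
    if [measurable]: "(\<lambda>(x, y). \<Psi> x y) \<in> borel_measurable (borel \<Otimes>\<^sub>M borel)" for \<Psi>
  proof -
    have "(\<lambda>\<omega>. (\<omega> 0, \<omega> 1)) \<in> path_space \<rightarrow>\<^sub>M borel \<Otimes>\<^sub>M (borel :: 'n torus measure)"
      by (intro measurable_Pair endpoints_measurable)
    from measurable_compose[OF this that]
    have m: "(\<lambda>\<omega>. \<Psi> (\<omega> 0) (\<omega> 1)) \<in> borel_measurable path_space" by simp
    have "(\<integral>\<^sup>+\<omega>. \<Psi> (\<omega> 0) (\<omega> 1) \<partial>?P) = (\<integral>\<^sup>+w. ennreal (k1 (W (1 / 2) w)) *
      (\<integral>\<^sup>+z. (\<lambda>x y _. \<Psi> x y) (fst z) (snd z) (B (1 / 4) w, B (1 / 2) w) \<partial>\<pi>) \<partial>M)"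
      by (rule past[of "1 / 4"]) (use m in \<open>simp_all add: torus_path_apply W_0\<close>)
    also have "\<dots> = (\<integral>\<^sup>+z. \<Psi> (fst z) (snd z) \<partial>\<pi>)"
      by (subst nn_integral_multc) (simp_all add: mass1)
    finally show ?thesis .
  qed
  have "emeasure ?P (space ?P) = (\<integral>\<^sup>+\<omega>. 1 \<partial>?P)" by simp
  also have "\<dots> = (\<integral>\<^sup>+z. 1 \<partial>\<pi>)" by (rule endpoint) simp
  also have "\<dots> = 1" by (simp add: \<pi>.emeasure_space_1)
  finally have prob: "prob_space ?P" by (rule prob_spaceI)
  have sets_P: "sets ?P = sets path_space" by (simp add: sets_R)
  have coord: "(\<lambda>\<omega>. \<omega> t) \<in> ?P \<rightarrow>\<^sub>M borel" if "t \<in> {0..1}" for t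
    unfolding measurable_cong_sets[OF sets_P refl] by (rule measurable_path_coord[OF that])
  have endpoint_P: "endpoint_law ?P = \<pi>"
  proof (rule measure_eqI)
    show "sets (endpoint_law ?P) = sets \<pi>" by (simp add: endpoint_law_def sets_\<pi>)
    fix A assume "A \<in> sets (endpoint_law ?P)"
    then have A[measurable]: "A \<in> sets (borel \<Otimes>\<^sub>M borel)" by (simp add: endpoint_law_def)
    have "(\<lambda>\<omega>. (\<omega> 0, \<omega> 1)) \<in> ?P \<rightarrow>\<^sub>M borel \<Otimes>\<^sub>M borel"
      by (intro measurable_Pair coord) auto
    then have "(\<integral>\<^sup>+z. indicator A z \<partial>endpoint_law ?P) = (\<integral>\<^sup>+\<omega>. indicator A (\<omega> 0, \<omega> 1) \<partial>?P)"
      unfolding endpoint_law_def by (rule nn_integral_distr) measurable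
    also have "\<dots> = (\<integral>\<^sup>+z. indicator A (fst z, snd z) \<partial>\<pi>)"
      by (rule endpoint) measurable
    finally show "emeasure (endpoint_law ?P) A = emeasure \<pi> A"
      using A by (simp add: endpoint_law_def sets_\<pi>)
  qed
  have marginal_P: "marginal ?P t = torus_vol" if t: "t \<in> {0..1}" for t
  proof (rule measure_eqI)
    show "sets (marginal ?P t) = sets torus_vol" by (simp add: marginal_def)
    fix A assume "A \<in> sets (marginal ?P t)"
    then have A[measurable]: "A \<in> sets borel" by (simp add: marginal_def)
    have m: "(\<lambda>\<omega>. indicator A (\<omega> t) :: ennreal) \<in> borel_measurable path_space"
      using measurable_path_coord[OF t] by measurable
    \<comment> \<open>The displacement is frozen while integrating over \<open>\<pi>\<close>. Its
      first marginal is the volume, so the result is the same for every \<open>c\<close>, and only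
      the mass of the remaining weight is left.\<close>
    have fst_shift: "(\<integral>\<^sup>+z. indicator A (fst z + c) \<partial>\<pi>) = emeasure torus_vol A" for c
    proof -
      have "(\<integral>\<^sup>+z. indicator A (fst z + c) \<partial>\<pi>) = (\<integral>\<^sup>+x. indicator A (x + c) \<partial>distr \<pi> borel fst)"
        by (rule nn_integral_distr[symmetric]) measurable
      also have "\<dots> = (\<integral>\<^sup>+x. indicator A x \<partial>torus_vol)"
        unfolding fst by (rule nn_integral_torus_vol_translate(1)) measurable
      finally show ?thesis by simp
    qed
    have snd_shift: "(\<integral>\<^sup>+z. indicator A (snd z - c) \<partial>\<pi>) = emeasure torus_vol A" for c
    proof -
      have "(\<integral>\<^sup>+z. indicator A (snd z + - c) \<partial>\<pi>) = (\<integral>\<^sup>+x. indicator A (x + - c) \<partial>distr \<pi> borel snd)"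
        by (rule nn_integral_distr[symmetric]) measurable
      also have "\<dots> = (\<integral>\<^sup>+x. indicator A x \<partial>torus_vol)"
        unfolding snd by (rule nn_integral_torus_vol_translate(1)) measurable
      finally show ?thesis by simp
    qed
    have "(\<integral>\<^sup>+\<omega>. indicator A (\<omega> t) \<partial>?P) = emeasure torus_vol A"
    proof (cases "t \<le> 1 / 2")
      case True
      \<comment> \<open>\<open>past\<close> needs \<open>0 < p < 1 / 2\<close> strictly. At
        \<open>t = 0\<close> and \<open>t = 1 / 2\<close> the auxiliary time \<open>1 / 4\<close> is
        used, and \<open>W t\<close> is constant or read from the second component.\<close>
      have "\<exists>p y. 0 < p \<and> p < 1 / 2 \<and> y \<in> borel_measurable (borel \<Otimes>\<^sub>M borel) \<and>
        (\<forall>w\<in>space M. W t w = y (B p w, B (1 / 2) w))"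
      proof -
        consider "t = 0" | "t = 1 / 2" | "0 < t" "t < 1 / 2" using t True by force
        then show ?thesis
        proof cases
          case 1
          then show ?thesis by (intro exI[of _ "1 / 4"] exI[of _ "\<lambda>_. 0"]) (simp add: W_0)
        next
          case 2
          show ?thesis unfolding 2 by (intro exI[of _ "1 / 4"] exI[of _ ?u]) (simp add: W_def)
        next
          case 3
          then show ?thesis
            by (intro exI[of _ t] exI[of _ "\<lambda>z. torus_proj (sqrt a *\<^sub>R fst z)"]) (simp add: W_def)
        qed
      qed
      then obtain p y where p: "0 < p" "p < 1 / 2" and y[measurable]: "y \<in> borel_measurable (borel \<Otimes>\<^sub>M borel)"
        and W_t: "\<And>w. w \<in> space M \<Longrightarrow> W t w = y (B p w, B (1 / 2) w)" by blast
      have "(\<integral>\<^sup>+\<omega>. indicator A (\<omega> t) \<partial>?P) = (\<integral>\<^sup>+w. ennreal (k1 (W (1 / 2) w)) *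
        (\<integral>\<^sup>+z. (\<lambda>x _ z. indicator A (x + y z)) (fst z) (snd z) (B p w, B (1 / 2) w) \<partial>\<pi>) \<partial>M)"
        by (rule past[OF p]) (use m t in \<open>simp_all add: torus_path_apply W_t\<close>)
      also have "\<dots> = emeasure torus_vol A"
        by (simp add: fst_shift nn_integral_multc mass1)
      finally show ?thesis .
    next
      case False
      \<comment> \<open>For late times the position is the end point minus the remaining
        displacement, so the second marginal of \<open>\<pi>\<close> is used. At
        \<open>t = 1\<close> the displacement is \<open>0\<close> and \<open>3 / 4\<close> is an
        auxiliary time.\<close>
      have "\<exists>q y. 1 / 2 < q \<and> q < 1 \<and> y \<in> borel_measurable (borel \<Otimes>\<^sub>M borel) \<and>
        (\<forall>w\<in>space M. W t w = W 1 w - y (B 1 w - B q w, B 1 w - B (1 / 2) w))"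
      proof (cases "t = 1")
        case True
        then show ?thesis by (intro exI[of _ "3 / 4"] exI[of _ "\<lambda>_. 0"]) simp
      next
        case F: False
        then show ?thesis using t False
          by (intro exI[of _ t] exI[of _ "\<lambda>z. torus_proj (sqrt a *\<^sub>R fst z)"])
            (simp add: W_diff[symmetric])
      qed
      then obtain q y where q: "1 / 2 < q" "q < 1" and y[measurable]: "y \<in> borel_measurable (borel \<Otimes>\<^sub>M borel)"
        and W_t: "\<And>w. w \<in> space M \<Longrightarrow> W t w = W 1 w - y (B 1 w - B q w, B 1 w - B (1 / 2) w)" by blast
      have "(\<integral>\<^sup>+\<omega>. indicator A (\<omega> t) \<partial>?P) = (\<integral>\<^sup>+w. ennreal (k2 (?V w)) *
        (\<integral>\<^sup>+z. (\<lambda>_ x z. indicator A (x - y z)) (fst z) (snd z) (B 1 w - B q w, B 1 w - B (1 / 2) w) \<partial>\<pi>) \<partial>M)"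
        by (rule future[OF q]) (use m t in \<open>simp_all add: torus_path_apply W_t add_diff_eq\<close>)
      also have "\<dots> = emeasure torus_vol A"
        by (simp add: snd_shift nn_integral_multc mass2)
      finally show ?thesis .
    qed
    moreover have "(\<integral>\<^sup>+x. indicator A x \<partial>marginal ?P t) = (\<integral>\<^sup>+\<omega>. indicator A (\<omega> t) \<partial>?P)"
      unfolding marginal_def by (rule nn_integral_distr[OF coord[OF t]]) measurable
    ultimately show "emeasure (marginal ?P t) A = emeasure torus_vol A"
      using A by (simp add: marginal_def)
  qed
  show thesis
  proof (rule that[OF h h_nn])
    show "0 \<le> C1 * C2" using k1(1) k2(1) by simp
    show "h \<omega> \<le> C1 * C2 * f (\<omega> 0, \<omega> 1)" for \<omega>
    proof -
      have "k1 (\<omega> (1 / 2) - \<omega> 0) * k2 (\<omega> 1 - \<omega> (1 / 2)) \<le> C1 * C2"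
        using k1 k2 by (intro mult_mono) auto
      then have "f (\<omega> 0, \<omega> 1) * (k1 (\<omega> (1 / 2) - \<omega> 0) * k2 (\<omega> 1 - \<omega> (1 / 2))) \<le> f (\<omega> 0, \<omega> 1) * (C1 * C2)"
        by (intro mult_left_mono f_nn)
      then show ?thesis by (simp add: h_def mult_ac)
    qed
    show "?P \<in> admissible \<pi>"
      using prob sets_P marginal_P endpoint_P by (simp add: admissible_def)
  qed
qed

end

section \<open>The minimization problem\<close>

text \<open>The constraints become a family of event probabilities: one event for each time and
  Borel set, and one for each measurable set of endpoint pairs.\<close>

lemma ex1_solution:
  fixes R :: "(real \<Rightarrow> 'n::finite torus) measure"
  assumes R: "prob_space R" "sets R = sets path_space"
    and \<pi>: "prob_space \<pi>" "sets \<pi> = sets (borel \<Otimes>\<^sub>M borel)"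
    and P: "P \<in> admissible \<pi>" "rel_entropy P R < \<infinity>"
  shows "\<exists>!P. is_solution R \<pi> P"
proof -
  let ?X = "\<lambda>\<omega> :: real \<Rightarrow> 'n torus. (\<omega> 0, \<omega> 1)"
  define K where "K =
    (\<lambda>(t, S). ((\<lambda>\<omega>. \<omega> t) -` S \<inter> space path_space, measure torus_vol S)) ` ({0..1} \<times> sets borel) \<union>
    (\<lambda>S. (?X -` S \<inter> space path_space, measure \<pi> S)) ` sets (borel \<Otimes>\<^sub>M borel)"
  have X: "?X \<in> path_space \<rightarrow>\<^sub>M borel \<Otimes>\<^sub>M borel"
    by (intro measurable_Pair measurable_path_coord) auto
  have "admissible \<pi> = {P. prob_space P \<and> sets P = sets R \<and> (\<forall>(A, c)\<in>K. measure P A = c)}"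
    unfolding admissible_def
  proof (intro Collect_cong conj_cong refl)
    show "(sets P = sets path_space) = (sets P = sets R)" for P by (simp add: R)
    fix P :: "(real \<Rightarrow> 'n torus) measure" assume P: "prob_space P" "sets P = sets R"
    then have sets: "sets P = sets path_space" and space: "space P = space path_space"
      using R sets_eq_imp_space_eq[of P path_space] by auto
    have "marginal P t = torus_vol \<longleftrightarrow>
        (\<forall>S\<in>sets borel. measure P ((\<lambda>\<omega>. \<omega> t) -` S \<inter> space path_space) = measure torus_vol S)"
      if "t \<in> {0..1}" for t
      unfolding marginal_def space[symmetric]
      using measurable_path_coord[OF that] P(1)
      by (intro distr_eq_iff_measure prob_space_torus_vol)
        (simp_all cong: measurable_cong_sets add: measurable_cong_sets[OF sets refl])
    moreover have "endpoint_law P = \<pi> \<longleftrightarrow>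
        (\<forall>S\<in>sets (borel \<Otimes>\<^sub>M borel). measure P (?X -` S \<inter> space path_space) = measure \<pi> S)"
      unfolding endpoint_law_def space[symmetric]
      using X P(1) \<pi>
      by (intro distr_eq_iff_measure) (simp_all add: measurable_cong_sets[OF sets refl])
    ultimately show "((\<forall>t\<in>{0..1}. marginal P t = torus_vol) \<and> endpoint_law P = \<pi>) =
        (\<forall>(A, c)\<in>K. measure P A = c)"
      by (simp add: K_def ball_Un)
  qed
  moreover have "A \<in> sets R" if "(A, c) \<in> K" for A c
    using that unfolding K_def R(2)
    by (auto intro!: measurable_sets[OF measurable_path_coord] measurable_sets[OF X])
  ultimately show ?thesis
    unfolding is_solution_def using P by (intro ex1_entropy_projection R(1))
qed

theorem corollary5p2:
  fixes M :: "'m measure" and B :: "real \<Rightarrow> 'm \<Rightarrow> real ^ 'n::finite"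
    and a :: real
    and R :: "(real \<Rightarrow> 'n torus) measure"
    and \<pi> :: "('n torus \<times> 'n torus) measure"
  assumes "std_brownian_motion M B" and "a > 0"
    and "R = reversible_brownian_law a M B"
    and "prob_space \<pi>" and "sets \<pi> = sets (borel \<Otimes>\<^sub>M borel)"
    and "distr \<pi> borel fst = torus_vol" and "distr \<pi> borel snd = torus_vol"
  shows "(\<exists>!P. is_solution R \<pi> P) \<longleftrightarrow> rel_entropy \<pi> (endpoint_law R) < \<infinity>"
proof -
  interpret prob_space M using assms(1) by (simp add: std_brownian_motion_def)
  interpret torus_brownian_motion M B a by standard (use assms in auto)
  note R_def = assms(3)
  have R: "prob_space R" "sets R = sets path_space"
    unfolding R_def by (rule prob_space_R, rule sets_R)
  let ?X = "\<lambda>\<omega> :: real \<Rightarrow> 'n torus. (\<omega> 0, \<omega> 1)"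
  have X: "?X \<in> R \<rightarrow>\<^sub>M borel \<Otimes>\<^sub>M borel"
    unfolding measurable_cong_sets[OF R(2) refl]
    by (intro measurable_Pair measurable_path_coord) auto
  show ?thesis
  proof
    assume "\<exists>!P. is_solution R \<pi> P"
    then obtain P where P: "prob_space P" "sets P = sets R" "endpoint_law P = \<pi>" "rel_entropy P R < \<infinity>"
      by (auto simp: is_solution_def admissible_def R)
    from rel_entropy_distr_finite[OF R(1) P(1,2) X P(4)] P(3)
    show "rel_entropy \<pi> (endpoint_law R) < \<infinity>" by (simp add: endpoint_law_def)
  next
    assume fin: "rel_entropy \<pi> (endpoint_law R) < \<infinity>"
    let ?R01 = "endpoint_law R"
    have R01: "prob_space ?R01" "sets ?R01 = sets (borel \<Otimes>\<^sub>M borel)"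
      unfolding endpoint_law_def using prob_space.prob_space_distr[OF R(1) X] by simp_all
    have sets_\<pi>: "sets \<pi> = sets ?R01" by (simp add: assms(5) R01)
    obtain g :: "_ \<Rightarrow> real" where g: "g \<in> borel_measurable ?R01" "\<And>z. 0 \<le> g z" "\<pi> = density ?R01 g"
      "integrable ?R01 (\<lambda>z. ent (g z))"
      using finite_rel_entropyE[OF R01(1) assms(4) sets_\<pi> fin] by metis
    have g_m[measurable]: "g \<in> borel_measurable (borel \<Otimes>\<^sub>M borel)"
      using g(1) by (simp add: measurable_cong_sets[OF R01(2) refl])
    obtain C where C: "0 \<le> C" "\<And>A. A \<in> sets (torus_vol \<Otimes>\<^sub>M torus_vol) \<Longrightarrow>
        emeasure ?R01 A \<le> ennreal C * emeasure (torus_vol \<Otimes>\<^sub>M torus_vol) A"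
      using endpoint_law_R_le unfolding R_def by blast
    obtain q :: "_ \<Rightarrow> real" where q: "q \<in> borel_measurable (torus_vol \<Otimes>\<^sub>M torus_vol)"
      "\<And>z. 0 \<le> q z" "\<And>z. q z \<le> C" "?R01 = density (torus_vol \<Otimes>\<^sub>M torus_vol) q"
      by (rule bounded_density[OF torus_vol2.finite_measure_axioms _ C(2,1)])
        (simp_all add: R01 pair_torus_vol)
    have q_m[measurable]: "q \<in> borel_measurable (borel \<Otimes>\<^sub>M borel)"
      using q(1) by (simp add: measurable_cong_sets[OF pair_torus_vol refl])
    \<comment> \<open>The chain rule for densities: \<open>g\<close> is that of \<open>\<pi>\<close>
      with respect to the endpoint law, \<open>q\<close> that of the endpoint law with respect to
      the product volume.\<close>
    define f where "f z = q z * g z" for z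
    have f: "f \<in> borel_measurable (borel \<Otimes>\<^sub>M borel)" "\<And>z. 0 \<le> f z"
      unfolding f_def[abs_def] using g(2) q(2) by (measurable, simp)
    have \<pi>_f: "\<pi> = density (torus_vol \<Otimes>\<^sub>M torus_vol) f"
    proof -
      have "g \<in> borel_measurable (torus_vol \<Otimes>\<^sub>M torus_vol)"
        using g_m by (simp add: measurable_cong_sets[OF pair_torus_vol refl])
      then show ?thesis
        unfolding g(3) q(4) using q(1,2) g(2)
        by (subst density_density_eq) (simp_all add: f_def[abs_def] ennreal_mult)
    qed
    obtain h C' where h: "h \<in> borel_measurable path_space" "\<And>\<omega>. 0 \<le> h \<omega>" "0 \<le> C'"
      "\<And>\<omega>. h \<omega> \<le> C' * f (\<omega> 0, \<omega> 1)" "density R h \<in> admissible \<pi>"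
      using ex_admissible_density[OF f \<pi>_f assms(4,6,7)] unfolding R_def by blast
    let ?P = "density R h"
    interpret P: prob_space ?P using h(5) by (simp add: admissible_def)
    interpret \<pi>: prob_space \<pi> by fact
    \<comment> \<open>\<open>C' * C\<close> bounds the ratio of \<open>h\<close> to \<open>g\<close>
      at the endpoints, since \<open>q\<close> is at most \<open>C\<close>. The maximum with
      \<open>1\<close> keeps \<open>ln D\<close> nonnegative, so the next bound also holds for
      negative logarithms and, by \<open>ln 0 = 0\<close>, where \<open>h\<close> vanishes.\<close>
    define D where "D = max 1 (C' * C)"
    have ln_h: "max 0 (ln (h \<omega>)) \<le> max 0 (ln (g (\<omega> 0, \<omega> 1))) + ln D" for \<omega>
    proof (cases "h \<omega> = 0")
      case False
      let ?z = "(\<omega> 0, \<omega> 1)"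
      have "h \<omega> \<le> C' * (q ?z * g ?z)" using h(4)[of \<omega>] by (simp add: f_def)
      also have "\<dots> \<le> C' * (C * g ?z)" using h(3) q(3) g(2) by (intro mult_left_mono mult_right_mono)
      also have "\<dots> \<le> D * g ?z" using g(2) by (auto simp: D_def mult.assoc[symmetric] intro: mult_right_mono)
      finally have le: "h \<omega> \<le> D * g ?z" .
      have pos: "0 < h \<omega>" using False h(2)[of \<omega>] by simp
      with le have "0 < D * g ?z" by linarith
      moreover have D: "1 \<le> D" by (simp add: D_def)
      ultimately have g_pos: "0 < g ?z" using g(2)[of ?z] by (cases "g ?z = 0") auto
      have "ln (h \<omega>) \<le> ln (D * g ?z)" using le pos by simp
      also have "\<dots> = ln D + ln (g ?z)" using D g_pos by (intro ln_mult_pos) auto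
      finally show ?thesis using ln_ge_zero[OF D] by linarith
    qed (simp add: D_def)
    have X_P: "?X \<in> ?P \<rightarrow>\<^sub>M borel \<Otimes>\<^sub>M borel" using X by simp
    have "(\<integral>\<^sup>+\<omega>. ennreal (max 0 (ln (h \<omega>))) \<partial>?P) \<le>
        (\<integral>\<^sup>+\<omega>. ennreal (max 0 (ln (g (?X \<omega>))) + ln D) \<partial>?P)"
      by (intro nn_integral_mono ennreal_leI ln_h)
    \<comment> \<open>The integrand depends on the endpoints only, and their law under
      \<open>?P\<close> is \<open>\<pi>\<close>; this brings the estimate back to the assumed finite
      entropy.\<close>
    also have "\<dots> = (\<integral>\<^sup>+z. ennreal (max 0 (ln (g z)) + ln D) \<partial>distr ?P (borel \<Otimes>\<^sub>M borel) ?X)"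
      by (rule nn_integral_distr[OF X_P, symmetric]) measurable
    also have "distr ?P (borel \<Otimes>\<^sub>M borel) ?X = \<pi>"
      using h(5) by (simp add: admissible_def endpoint_law_def)
    also have "(\<integral>\<^sup>+z. ennreal (max 0 (ln (g z)) + ln D) \<partial>\<pi>) =
        (\<integral>\<^sup>+z. ennreal (max 0 (ln (g z))) \<partial>\<pi>) + ennreal (ln D)"
    proof -
      have "(\<lambda>z. ennreal (max 0 (ln (g z)))) \<in> borel_measurable \<pi>"
        unfolding measurable_cong_sets[OF assms(5) refl] by measurable
      moreover have "0 \<le> ln D" by (simp add: D_def)
      ultimately show ?thesis
        by (simp add: ennreal_plus nn_integral_add \<pi>.emeasure_space_1)
    qed
    also have "\<dots> < \<infinity>"
      using finite_rel_entropy_ln_density[OF g(1,2) _ g(4)] assms(4) g(3) by (simp add: less_top)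
    finally have "rel_entropy ?P R < \<infinity>"
      using h(1,2) P.prob_space_axioms
      by (intro rel_entropy_density_finiteI[OF R(1)]) (simp_all add: measurable_cong_sets[OF R(2) refl])
    then show "\<exists>!P. is_solution R \<pi> P"
      by (intro ex1_solution[OF R assms(4,5) h(5)])
  qed
qed

end
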